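(* Among all $k$-uniform hypertrees with $m$ hyperedges, the second hypertree in $S_\alpha$-order is $F_{m,k}$ for $k\ge3$ and $0<\alpha<1$.
   Context: Hypergraphs are finite; $k$-uniform means every hyperedge has exactly $k$ vertices; a hypertree is a connected hypergraph without cycles; a cored vertex is a vertex of degree one. Let $P_{m-1}$ be the path of length $m-1$ with vertices $v_1,\dots,v_m$ and edges $e_i=\{v_i,v_{i+1}\}$, $i=1,\dots,m-1$; the hyperpath $P_{m-1}^{(k)}$ is obtained from it by inserting $k-2$ new (cored) vertices into each edge $e_i$, giving the hyperedge $e_i^{(k)}$. $F_{m,k}$ is the $k$-uniform hypertree obtained from $P_{m-1}^{(k)}$ by attaching a pendant hyperedge (a new hyperedge consisting of the attachment vertex and $k-1$ new vertices) to a cored vertex on the hyperedge $e_2^{(k)}$. For a $k$-uniform hypergraph $\mathcal{H}$ on $[n]$, $\mathcal{A}(\mathcal{H})$ is the $k$-order $n$-dimensional tensor with entry $\frac1{(k-1)!}$ at $(i_1,\dots,i_k)$ if $\{i_1,\dots,i_k\}\in E(\mathcal{H})$ and $0$ otherwise; $\mathcal{D}(\mathcal{H})$ is the diagonal tensor of vertex degrees; $\mathcal{A}_\alpha(\mathcal{H})=\alpha\mathcal{D}(\mathcal{H})+(1-\alpha)\mathcal{A}(\mathcal{H})$. For a tensor $\mathcal{T}$, $\mathrm{Tr}_d(\mathcal{T})$ is the sum of the $d$-th powers of all $n(k-1)^{n-1}$ eigenvalues of $\mathcal{T}$; in particular $\mathrm{Tr}_0(\mathcal{T})=n(k-1)^{n-1}$,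 and for $d\ge1$ $$\mathrm{Tr}_{d}(\mathcal{T})=(k-1)^{n-1}\sum_{d_1+\cdots+d_n=d}\ \prod_{i=1}^{n}\frac{1}{(d_i(k-1))!}\Big(\sum_{\gamma\in[n]^{k-1}}(\mathcal{T})_{i\gamma}\frac{\partial}{\partial a_{i\gamma}}\Big)^{d_i}\mathrm{tr}\big(A^{d(k-1)}\big),$$ with $A=(a_{ij})$ an $n\times n$ matrix of indeterminates, $d_i\ge0$ integers, $\frac{\partial}{\partial a_{i\gamma}}=\frac{\partial}{\partial a_{i i_2}}\cdots\frac{\partial}{\partial a_{i i_k}}$ for $\gamma=i_2\cdots i_k$. $S_\alpha$-order: for $k$-uniform hypergraphs $\mathcal{H}_1,\mathcal{H}_2$ with $n$ vertices, $\mathcal{H}_1\prec_\alpha\mathcal{H}_2$ ($\mathcal{H}_1$ comes before $\mathcal{H}_2$) if there is $d\in\{1,\dots,n(k-1)^{n-1}-1\}$ with $\mathrm{Tr}_t(\mathcal{A}_\alpha(\mathcal{H}_1))=\mathrm{Tr}_t(\mathcal{A}_\alpha(\mathcal{H}_2))$ for $t=0,\dots,d-1$ and $\mathrm{Tr}_d(\mathcal{A}_\alpha(\mathcal{H}_1))<\mathrm{Tr}_d(\mathcal{A}_\alpha(\mathcal{H}_2))$. The first hypertree $F$ in a class is the member with $F\prec_\alpha\mathcal{H}$ for every other member $\mathcal{H}$ of the class (up to isomorphism); the second is the first among the members other than $F$.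
   Formalization: The number of hyperedges is assumed to satisfy m ≥ 4: for m = 3 the hypertree F_{3,k} is itself the hyperpath, which is first rather than second (the hyperstar is second), and for m ≤ 2 there is no hyperedge e_2, so F_{m,k} is undefined. *)

theory Defs
  imports Complex_Main "HOL-Library.Poly_Mapping" "Jordan_Normal_Form.Matrix"
begin

text \<open>The vertex set [n] is rendered as \<open>{..<n}\<close>.\<close>

datatype hgraph = HG (nverts: nat) (edges: "nat set set")

definition hypergraph :: "hgraph \<Rightarrow> bool" where
  "hypergraph H \<longleftrightarrow> (\<forall>e\<in>edges H. e \<noteq> {} \<and> e \<subseteq> {..<nverts H})"

definition uniform :: "nat \<Rightarrow> hgraph \<Rightarrow> bool" where
  "uniform k H \<longleftrightarrow> hypergraph H \<and> (\<forall>e\<in>edges H. card e = k)"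

definition degree :: "hgraph \<Rightarrow> nat \<Rightarrow> nat" where
  "degree H v = card {e \<in> edges H. v \<in> e}"

definition cored :: "hgraph \<Rightarrow> nat \<Rightarrow> bool" where
  "cored H v \<longleftrightarrow> v < nverts H \<and> degree H v = 1"

definition adjacency_rel :: "hgraph \<Rightarrow> (nat \<times> nat) set" where
  "adjacency_rel H = {(u, v). \<exists>e\<in>edges H. u \<in> e \<and> v \<in> e}"

definition connected_hg :: "hgraph \<Rightarrow> bool" where
  "connected_hg H \<longleftrightarrow> (\<forall>u<nverts H. \<forall>v<nverts H. (u, v) \<in> (adjacency_rel H)\<^sup>*)"

text \<open>Cycles are Berge cycles: an alternating closed sequence
  \<open>v\<^sub>0 e\<^sub>0 v\<^sub>1 e\<^sub>1 \<dots> v\<^sub>s e\<^sub>s v\<^sub>0\<close> of at least two distinct vertices and as many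
  distinct hyperedges. In particular two hyperedges sharing two vertices form a cycle.\<close>

definition hcycle :: "hgraph \<Rightarrow> nat list \<Rightarrow> nat set list \<Rightarrow> bool" where
  "hcycle H vs es \<longleftrightarrow>
     length vs = length es \<and> 2 \<le> length es \<and> distinct vs \<and> distinct es \<and> set es \<subseteq> edges H \<and>
     (\<forall>i<length es. vs ! i \<in> es ! i \<and> vs ! (Suc i mod length es) \<in> es ! i)"

definition hypertree :: "hgraph \<Rightarrow> bool" where
  "hypertree H \<longleftrightarrow> hypergraph H \<and> connected_hg H \<and> (\<nexists>vs es. hcycle H vs es)"

definition hg_iso :: "hgraph \<Rightarrow> hgraph \<Rightarrow> bool" where
  "hg_iso G H \<longleftrightarrow>
     (\<exists>f. bij_betw f {..<nverts G} {..<nverts H} \<and> edges H = (\<lambda>e. f ` e) ` edges G)"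

definition uniform_hypertrees :: "nat \<Rightarrow> nat \<Rightarrow> hgraph set" where
  "uniform_hypertrees k m = {H. hypertree H \<and> uniform k H \<and> card (edges H) = m}"

text \<open>In the hyperpath of length \<open>l\<close> the path vertex \<open>v\<^sub>i\<close> is the number \<open>(i - 1) * (k - 1)\<close>,
  for \<open>1 \<le> i \<le> l + 1\<close>, and the \<open>k - 2\<close> vertices inserted into the edge \<open>{v\<^sub>i, v\<^sub>i\<^sub>+\<^sub>1}\<close> are the
  numbers strictly between \<open>v\<^sub>i\<close> and \<open>v\<^sub>i\<^sub>+\<^sub>1\<close>.\<close>

definition path_hyperedge :: "nat \<Rightarrow> nat \<Rightarrow> nat set" where
  "path_hyperedge k i = {(i - 1) * (k - 1) .. i * (k - 1)}"

definition hyperpath :: "nat \<Rightarrow> nat \<Rightarrow> hgraph" where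
  "hyperpath k l = HG (l * (k - 1) + 1) (path_hyperedge k ` {1..l})"

definition attach_pendant :: "nat \<Rightarrow> hgraph \<Rightarrow> nat \<Rightarrow> hgraph" where
  "attach_pendant k H v =
     HG (nverts H + (k - 1))
        (insert (insert v {nverts H ..< nverts H + (k - 1)}) (edges H))"

text \<open>\<open>F_hg m k c\<close> has its pendant hyperedge attached at \<open>c\<close>. It is the intended hypertree when
  \<open>c\<close> is a cored vertex on the second hyperedge of the hyperpath; the isomorphism type does not
  depend on which such \<open>c\<close> is taken.\<close>

definition F_hg :: "nat \<Rightarrow> nat \<Rightarrow> nat \<Rightarrow> hgraph" where
  "F_hg m k c = attach_pendant k (hyperpath k (m - 1)) c"

lemma ex_cored_on_second_hyperedge:
  assumes "k \<ge> 3" "m \<ge> 3"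
  shows "\<exists>c \<in> path_hyperedge k 2. cored (hyperpath k (m - 1)) c"
proof
  show k2: "k \<in> path_hyperedge k 2"
    using assms by (auto simp: path_hyperedge_def)
  have only: "i = 2" if i: "i \<ge> 1" "(i - 1) * (k - 1) \<le> k" "k \<le> i * (k - 1)" for i
  proof (rule ccontr)
    assume "i \<noteq> 2"
    then consider "i = 1" | "i - 1 \<ge> 2" using i(1) by linarith
    then show False
    proof cases
      case 1
      then show False using i assms by simp
    next
      case 2
      then have "2 * (k - 1) \<le> (i - 1) * (k - 1)" by (rule mult_le_mono1)
      then show False using i assms by linarith
    qed
  qed
  have "i = 2" if "i \<in> {1..m - 1}" "k \<in> path_hyperedge k i" for i
    using that only[of i] by (simp add: path_hyperedge_def)
  moreover note k2
  moreover have "(2::nat) \<in> {1..m - 1}" using assms by simp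
  ultimately have "{e \<in> edges (hyperpath k (m - 1)). k \<in> e} = {path_hyperedge k 2}"
    unfolding hyperpath_def hgraph.sel by blast
  moreover have "k < (m - 1) * (k - 1) + 1"
  proof -
    have "2 * (k - 1) \<le> (m - 1) * (k - 1)" using assms by (intro mult_le_mono1) linarith
    then show ?thesis using assms by linarith
  qed
  ultimately show "cored (hyperpath k (m - 1)) k"
    by (simp add: cored_def degree_def) (simp add: hyperpath_def)
qed

text \<open>A tensor of order \<open>k\<close> and dimension \<open>n\<close> is a function on index lists; only its values on
  lists of length \<open>k\<close> with entries below \<open>n\<close> matter.\<close>

type_synonym tensor = "nat list \<Rightarrow> real"

definition adjacency_tensor :: "nat \<Rightarrow> hgraph \<Rightarrow> tensor" where
  "adjacency_tensor k H = (\<lambda>is. if set is \<in> edges H then 1 / fact (k - 1) else 0)"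

definition degree_tensor :: "nat \<Rightarrow> hgraph \<Rightarrow> tensor" where
  "degree_tensor k H = (\<lambda>is. if is = replicate k (hd is) then real (degree H (hd is)) else 0)"

definition A_tensor :: "real \<Rightarrow> nat \<Rightarrow> hgraph \<Rightarrow> tensor" where
  "A_tensor \<alpha> k H = (\<lambda>is. \<alpha> * degree_tensor k H is + (1 - \<alpha>) * adjacency_tensor k H is)"

text \<open>Real polynomials in the indeterminates \<open>a\<^sub>i\<^sub>j\<close>: finitely supported maps from monomials
  (exponent vectors indexed by pairs \<open>(i, j)\<close>) to coefficients.\<close>

type_synonym ind_poly = "((nat \<times> nat) \<Rightarrow>\<^sub>0 nat) \<Rightarrow>\<^sub>0 real"

definition indet :: "nat \<times> nat \<Rightarrow> ind_poly" where
  "indet x = Poly_Mapping.single (Poly_Mapping.single x 1) 1"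

definition const_poly :: "real \<Rightarrow> ind_poly" where
  "const_poly c = Poly_Mapping.single 0 c"

text \<open>Monomials not containing \<open>x\<close> contribute 0 because of the factor \<open>lookup \<mu> x\<close>, so the
  truncated subtraction of exponents is harmless.\<close>

definition partial_deriv :: "nat \<times> nat \<Rightarrow> ind_poly \<Rightarrow> ind_poly" where
  "partial_deriv x p =
     (\<Sum>\<mu> \<in> Poly_Mapping.keys p.
        Poly_Mapping.single (\<mu> - Poly_Mapping.single x 1)
          (real (Poly_Mapping.lookup \<mu> x) * Poly_Mapping.lookup p \<mu>))"

definition partial_derivs :: "nat \<Rightarrow> nat list \<Rightarrow> ind_poly \<Rightarrow> ind_poly" where
  "partial_derivs i \<gamma> = foldr (\<lambda>j. partial_deriv (i, j)) \<gamma>"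

definition tensor_op :: "nat \<Rightarrow> nat \<Rightarrow> tensor \<Rightarrow> nat \<Rightarrow> ind_poly \<Rightarrow> ind_poly" where
  "tensor_op n k T i p =
     (\<Sum>\<gamma> \<in> {\<gamma>. length \<gamma> = k - 1 \<and> set \<gamma> \<subseteq> {..<n}}.
        const_poly (T (i # \<gamma>)) * partial_derivs i \<gamma> p)"

definition trace_power :: "nat \<Rightarrow> nat \<Rightarrow> ind_poly" where
  "trace_power n N = (\<Sum>i<n. (mat n n indet ^\<^sub>m N) $$ (i, i))"

text \<open>The product over \<open>i\<close> in the trace formula is a composition of commuting operators, taken here
  in the order of \<open>[0..<n]\<close>. The operators have total order \<open>d * (k - 1)\<close>, the degree of the
  polynomial they act on, so the result is a constant polynomial, read off by its coefficient at
  the trivial monomial. The list \<open>ds\<close> ranges over the exponents \<open>d\<^sub>1, \<dots>, d\<^sub>n\<close>.\<close>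

definition Tr :: "nat \<Rightarrow> nat \<Rightarrow> tensor \<Rightarrow> nat \<Rightarrow> real" where
  "Tr n k T d =
     (if d = 0 then real (n * (k - 1) ^ (n - 1))
      else real ((k - 1) ^ (n - 1)) *
        (\<Sum>ds \<in> {ds. length ds = n \<and> sum_list ds = d}.
           Poly_Mapping.lookup
             (foldr (\<lambda>i p. const_poly (1 / fact (ds ! i * (k - 1))) *
                           (tensor_op n k T i ^^ (ds ! i)) p)
                    [0..<n] (trace_power n (d * (k - 1)))) 0))"

definition prec :: "real \<Rightarrow> nat \<Rightarrow> hgraph \<Rightarrow> hgraph \<Rightarrow> bool" where
  "prec \<alpha> k G H \<longleftrightarrow>
     nverts G = nverts H \<and>
     (\<exists>d \<in> {1 .. nverts G * (k - 1) ^ (nverts G - 1) - 1}.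
        (\<forall>t<d. Tr (nverts G) k (A_tensor \<alpha> k G) t = Tr (nverts H) k (A_tensor \<alpha> k H) t) \<and>
        Tr (nverts G) k (A_tensor \<alpha> k G) d < Tr (nverts H) k (A_tensor \<alpha> k H) d)"

definition is_first :: "real \<Rightarrow> nat \<Rightarrow> hgraph set \<Rightarrow> hgraph \<Rightarrow> bool" where
  "is_first \<alpha> k C F \<longleftrightarrow> F \<in> C \<and> (\<forall>H\<in>C. \<not> hg_iso F H \<longrightarrow> prec \<alpha> k F H)"

definition is_second :: "real \<Rightarrow> nat \<Rightarrow> hgraph set \<Rightarrow> hgraph \<Rightarrow> bool" where
  "is_second \<alpha> k C S \<longleftrightarrow>
     (\<exists>F. is_first \<alpha> k C F \<and> is_first \<alpha> k {H \<in> C. \<not> hg_iso F H} S)"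

end

theory Submission
  imports Defs "HOL-Combinatorics.Multiset_Permutations" "HOL-Combinatorics.Transposition"
    "HOL-Computational_Algebra.Formal_Power_Series"
begin

text \<open>
  The product of differential operators in the trace formula pairs a polynomial in the indeterminates
  with the trace of a matrix power, so the trace of order \<open>d\<close> is a sum over closed words whose arcs are
  chosen from loops and hyperedges. Inserting a loop at \<open>v\<close> multiplies the number of closed words,
  with labelled arcs and up to rotation, by the number of visits to \<open>v\<close>; hence the loops contribute
  a factor \<open>1 / (1 - \<alpha> deg(v) x)\<close> per visit. In a closed word in- and outdegrees agree, and peeling
  pendant hyperedges shows that in a hypertree all vertices of a hyperedge then use it equally often.
  For \<open>d < 3 k\<close> only single hyperedges, doubled hyperedges and adjacent pairs are left.

  Comparing traces, order 2 separates the hypertrees with a vertex of degree at least 3 from the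
  others. Among the latter let \<open>q e\<close> be the number of hyperedges adjacent to \<open>e\<close>. The first order
  that can differ is \<open>k + 2\<close>, through the sum of \<open>(q e)\<^sup>2\<close>: it is least for the hyperpath, and next for
  the hypertrees with one hyperedge with \<open>q e = 3\<close> and all others with \<open>q e \<le> 2\<close>. These are separated
  by order \<open>2 k + 2\<close>, through the sum of \<open>q e * q f\<close> over adjacent pairs, which decreases with the
  number of pendant hyperedges at the branching hyperedge; two of them force \<open>F\<close>.
\<close>

section \<open>Linear functionals on polynomials\<close>

text \<open>No weight of a hyperedge is ever computed: \<open>single_weight\<close> and
  \<open>pair_weight\<close> need only be positive, and the doubled hyperedge cancels whenever order
  \<open>2 k\<close> is reached. The shift by 2 in \<open>k + 2\<close> and \<open>2 k + 2\<close>
  comes from the loops: a vertex of degree two instead of one multiplies the series of a hyperedge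
  by \<open>(1 - \<alpha> x) / (1 - 2 \<alpha> x)\<close>, so the coefficient of \<open>x^j\<close>
  is a polynomial of degree \<open>j\<close> in \<open>q e\<close>. As the sum of all
  \<open>q e\<close> is \<open>2 (m - 1)\<close>, the coefficients for \<open>j < 2\<close> carry no
  information. The hypothesis \<open>k \<ge> 3\<close> gives \<open>k + 2 < 2 k\<close> and
  \<open>2 k + 2 < 3 k\<close>, which keeps the contributions of one and of two hyperedges apart and
  excludes three. The obstacle is that the hypertrees with a single branching hyperedge all have the
  same distribution of \<open>q e\<close>, so that no sum over single hyperedges separates them;
  adjacent pairs, which enter at order \<open>2 k\<close>, are the first quantity sensitive to the
  arrangement. The signs are right because \<open>\<alpha> > 0\<close> makes loops count positively
  and \<open>\<alpha> < 1\<close> makes the hyperedge factors positive.\<close>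

definition linear_ext :: "('a \<Rightarrow> real) \<Rightarrow> ('a \<Rightarrow>\<^sub>0 real) \<Rightarrow> real" where
  "linear_ext v Q = (\<Sum>\<mu>\<in>Poly_Mapping.keys Q. Poly_Mapping.lookup Q \<mu> * v \<mu>)"

lemma linear_ext_superset:
  assumes "finite A" "Poly_Mapping.keys Q \<subseteq> A"
  shows "linear_ext v Q = (\<Sum>\<mu>\<in>A. Poly_Mapping.lookup Q \<mu> * v \<mu>)"
  unfolding linear_ext_def
  by (rule sum.mono_neutral_left) (use assms in \<open>auto simp: in_keys_iff\<close>)

lemma linear_ext_zero [simp]: "linear_ext v 0 = 0"
  by (simp add: linear_ext_def)

lemma linear_ext_single [simp]: "linear_ext v (Poly_Mapping.single \<mu> c) = c * v \<mu>"
  by (simp add: linear_ext_def)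

lemma linear_ext_add: "linear_ext v (P + Q) = linear_ext v P + linear_ext v Q"
proof -
  let ?A = "Poly_Mapping.keys P \<union> Poly_Mapping.keys Q"
  have "linear_ext v (P + Q) = (\<Sum>\<mu>\<in>?A. Poly_Mapping.lookup (P + Q) \<mu> * v \<mu>)"
    by (rule linear_ext_superset) (use keys_add[of P Q] in auto)
  moreover have "linear_ext v P = (\<Sum>\<mu>\<in>?A. Poly_Mapping.lookup P \<mu> * v \<mu>)"
    "linear_ext v Q = (\<Sum>\<mu>\<in>?A. Poly_Mapping.lookup Q \<mu> * v \<mu>)"
    by (rule linear_ext_superset; auto)+
  ultimately show ?thesis
    by (simp add: lookup_add distrib_right sum.distrib)
qed

lemma linear_ext_sum: "linear_ext v (\<Sum>x\<in>A. f x) = (\<Sum>x\<in>A. linear_ext v (f x))"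
  by (induction A rule: infinite_finite_induct) (auto simp: linear_ext_add)

text \<open>Bilinear identities are proved by this induction, so that they only have to be checked
  on single monomials.\<close>

lemma single_sum_induct [case_names zero add single]:
  assumes "P 0" "\<And>p q. P p \<Longrightarrow> P q \<Longrightarrow> P (p + q)" "\<And>\<mu> c. P (Poly_Mapping.single \<mu> c)"
  shows "P (Q :: 'a \<Rightarrow>\<^sub>0 'b::comm_monoid_add)"
proof -
  have "P (\<Sum>\<mu>\<in>A. Poly_Mapping.single \<mu> (Poly_Mapping.lookup Q \<mu>))" for A
    by (induction A rule: infinite_finite_induct) (use assms in auto)
  moreover have "(\<Sum>\<mu>\<in>Poly_Mapping.keys Q. Poly_Mapping.single \<mu> (Poly_Mapping.lookup Q \<mu>)) = Q"
    by (rule poly_mapping_eqI) (simp add: lookup_sum lookup_single when_def in_keys_iff)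
  ultimately show ?thesis by metis
qed

section \<open>Differential operators as multiplication operators\<close>

text \<open>The multi-index factorial: the constant left when the monomial \<open>\<mu>\<close> of
  derivatives acts on the monomial \<open>\<mu>\<close>.\<close>

definition mfact :: "('a \<Rightarrow>\<^sub>0 nat) \<Rightarrow> real" where
  "mfact \<mu> = (\<Prod>x\<in>Poly_Mapping.keys \<mu>. fact (Poly_Mapping.lookup \<mu> x))"

lemma mfact_superset:
  assumes "finite A" "Poly_Mapping.keys \<mu> \<subseteq> A"
  shows "mfact \<mu> = (\<Prod>x\<in>A. fact (Poly_Mapping.lookup \<mu> x))"
  unfolding mfact_def
  by (rule prod.mono_neutral_left) (use assms in \<open>auto simp: in_keys_iff\<close>)

lemma mfact_zero [simp]: "mfact 0 = 1"
  by (simp add: mfact_def)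

lemma mfact_pos: "mfact \<mu> > 0"
  by (auto simp: mfact_def intro!: prod_pos)

lemma mfact_add_single:
  "mfact (\<mu> + Poly_Mapping.single x 1) = real (Poly_Mapping.lookup \<mu> x + 1) * mfact \<mu>"
proof -
  let ?A = "insert x (Poly_Mapping.keys \<mu>)"
  have "mfact (\<mu> + Poly_Mapping.single x 1) = (\<Prod>y\<in>?A. fact (Poly_Mapping.lookup (\<mu> + Poly_Mapping.single x 1) y))"
    by (rule mfact_superset) (use keys_add[of \<mu> "Poly_Mapping.single x 1"] in auto)
  also have "\<dots> = fact (Poly_Mapping.lookup \<mu> x + 1) * (\<Prod>y\<in>?A - {x}. fact (Poly_Mapping.lookup \<mu> y))"
  proof -
    have "(\<Prod>y\<in>?A - {x}. fact (Poly_Mapping.lookup (\<mu> + Poly_Mapping.single x 1) y) :: real)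
        = (\<Prod>y\<in>?A - {x}. fact (Poly_Mapping.lookup \<mu> y))"
      by (intro prod.cong refl) (auto simp: lookup_add lookup_single_not_eq)
    then show ?thesis
      by (subst prod.remove[of _ x]) (auto simp: lookup_add)
  qed
  also have "\<dots> = real (Poly_Mapping.lookup \<mu> x + 1) * (\<Prod>y\<in>?A. fact (Poly_Mapping.lookup \<mu> y))"
    by (subst (2) prod.remove[of _ x]) auto
  also have "(\<Prod>y\<in>?A. fact (Poly_Mapping.lookup \<mu> y)) = mfact \<mu>"
    by (rule mfact_superset[symmetric]) auto
  finally show ?thesis .
qed

lemma lookup_partial_deriv:
  "Poly_Mapping.lookup (partial_deriv x p) \<mu>
     = real (Poly_Mapping.lookup \<mu> x + 1) * Poly_Mapping.lookup p (\<mu> + Poly_Mapping.single x 1)"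
proof -
  let ?\<nu> = "\<mu> + Poly_Mapping.single x 1"
  \<comment> \<open>Subtraction of exponents is truncated, so besides \<open>?\<nu>\<close> also
    \<open>\<mu>\<close> itself may be sent to \<open>\<mu>\<close>; it then lacks \<open>x\<close>
    and carries the factor 0.\<close>
  have sub: "\<kappa> = ?\<nu>" if "\<kappa> - Poly_Mapping.single x 1 = \<mu>" "Poly_Mapping.lookup \<kappa> x \<noteq> 0" for \<kappa>
  proof (rule poly_mapping_eqI)
    fix y
    have "Poly_Mapping.lookup (\<kappa> - Poly_Mapping.single x 1) y = Poly_Mapping.lookup \<mu> y"
      using that by simp
    then show "Poly_Mapping.lookup \<kappa> y = Poly_Mapping.lookup ?\<nu> y"
      using that(2) by (auto simp: lookup_minus lookup_add lookup_single when_def split: if_splits)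
  qed
  have "Poly_Mapping.lookup (partial_deriv x p) \<mu> =
      (\<Sum>\<kappa>\<in>Poly_Mapping.keys p. (real (Poly_Mapping.lookup \<kappa> x) * Poly_Mapping.lookup p \<kappa>
         when \<kappa> - Poly_Mapping.single x 1 = \<mu>))"
    by (simp add: partial_deriv_def lookup_sum lookup_single)
  also have "\<dots> = (\<Sum>\<kappa>\<in>Poly_Mapping.keys p. (if \<kappa> = ?\<nu> then real (Poly_Mapping.lookup ?\<nu> x) * Poly_Mapping.lookup p ?\<nu> else 0))"
    using sub by (intro sum.cong) (auto simp: when_def)
  also have "\<dots> = real (Poly_Mapping.lookup \<mu> x + 1) * Poly_Mapping.lookup p ?\<nu>"
    by (simp add: lookup_add in_keys_iff)
  finally show ?thesis .
qed

text \<open>The apolar pairing: replace each indeterminate of \<open>Q\<close> by the corresponding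
  derivative, apply the operator to \<open>p\<close> and take the constant coefficient.\<close>

definition diff_pairing :: "ind_poly \<Rightarrow> ind_poly \<Rightarrow> real" where
  "diff_pairing Q p = linear_ext (\<lambda>\<mu>. mfact \<mu> * Poly_Mapping.lookup p \<mu>) Q"

lemma diff_pairing_one: "diff_pairing 1 p = Poly_Mapping.lookup p 0"
  by (simp add: diff_pairing_def flip: single_one)

lemma diff_pairing_sum_left: "diff_pairing (\<Sum>x\<in>A. f x) p = (\<Sum>x\<in>A. diff_pairing (f x) p)"
  by (simp add: diff_pairing_def linear_ext_sum)

lemma diff_pairing_zero_right [simp]: "diff_pairing Q 0 = 0"
  by (simp add: diff_pairing_def linear_ext_def)

lemma diff_pairing_add_right: "diff_pairing Q (p + p') = diff_pairing Q p + diff_pairing Q p'"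
  by (simp add: diff_pairing_def linear_ext_def lookup_add algebra_simps sum.distrib)

lemma diff_pairing_sum_right: "diff_pairing Q (\<Sum>x\<in>A. f x) = (\<Sum>x\<in>A. diff_pairing Q (f x))"
  by (induction A rule: infinite_finite_induct) (auto simp: diff_pairing_add_right)

lemma const_poly_mult_single: "const_poly c * Poly_Mapping.single \<mu> b = Poly_Mapping.single \<mu> (c * b)"
  by (simp add: const_poly_def mult_single)

lemma lookup_const_poly_mult:
  "Poly_Mapping.lookup (const_poly c * p) \<mu> = c * Poly_Mapping.lookup p \<mu>"
  by (induction p rule: single_sum_induct)
     (auto simp: const_poly_mult_single lookup_add distrib_left lookup_single when_def)

lemma diff_pairing_const_left: "diff_pairing (const_poly c * Q) p = c * diff_pairing Q p"
  by (induction Q rule: single_sum_induct)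
     (auto simp: const_poly_mult_single linear_ext_add distrib_left diff_pairing_def)

lemma diff_pairing_const_right: "diff_pairing Q (const_poly c * p) = c * diff_pairing Q p"
  by (simp add: diff_pairing_def linear_ext_def lookup_const_poly_mult sum_distrib_left)
     (rule sum.cong[OF refl], simp only: mult_ac)

text \<open>Differentiation and multiplication are adjoint: on a monomial \<open>\<mu>\<close> both
  sides read the coefficient of \<open>p\<close> at \<open>\<mu> + x\<close>, and the two factorials
  differ exactly by the exponent that differentiation produces.\<close>

lemma diff_pairing_indet: "diff_pairing Q (partial_deriv x p) = diff_pairing (indet x * Q) p"
proof (induction Q rule: single_sum_induct)
  case (single \<mu> c)
  show ?case
    by (simp add: diff_pairing_def indet_def mult_single lookup_partial_deriv
        add.commute[of "Poly_Mapping.single x (Suc 0)"] mfact_add_single[simplified])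
qed (auto simp: linear_ext_add distrib_left diff_pairing_def)

text \<open>The symbol of \<open>tensor_op\<close>: each derivative is replaced by its
  indeterminate.\<close>

definition tensor_symbol :: "nat \<Rightarrow> nat \<Rightarrow> tensor \<Rightarrow> nat \<Rightarrow> ind_poly" where
  "tensor_symbol n k T i =
     (\<Sum>\<gamma> \<in> {\<gamma>. length \<gamma> = k - 1 \<and> set \<gamma> \<subseteq> {..<n}}.
        const_poly (T (i # \<gamma>)) * (\<Prod>j\<leftarrow>\<gamma>. indet (i, j)))"

lemma diff_pairing_partial_derivs:
  "diff_pairing Q (partial_derivs i \<gamma> p) = diff_pairing ((\<Prod>j\<leftarrow>\<gamma>. indet (i, j)) * Q) p"
  by (induction \<gamma> arbitrary: Q)
     (simp_all add: partial_derivs_def diff_pairing_indet mult.assoc mult.left_commute)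

lemma diff_pairing_tensor_op:
  "diff_pairing Q (tensor_op n k T i p) = diff_pairing (tensor_symbol n k T i * Q) p"
  unfolding tensor_op_def tensor_symbol_def
  by (simp add: diff_pairing_sum_right diff_pairing_sum_left sum_distrib_right mult.assoc
      diff_pairing_const_right diff_pairing_const_left diff_pairing_partial_derivs)

lemma diff_pairing_tensor_op_power:
  "diff_pairing Q ((tensor_op n k T i ^^ d) p) = diff_pairing (tensor_symbol n k T i ^ d * Q) p"
  by (induction d arbitrary: Q)
     (simp_all add: diff_pairing_tensor_op mult.assoc mult.left_commute)

lemma diff_pairing_foldr:
  "diff_pairing Q (foldr (\<lambda>i p. const_poly (c i) * (tensor_op n k T i ^^ d i) p) is p)
     = diff_pairing ((\<Prod>i\<leftarrow>is. const_poly (c i) * tensor_symbol n k T i ^ d i) * Q) p"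
  by (induction "is" arbitrary: Q)
     (simp_all add: diff_pairing_const_left diff_pairing_const_right diff_pairing_tensor_op_power
        mult.assoc mult.left_commute)

lemma const_poly_mult: "const_poly a * const_poly b = const_poly (a * b)"
  by (simp add: const_poly_def mult_single)

lemma const_poly_one [simp]: "const_poly 1 = 1"
  by (simp add: const_poly_def)

lemma const_poly_zero [simp]: "const_poly 0 = 0"
  by (simp add: const_poly_def)

lemma const_poly_add: "const_poly a + const_poly b = const_poly (a + b)"
  by (simp add: const_poly_def single_add)

lemma const_poly_power: "const_poly a ^ d = const_poly (a ^ d)"
  by (induction d) (auto simp: const_poly_mult)

lemma const_poly_prod: "(\<Prod>x\<in>A. const_poly (f x)) = const_poly (\<Prod>x\<in>A. f x)"
  by (induction A rule: infinite_finite_induct) (auto simp: const_poly_mult)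

abbreviation monomial :: "((nat \<times> nat) \<Rightarrow>\<^sub>0 nat) \<Rightarrow> ind_poly" where
  "monomial \<mu> \<equiv> Poly_Mapping.single \<mu> 1"

lemma monomial_prod: "(\<Prod>x\<in>A. monomial (f x)) = monomial (\<Sum>x\<in>A. f x)"
  by (induction A rule: infinite_finite_induct) (auto simp: mult_single)

lemma monomial_prod_list: "(\<Prod>x\<leftarrow>xs. monomial (f x)) = monomial (\<Sum>x\<leftarrow>xs. f x)"
  by (induction xs) (auto simp: mult_single)

text \<open>The constant coefficient is the pairing with 1. Moving the operators across one at a
  time turns their ordered composition into a product in a commutative ring, where sums can be
  expanded freely.\<close>

lemma Tr_eq_diff_pairing:
  assumes "d \<ge> 1"
  shows "Tr n k T d = real ((k - 1) ^ (n - 1)) *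
    (\<Sum>ds \<in> {ds. length ds = n \<and> sum_list ds = d}.
       diff_pairing (\<Prod>i<n. const_poly (1 / fact (ds ! i * (k - 1))) * tensor_symbol n k T i ^ (ds ! i))
         (trace_power n (d * (k - 1))))"
proof -
  have "Poly_Mapping.lookup
             (foldr (\<lambda>i p. const_poly (1 / fact (ds ! i * (k - 1))) *
                           (tensor_op n k T i ^^ (ds ! i)) p)
                    [0..<n] (trace_power n (d * (k - 1)))) 0
      = diff_pairing (\<Prod>i<n. const_poly (1 / fact (ds ! i * (k - 1))) * tensor_symbol n k T i ^ (ds ! i))
         (trace_power n (d * (k - 1)))" for ds
    using diff_pairing_foldr[of 1 "\<lambda>i. 1 / fact (ds ! i * (k - 1))" "\<lambda>i. ds ! i" n k T "[0..<n]"]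
    by (simp add: diff_pairing_one prod.distinct_set_conv_list[symmetric] lessThan_atLeast0)
  then show ?thesis
    using assms by (simp add: Tr_def)
qed

section \<open>Closed words and their arcs\<close>

text \<open>One additive functional for several statistics: suitable 0-1 weights give the number of
  arcs, the outdegree, the indegree and a single exponent.\<close>

definition weight :: "('a \<Rightarrow> nat) \<Rightarrow> ('a \<Rightarrow>\<^sub>0 nat) \<Rightarrow> nat" where
  "weight w \<mu> = (\<Sum>x\<in>Poly_Mapping.keys \<mu>. w x * Poly_Mapping.lookup \<mu> x)"

lemma weight_superset:
  assumes "finite A" "Poly_Mapping.keys \<mu> \<subseteq> A"
  shows "weight w \<mu> = (\<Sum>x\<in>A. w x * Poly_Mapping.lookup \<mu> x)"
  unfolding weight_def
  by (rule sum.mono_neutral_left) (use assms in \<open>auto simp: in_keys_iff\<close>)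

lemma weight_zero [simp]: "weight w 0 = 0"
  by (simp add: weight_def)

lemma weight_single [simp]: "weight w (Poly_Mapping.single x c) = w x * c"
  by (simp add: weight_def)

lemma weight_add: "weight w (\<mu> + \<nu>) = weight w \<mu> + weight w \<nu>"
proof -
  let ?A = "Poly_Mapping.keys \<mu> \<union> Poly_Mapping.keys \<nu>"
  have "weight w (\<mu> + \<nu>) = (\<Sum>x\<in>?A. w x * Poly_Mapping.lookup (\<mu> + \<nu>) x)"
    by (rule weight_superset) (use keys_add[of \<mu> \<nu>] in auto)
  moreover have "weight w \<mu> = (\<Sum>x\<in>?A. w x * Poly_Mapping.lookup \<mu> x)"
    "weight w \<nu> = (\<Sum>x\<in>?A. w x * Poly_Mapping.lookup \<nu> x)"
    by (rule weight_superset; auto)+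
  ultimately show ?thesis
    by (simp add: lookup_add distrib_left sum.distrib)
qed

lemma weight_sum: "weight w (\<Sum>x\<in>A. f x) = (\<Sum>x\<in>A. weight w (f x))"
  by (induction A rule: infinite_finite_induct) (auto simp: weight_add)

lemma weight_sum_list: "weight w (\<Sum>x\<leftarrow>xs. f x) = (\<Sum>x\<leftarrow>xs. weight w (f x))"
  by (induction xs) (auto simp: weight_add)

lemma weight_eq_lookup: "weight (\<lambda>y. if y = x then Suc 0 else 0) \<mu> = Poly_Mapping.lookup \<mu> x"
proof -
  have "weight (\<lambda>y. if y = x then Suc 0 else 0) \<mu>
      = (\<Sum>y\<in>insert x (Poly_Mapping.keys \<mu>). (if y = x then Suc 0 else 0) * Poly_Mapping.lookup \<mu> y)"
    by (rule weight_superset) auto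
  also have "\<dots> = (\<Sum>y\<in>insert x (Poly_Mapping.keys \<mu>). if y = x then Poly_Mapping.lookup \<mu> x else 0)"
    by (intro sum.cong) auto
  finally show ?thesis by simp
qed

text \<open>The exponent vector of a monomial in the indeterminates, read as a multiset of arcs from
  \<open>i\<close> to \<open>j\<close>.\<close>

type_synonym arcs = "(nat \<times> nat) \<Rightarrow>\<^sub>0 nat"

abbreviation arc :: "nat \<Rightarrow> nat \<Rightarrow> arcs" where
  "arc i j \<equiv> Poly_Mapping.single (i, j) (Suc 0)"

abbreviation size_arcs :: "arcs \<Rightarrow> nat" where
  "size_arcs \<equiv> weight (\<lambda>_. Suc 0)"

abbreviation outdeg :: "nat \<Rightarrow> arcs \<Rightarrow> nat" where
  "outdeg i \<equiv> weight (\<lambda>x. if fst x = i then Suc 0 else 0)"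

abbreviation indeg :: "nat \<Rightarrow> arcs \<Rightarrow> nat" where
  "indeg i \<equiv> weight (\<lambda>x. if snd x = i then Suc 0 else 0)"

fun path_arcs :: "nat list \<Rightarrow> arcs" where
  "path_arcs (x # y # xs) = arc x y + path_arcs (y # xs)"
| "path_arcs _ = 0"

definition closed_arcs :: "nat list \<Rightarrow> arcs" where
  "closed_arcs xs = path_arcs (xs @ [hd xs])"

lemma path_arcs_append: "path_arcs (xs @ y # ys) = path_arcs (xs @ [y]) + path_arcs (y # ys)"
  by (induction xs rule: path_arcs.induct) (auto simp: add.assoc)

lemma path_arcs_snoc2: "path_arcs (xs @ [y, z]) = path_arcs (xs @ [y]) + arc y z"
  using path_arcs_append[of xs y "[z]"] by simp

lemma path_arcs_nth:
  "path_arcs xs = (\<Sum>p<length xs - 1. arc (xs ! p) (xs ! Suc p))"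
  by (induction xs rule: path_arcs.induct) (auto simp: sum.lessThan_Suc_shift simp del: sum.lessThan_Suc)

lemma closed_arcs_rotate1: "closed_arcs (rotate1 xs) = closed_arcs xs"
proof (cases xs)
  case (Cons x ys)
  show ?thesis
  proof (cases ys)
    case (Cons y zs)
    then show ?thesis
      using path_arcs_snoc2[of ys x y] \<open>xs = x # ys\<close> by (simp add: closed_arcs_def add.commute)
  qed (simp add: Cons)
qed simp

lemma closed_arcs_rotate: "closed_arcs (rotate p xs) = closed_arcs xs"
  by (induction p) (auto simp: closed_arcs_rotate1)

lemma closed_arcs_append:
  assumes "xs \<noteq> []" "ys \<noteq> []" "hd xs = hd ys"
  shows "closed_arcs (xs @ ys) = closed_arcs xs + closed_arcs ys"
  using assms path_arcs_append[of xs "hd ys" "tl ys @ [hd ys]"]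
  by (cases ys) (auto simp: closed_arcs_def)

text \<open>The cyclic form, with successors modulo the length, makes all rotations of a word
  visible in one sum.\<close>

lemma closed_arcs_nth:
  "closed_arcs xs = (\<Sum>p<length xs. arc (xs ! p) (xs ! (Suc p mod length xs)))"
proof (cases "xs = []")
  case False
  have "(xs @ [hd xs]) ! Suc p = xs ! (Suc p mod length xs)" if "p < length xs" for p
    using that False by (cases "Suc p = length xs") (auto simp: nth_append hd_conv_nth)
  then show ?thesis
    by (auto simp: closed_arcs_def path_arcs_nth nth_append intro!: sum.cong)
qed (simp add: closed_arcs_def)

lemma size_closed_arcs: "size_arcs (closed_arcs xs) = length xs"
  by (simp add: closed_arcs_nth weight_sum)

lemma keys_path_arcs: "Poly_Mapping.keys (path_arcs xs) \<subseteq> set xs \<times> set xs"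
proof (induction xs rule: path_arcs.induct)
  case (1 x y xs)
  then show ?case
    using keys_add[of "arc x y" "path_arcs (y # xs)"] by auto
qed auto

lemma outdeg_path_arcs: "outdeg i (path_arcs (xs @ [y])) = count_list xs i"
proof (induction xs)
  case (Cons x xs)
  then show ?case by (cases xs) (auto simp: weight_add)
qed simp

lemma indeg_path_arcs: "indeg i (path_arcs (x # xs)) = count_list xs i"
  by (induction xs arbitrary: x) (auto simp: weight_add)

lemma outdeg_closed_arcs: "outdeg i (closed_arcs xs) = count_list xs i"
  by (simp add: closed_arcs_def outdeg_path_arcs)

lemma indeg_closed_arcs: "indeg i (closed_arcs xs) = count_list xs i"
  by (cases xs) (auto simp: closed_arcs_def indeg_path_arcs)

text \<open>Every letter of a closed word is the tail of an arc, so the arcs determine the alphabet;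
  together with the length this bounds the words with given arcs.\<close>

lemma set_eq_keys_closed_arcs: "set xs = fst ` Poly_Mapping.keys (closed_arcs xs)"
proof (intro Set.set_eqI iffI)
  fix x assume "x \<in> set xs"
  then have "outdeg x (closed_arcs xs) \<noteq> 0"
    by (simp add: outdeg_closed_arcs count_list_0_iff)
  then have "\<exists>a\<in>Poly_Mapping.keys (closed_arcs xs). fst a = x"
    unfolding weight_def by (rule contrapos_np) (auto intro!: sum.neutral)
  then show "x \<in> fst ` Poly_Mapping.keys (closed_arcs xs)" by auto
next
  fix x assume "x \<in> fst ` Poly_Mapping.keys (closed_arcs xs)"
  then show "x \<in> set xs"
    using keys_path_arcs[of "xs @ [hd xs]"] by (cases xs) (auto simp: closed_arcs_def)
qed

definition closed_words :: "arcs \<Rightarrow> nat list set" where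
  "closed_words \<mu> = {xs. xs \<noteq> [] \<and> closed_arcs xs = \<mu>}"

lemma finite_closed_words [simp]: "finite (closed_words \<mu>)"
proof (rule finite_subset)
  show "closed_words \<mu> \<subseteq> {xs. set xs \<subseteq> fst ` Poly_Mapping.keys \<mu> \<and> length xs = size_arcs \<mu>}"
    using set_eq_keys_closed_arcs by (auto simp: closed_words_def size_closed_arcs)
  show "finite {xs. set xs \<subseteq> fst ` Poly_Mapping.keys \<mu> \<and> length xs = size_arcs \<mu>}"
    by (rule finite_lists_length_eq) auto
qed

text \<open>Double counting of pairs of a closed word and a rotation. Each rotation permutes
  \<open>closed_words \<mu>\<close>, and the rotations of a single word bring each of its arcs to
  the front once. The predicate \<open>P\<close> allows prescribing the first arc or only its
  tail.\<close>

lemma card_closed_words_first_arc: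
  "card {xs \<in> closed_words \<mu>. P (xs ! 0, xs ! (1 mod length xs))} * size_arcs \<mu>
     = card (closed_words \<mu>) * weight (\<lambda>x. if P x then Suc 0 else 0) \<mu>"
proof -
  define N where "N = size_arcs \<mu>"
  define f where "f xs = (if P (xs ! 0, xs ! (1 mod length xs)) then Suc 0 else 0)" for xs :: "nat list"
  have len: "length xs = N" if "xs \<in> closed_words \<mu>" for xs
    using that size_closed_arcs by (auto simp: closed_words_def N_def)
  have bij: "bij_betw (rotate p) (closed_words \<mu>) (closed_words \<mu>)" for p
  proof -
    have inj: "inj_on (rotate p) (closed_words \<mu>)"
      proof (rule inj_onI)
      fix xs ys assume xy: "xs \<in> closed_words \<mu>" "ys \<in> closed_words \<mu>" "rotate p xs = rotate p ys"
      have "N \<noteq> 0" using len[OF xy(1)] xy(1) by (auto simp: closed_words_def)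
      \<comment> \<open>A further rotation by \<open>(N - 1) * p\<close> undoes the rotation by
        \<open>p\<close>, since the total is a multiple of the length.\<close>
      then have "(N - 1) * p + p = N * p" by (cases N) auto
      then have "rotate ((N - 1) * p) (rotate p zs) = zs" if "zs \<in> closed_words \<mu>" for zs
        using len[OF that] by (simp add: rotate_rotate rotate_id)
      then show "xs = ys" using xy by metis
    qed
    have "rotate p ` closed_words \<mu> \<subseteq> closed_words \<mu>"
      by (auto simp: closed_words_def closed_arcs_rotate)
    then show ?thesis
      using inj by (simp add: bij_betw_def endo_inj_surj)
  qed
  have "(\<Sum>p<N. f (rotate p xs)) = weight (\<lambda>x. if P x then Suc 0 else 0) \<mu>" if "xs \<in> closed_words \<mu>" for xs
  proof -
    have "weight (\<lambda>x. if P x then Suc 0 else 0) (closed_arcs xs)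
        = (\<Sum>p<length xs. if P (xs ! p, xs ! (Suc p mod length xs)) then Suc 0 else 0)"
      by (simp add: closed_arcs_nth weight_sum)
    also have "\<dots> = (\<Sum>p<length xs. f (rotate p xs))"
    proof (intro sum.cong refl)
      fix p assume "p \<in> {..<length xs}"
      then have "p < length xs" "0 < length xs" "1 mod length xs < length xs" by auto
      then have "rotate p xs ! 0 = xs ! p" "rotate p xs ! (1 mod length xs) = xs ! (Suc p mod length xs)"
        using nth_rotate[of 0 xs p] nth_rotate[of "1 mod length xs" xs p] by (auto simp: mod_simps)
      then show "(if P (xs ! p, xs ! (Suc p mod length xs)) then Suc 0 else 0) = f (rotate p xs)"
        by (simp add: f_def)
    qed
    finally show ?thesis
      using that len[OF that] by (simp add: closed_words_def)
  qed
  then have "card (closed_words \<mu>) * weight (\<lambda>x. if P x then Suc 0 else 0) \<mu>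
      = (\<Sum>xs\<in>closed_words \<mu>. \<Sum>p<N. f (rotate p xs))"
    by simp
  also have "\<dots> = (\<Sum>p<N. \<Sum>xs\<in>closed_words \<mu>. f (rotate p xs))"
    by (rule sum.swap)
  also have "\<dots> = (\<Sum>p<N. \<Sum>xs\<in>closed_words \<mu>. f xs)"
    by (intro sum.cong refl sum.reindex_bij_betw bij)
  also have "(\<Sum>xs\<in>closed_words \<mu>. f xs) = card {xs \<in> closed_words \<mu>. P (xs ! 0, xs ! (1 mod length xs))}"
    by (simp add: f_def sum.If_cases Int_def)
  finally show ?thesis
    by (simp add: N_def)
qed

text \<open>The rotation classes of closed words are counted by \<open>closed_weight\<close>, each arc being labelled.\<close>

definition closed_weight :: "arcs \<Rightarrow> real" where
  "closed_weight \<mu> = mfact \<mu> * real (card (closed_words \<mu>)) / real (size_arcs \<mu>)"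

text \<open>Deleting the first letter of a word that starts with a loop at \<open>i\<close> leaves a word that starts
  at \<open>i\<close>.\<close>

lemma closed_weight_add_loop:
  assumes "size_arcs \<mu> \<ge> 1"
  shows "closed_weight (\<mu> + arc i i) = real (outdeg i \<mu>) * closed_weight \<mu>"
proof -
  let ?A = "{xs \<in> closed_words (\<mu> + arc i i). (xs ! 0, xs ! (1 mod length xs)) = (i, i)}"
  let ?B = "{ys \<in> closed_words \<mu>. fst (ys ! 0, ys ! (1 mod length ys)) = i}"
  have "bij_betw ((#) i) ?B ?A"
  proof (rule bij_betw_imageI)
    show "(#) i ` ?B = ?A"
    proof (intro Set.set_eqI iffI)
      fix xs assume "xs \<in> (#) i ` ?B"
      then obtain ys where ys: "xs = i # ys" "ys \<in> closed_words \<mu>" "ys ! 0 = i" by auto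
      then obtain zs where zs: "ys = i # zs" by (cases ys) (auto simp: closed_words_def)
      show "xs \<in> ?A"
        using ys(2) by (simp add: ys(1) zs closed_words_def closed_arcs_def add.commute)
    next
      fix xs assume xs: "xs \<in> ?A"
      then have "closed_arcs xs = \<mu> + arc i i"
        by (simp add: closed_words_def)
      then have "length xs = size_arcs (\<mu> + arc i i)"
        using size_closed_arcs by metis
      then have "length xs \<ge> 2"
        using assms by (simp add: weight_add)
      then obtain a b zs where "xs = a # b # zs"
        by (cases xs rule: path_arcs.cases) auto
      then have zs: "xs = i # i # zs" using xs by simp
      have "\<mu> + arc i i = arc i i + closed_arcs (i # zs)"
        using xs unfolding zs by (simp add: closed_words_def closed_arcs_def)
      then have "closed_arcs (i # zs) = \<mu>"
        by (metis add.commute add_left_cancel)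
      then have "i # zs \<in> ?B"
        unfolding closed_words_def by simp
      then show "xs \<in> (#) i ` ?B" unfolding zs by (rule imageI)
    qed
  qed auto
  then have eq: "card ?A = card ?B"
    by (rule bij_betw_same_card[THEN sym])
  \<comment> \<open>The double count is used once for the arc \<open>(i, i)\<close> and once for the
    tail \<open>i\<close>. The exponent plus one in the first count is what \<open>mfact\<close>
    gains from the new loop, and the two lengths are the denominators of the two closed
    weights.\<close>
  have "card ?A * (size_arcs \<mu> + 1)
      = card (closed_words (\<mu> + arc i i)) * (Poly_Mapping.lookup \<mu> (i, i) + 1)"
    using card_closed_words_first_arc[of "\<mu> + arc i i" "\<lambda>x. x = (i, i)"]
    by (simp add: weight_add weight_eq_lookup lookup_add)
  moreover have "card ?B * size_arcs \<mu> = card (closed_words \<mu>) * outdeg i \<mu>"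
    using card_closed_words_first_arc[of \<mu> "\<lambda>x. fst x = i"] by simp
  ultimately have nat: "card ?B * (size_arcs \<mu> + 1)
      = card (closed_words (\<mu> + arc i i)) * (Poly_Mapping.lookup \<mu> (i, i) + 1)"
    "card ?B * size_arcs \<mu> = card (closed_words \<mu>) * outdeg i \<mu>"
    unfolding eq by blast+
  have 1: "real (card ?B) * (real (size_arcs \<mu>) + 1)
      = real (card (closed_words (\<mu> + arc i i))) * (real (Poly_Mapping.lookup \<mu> (i, i)) + 1)"
    using arg_cong[OF nat(1), of real] by (simp only: of_nat_mult of_nat_add of_nat_1)
  have 2: "real (card ?B) * real (size_arcs \<mu>) = real (card (closed_words \<mu>)) * real (outdeg i \<mu>)"
    using arg_cong[OF nat(2), of real] by (simp only: of_nat_mult)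
  have "closed_weight (\<mu> + arc i i)
      = mfact \<mu> * (real (card (closed_words (\<mu> + arc i i))) * (real (Poly_Mapping.lookup \<mu> (i, i)) + 1))
        / (real (size_arcs \<mu>) + 1)"
    by (simp only: closed_weight_def mfact_add_single[unfolded One_nat_def] weight_add weight_single)
       (simp add: mult_ac add_ac)
  also have "\<dots> = mfact \<mu> * real (card ?B)"
    unfolding 1[symmetric] by simp
  also have "\<dots> = mfact \<mu> * (real (card ?B) * real (size_arcs \<mu>)) / real (size_arcs \<mu>)"
    using assms by simp
  also have "\<dots> = real (outdeg i \<mu>) * closed_weight \<mu>"
    unfolding 2 by (simp add: closed_weight_def)
  finally show ?thesis .
qed

text \<open>Each inserted loop raises the outdegree of its vertex by one, so repeated insertion
  yields a rising factorial rather than a power.\<close>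

lemma closed_weight_add_loops:
  assumes "size_arcs \<mu> \<ge> 1"
  shows "closed_weight (\<mu> + Poly_Mapping.single (i, i) s)
    = pochhammer (real (outdeg i \<mu>)) s * closed_weight \<mu>"
proof (induction s)
  case (Suc s)
  have "\<mu> + Poly_Mapping.single (i, i) (Suc s) = (\<mu> + Poly_Mapping.single (i, i) s) + arc i i"
    by (simp add: add.assoc flip: single_add)
  then have "closed_weight (\<mu> + Poly_Mapping.single (i, i) (Suc s))
      = real (outdeg i \<mu> + s) * closed_weight (\<mu> + Poly_Mapping.single (i, i) s)"
    using assms by (simp only: closed_weight_add_loop weight_add) (simp add: weight_add)
  then show ?case
    by (simp add: Suc.IH pochhammer_Suc)
qed simp

text \<open>Loops at other vertices leave the outdegree at \<open>i\<close> unchanged, so the rising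
  factorials multiply.\<close>

lemma closed_weight_add_all_loops:
  assumes "size_arcs \<mu> \<ge> 1" "finite I"
  shows "closed_weight (\<mu> + (\<Sum>i\<in>I. Poly_Mapping.single (i, i) (s i)))
    = (\<Prod>i\<in>I. pochhammer (real (outdeg i \<mu>)) (s i)) * closed_weight \<mu>"
  using assms(2)
proof (induction I)
  case (insert i I)
  let ?\<nu> = "\<mu> + (\<Sum>i\<in>I. Poly_Mapping.single (i, i) (s i))"
  have "outdeg i (\<Sum>i\<in>I. Poly_Mapping.single (i, i) (s i)) = 0"
    using insert by (auto simp: weight_sum intro!: sum.neutral)
  then have "outdeg i ?\<nu> = outdeg i \<mu>"
    by (simp add: weight_add)
  moreover have "size_arcs ?\<nu> \<ge> 1"
    using assms by (simp add: weight_add)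
  ultimately show ?case
    using closed_weight_add_loops[of ?\<nu> i "s i"] insert by (simp add: add_ac)
qed simp

lemma closed_weight_balanced:
  assumes "closed_weight \<mu> \<noteq> 0"
  shows "outdeg i \<mu> = indeg i \<mu>"
proof -
  obtain xs where "xs \<in> closed_words \<mu>"
    using assms by (force simp: closed_weight_def)
  then have "\<mu> = closed_arcs xs"
    by (auto simp: closed_words_def)
  then show ?thesis
    by (simp add: outdeg_closed_arcs indeg_closed_arcs)
qed

lemma closed_weight_pos_iff: "closed_weight \<mu> > 0 \<longleftrightarrow> closed_words \<mu> \<noteq> {}"
proof
  assume ne: "closed_words \<mu> \<noteq> {}"
  then obtain xs where "xs \<noteq> []" "closed_arcs xs = \<mu>"
    by (auto simp: closed_words_def)
  then have "size_arcs \<mu> > 0"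
    using size_closed_arcs[of xs] by auto
  then show "closed_weight \<mu> > 0"
    using ne mfact_pos[of \<mu>] by (auto simp: closed_weight_def card_gt_0_iff intro!: divide_pos_pos mult_pos_pos)
qed (auto simp: closed_weight_def)

text \<open>Rotate both closed words so that they start at the common vertex, and concatenate
  them.\<close>

lemma closed_words_add:
  assumes "closed_words \<mu> \<noteq> {}" "closed_words \<nu> \<noteq> {}" "outdeg x \<mu> > 0" "outdeg x \<nu> > 0"
  shows "closed_words (\<mu> + \<nu>) \<noteq> {}"
proof -
  have start: "\<exists>xs\<in>closed_words \<kappa>. hd xs = x" if ne: "closed_words \<kappa> \<noteq> {}" and out: "outdeg x \<kappa> > 0" for \<kappa>
  proof -
    obtain xs where xs: "xs \<noteq> []" "closed_arcs xs = \<kappa>"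
      using ne by (auto simp: closed_words_def)
    then have "x \<in> set xs"
      using out outdeg_closed_arcs[of x xs] by (metis count_list_0_iff less_numeral_extra(3))
    then obtain p where p: "p < length xs" "xs ! p = x"
      by (auto simp: in_set_conv_nth)
    then have "hd (rotate p xs) = x"
      by (simp add: hd_rotate_conv_nth xs)
    moreover have "rotate p xs \<in> closed_words \<kappa>"
      using xs by (simp add: closed_words_def closed_arcs_rotate)
    ultimately show ?thesis by blast
  qed
  obtain xs ys where "xs \<in> closed_words \<mu>" "ys \<in> closed_words \<nu>" "hd xs = x" "hd ys = x"
    using start[of \<mu>] start[of \<nu>] assms by blast
  then have "xs @ ys \<in> closed_words (\<mu> + \<nu>)"
    by (auto simp: closed_words_def closed_arcs_append)
  then show ?thesis by blast
qed

text \<open>Loop insertion starts from a nonempty multiset of arcs, so loops alone are treated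
  separately. A closed word made of loops cannot change its vertex; hence the weight is nonzero only
  if all loops sit at one vertex.\<close>

lemma closed_weight_loops:
  assumes "finite I" "(\<Sum>i\<in>I. s i) \<ge> 1"
  shows "closed_weight (\<Sum>i\<in>I. Poly_Mapping.single (i, i) (s i)) * real (\<Sum>i\<in>I. s i)
    = (\<Sum>v\<in>I. if s v = (\<Sum>i\<in>I. s i) then fact (s v) else 0)"
proof -
  obtain v where v: "v \<in> I" "s v \<ge> 1"
    using assms by (metis Suc_leI One_nat_def not_less_eq_eq not_less_zero sum.neutral bot_nat_0.not_eq_extremum)
  let ?\<mu> = "Poly_Mapping.single (v, v) (s v)"
  have words: "closed_words ?\<mu> = {replicate (s v) v}"
  proof (intro Set.set_eqI iffI)
    fix xs assume "xs \<in> closed_words ?\<mu>"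
    then have "xs \<noteq> []" and xs: "closed_arcs xs = ?\<mu>" by (auto simp: closed_words_def)
    have "set xs \<subseteq> {v}"
      using set_eq_keys_closed_arcs[of xs] v unfolding xs by auto
    moreover have "length xs = s v"
      using size_closed_arcs[of xs] unfolding xs by simp
    ultimately show "xs \<in> {replicate (s v) v}"
      by (auto intro!: replicate_eqI)
  next
    fix xs assume "xs \<in> {replicate (s v) v}"
    moreover have "(\<Sum>p<m. arc v v) = Poly_Mapping.single (v, v) m" for m
      by (induction m) (auto simp flip: single_add)
    ultimately show "xs \<in> closed_words ?\<mu>"
      using v by (simp add: closed_words_def closed_arcs_nth)
  qed
  have mf: "mfact ?\<mu> = fact (s v)"
    using v by (simp add: mfact_def)
  have w: "closed_weight ?\<mu> * real (s v) = fact (s v)"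
    using v by (simp add: closed_weight_def words mf)
  have size1: "size_arcs ?\<mu> \<ge> 1" using v by simp
  have fin: "finite (I - {v})" using assms by simp
  have split: "(\<Sum>i\<in>I. Poly_Mapping.single (i, i) (s i)) = ?\<mu> + (\<Sum>i\<in>I-{v}. Poly_Mapping.single (i, i) (s i))"
    "(\<Sum>i\<in>I. s i) = s v + (\<Sum>i\<in>I-{v}. s i)"
    using v assms(1) by (auto simp: sum.remove)
  \<comment> \<open>The outdegree at \<open>i \<noteq> v\<close> is 0, and
    \<open>pochhammer 0 s\<close> vanishes unless \<open>s = 0\<close>.\<close>
  have prod: "(\<Prod>i\<in>I-{v}. pochhammer (real (outdeg i ?\<mu>)) (s i)) = (if (\<Sum>i\<in>I-{v}. s i) = 0 then 1 else 0)"
  proof (cases "(\<Sum>i\<in>I-{v}. s i) = 0")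
    case True
    then have "\<forall>i\<in>I-{v}. s i = 0" using fin by simp
    then show ?thesis using True by simp
  next
    case False
    then obtain i where "i \<in> I - {v}" "s i \<noteq> 0"
      by (metis sum.neutral)
    then have "pochhammer (real (outdeg i ?\<mu>)) (s i) = 0"
      by (auto simp: pochhammer_0_left)
    then show ?thesis using False fin \<open>i \<in> I - {v}\<close> by (auto simp: prod_zero_iff)
  qed
  have lhs: "closed_weight (\<Sum>i\<in>I. Poly_Mapping.single (i, i) (s i))
    = (if (\<Sum>i\<in>I-{v}. s i) = 0 then closed_weight ?\<mu> else 0)"
    unfolding split(1) closed_weight_add_all_loops[OF size1 fin] prod by simp
  show ?thesis
  proof (cases "(\<Sum>i\<in>I-{v}. s i) = 0")
    case True
    then have z: "\<forall>i\<in>I-{v}. s i = 0" using fin by simp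
    have "(\<Sum>u\<in>I. if s u = (\<Sum>i\<in>I. s i) then fact (s u) else 0) = (\<Sum>u\<in>I. if u = v then fact (s v) else 0 :: real)"
      using z v True split(2) by (intro sum.cong) auto
    then show ?thesis
      using True w v assms(1) unfolding lhs by (simp add: split(2))
  next
    case False
    have "s u \<noteq> (\<Sum>i\<in>I. s i)" if "u \<in> I" for u
    proof (cases "u = v")
      case True
      then show ?thesis using False split(2) by simp
    next
      case False
      have "s u \<le> (\<Sum>i\<in>I-{v}. s i)"
        using False that fin by (intro member_le_sum) auto
      then show ?thesis using v(2) split(2) by simp
    qed
    then have "(\<Sum>u\<in>I. if s u = (\<Sum>i\<in>I. s i) then fact (s u) else 0) = (0::real)"
      by (intro sum.neutral) auto
    then show ?thesis using False lhs by simp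
  qed
qed

text \<open>The entry \<open>(i, j)\<close> of the power is the sum, over the walks from
  \<open>i\<close> to \<open>j\<close>, of their arc monomials; on the diagonal the walks are the
  closed words that start at \<open>i\<close>.\<close>

lemma lookup_trace_power:
  assumes "N \<ge> 1"
  shows "Poly_Mapping.lookup (trace_power n N) \<mu>
    = real (card {xs \<in> closed_words \<mu>. length xs = N \<and> set xs \<subseteq> {..<n}})"
proof -
  let ?L = "\<lambda>N. {xs. length xs = N \<and> set xs \<subseteq> {..<n}}"
  have fin: "finite {xs. length xs = N \<and> set xs \<subseteq> {..<n} \<and> P xs}" for N P
    by (rule finite_subset[OF _ finite_lists_length_eq[of "{..<n}" N]]) auto
  \<comment> \<open>The induction begins at exponent 1, so that the words are nonempty and
    \<open>hd\<close> is their first letter.\<close>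
  have pow: "(mat n n indet ^\<^sub>m Suc N) $$ (i, j)
      = (\<Sum>xs\<in>{xs. length xs = Suc N \<and> set xs \<subseteq> {..<n} \<and> hd xs = i}. monomial (path_arcs (xs @ [j])))"
    if ij: "i < n" "j < n" for i j N
    using ij(2)
  proof (induction N arbitrary: j)
    case 0
    have "{xs. length xs = Suc 0 \<and> set xs \<subseteq> {..<n} \<and> hd xs = i} = {[i]}"
      using ij by (auto simp: length_Suc_conv)
    then show ?case
      using ij 0 by (simp add: indet_def)
  next
    case (Suc N)
    have dim: "mat n n indet ^\<^sub>m Suc N \<in> carrier_mat n n"
      by (rule pow_carrier_mat) simp
    have "(mat n n indet ^\<^sub>m Suc (Suc N)) $$ (i, j)
        = (\<Sum>l<n. (mat n n indet ^\<^sub>m Suc N) $$ (i, l) * indet (l, j))"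
      using dim ij Suc.prems
      by (subst pow_mat.simps) (auto simp: scalar_prod_def lessThan_atLeast0 intro!: sum.cong)
    also have "\<dots> = (\<Sum>l<n. \<Sum>xs\<in>{xs. length xs = Suc N \<and> set xs \<subseteq> {..<n} \<and> hd xs = i}.
        monomial (path_arcs ((xs @ [l]) @ [j])))"
      by (intro sum.cong) (auto simp: Suc.IH sum_distrib_right indet_def mult_single path_arcs_snoc2 simp del: pow_mat.simps)
    also have "\<dots> = (\<Sum>(l, xs)\<in>{..<n} \<times> {xs. length xs = Suc N \<and> set xs \<subseteq> {..<n} \<and> hd xs = i}.
        monomial (path_arcs ((xs @ [l]) @ [j])))"
      by (subst sum.Sigma) (auto simp: fin)
    also have "\<dots> = (\<Sum>ys\<in>{xs. length xs = Suc (Suc N) \<and> set xs \<subseteq> {..<n} \<and> hd xs = i}.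
        monomial (path_arcs (ys @ [j])))"
    proof (rule sum.reindex_bij_witness[where i = "\<lambda>ys. (last ys, butlast ys)" and j = "\<lambda>(l, xs). xs @ [l]"])
      fix ys assume "ys \<in> {xs. length xs = Suc (Suc N) \<and> set xs \<subseteq> {..<n} \<and> hd xs = i}"
      then have *: "length ys = Suc (Suc N)" "set ys \<subseteq> {..<n}" "hd ys = i" "ys \<noteq> []" by auto
      then have "ys = butlast ys @ [last ys]" "butlast ys \<noteq> []" by (auto simp flip: length_0_conv)
      then have "hd (butlast ys) = i" using *(3) by (metis hd_append2)
      then show "(last ys, butlast ys) \<in> {..<n} \<times> {xs. length xs = Suc N \<and> set xs \<subseteq> {..<n} \<and> hd xs = i}"
        using * last_in_set[OF *(4)] in_set_butlastD[of _ ys] by (simp add: subset_iff)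
      show "(case (last ys, butlast ys) of (l, xs) \<Rightarrow> xs @ [l]) = ys"
        using * by simp
    next
      fix a assume "a \<in> {..<n} \<times> {xs. length xs = Suc N \<and> set xs \<subseteq> {..<n} \<and> hd xs = i}"
      then obtain l xs where "a = (l, xs)" "l < n" "length xs = Suc N" "set xs \<subseteq> {..<n}" "hd xs = i" by auto
      then show "(case a of (l, xs) \<Rightarrow> xs @ [l]) \<in> {xs. length xs = Suc (Suc N) \<and> set xs \<subseteq> {..<n} \<and> hd xs = i}"
        by (cases xs) auto
    qed auto
    finally show ?case .
  qed
  obtain N' where N': "N = Suc N'" using assms by (cases N) auto
  have "trace_power n N = (\<Sum>i<n. \<Sum>xs\<in>{xs. length xs = N \<and> set xs \<subseteq> {..<n} \<and> hd xs = i}. monomial (closed_arcs xs))"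
    unfolding trace_power_def N' by (intro sum.cong) (auto simp: pow closed_arcs_def simp del: pow_mat.simps)
  also have "\<dots> = (\<Sum>i<n. \<Sum>xs\<in>{xs \<in> ?L N. hd xs = i}. monomial (closed_arcs xs))"
    by (simp add: conj_assoc)
  also have "\<dots> = (\<Sum>xs\<in>?L N. monomial (closed_arcs xs))"
  proof (rule sum.group)
    show "hd ` ?L N \<subseteq> {..<n}"
      using N' by (auto simp: length_Suc_conv)
  qed (use fin[of N "\<lambda>_. True"] in auto)
  finally have "Poly_Mapping.lookup (trace_power n N) \<mu>
      = (\<Sum>xs\<in>?L N. if closed_arcs xs = \<mu> then 1 else 0)"
    by (simp add: lookup_sum lookup_single when_def)
  also have "\<dots> = real (card {xs \<in> ?L N. closed_arcs xs = \<mu>})"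
    using fin[of N "\<lambda>_. True"] by (simp add: sum.If_cases Int_def)
  also have "{xs \<in> ?L N. closed_arcs xs = \<mu>} = {xs \<in> closed_words \<mu>. length xs = N \<and> set xs \<subseteq> {..<n}}"
    using N' by (auto simp: closed_words_def)
  finally show ?thesis .
qed

lemma diff_pairing_trace_power:
  assumes "size_arcs \<mu> = N" "N \<ge> 1" "Poly_Mapping.keys \<mu> \<subseteq> {..<n} \<times> {..<n}"
  shows "diff_pairing (monomial \<mu>) (trace_power n N) = real N * closed_weight \<mu>"
proof -
  have "{xs \<in> closed_words \<mu>. length xs = N \<and> set xs \<subseteq> {..<n}} = closed_words \<mu>"
    using assms(1,3) set_eq_keys_closed_arcs size_closed_arcs by (fastforce simp: closed_words_def)
  then have "diff_pairing (monomial \<mu>) (trace_power n N) = mfact \<mu> * real (card (closed_words \<mu>))"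
    using assms by (simp add: diff_pairing_def lookup_trace_power)
  then show ?thesis
    using assms by (simp add: closed_weight_def)
qed

section \<open>Sums over compositions\<close>

text \<open>The series \<open>1 / (1 - c X)\<close>.\<close>

definition geo_fps :: "real \<Rightarrow> real fps" where
  "geo_fps c = Abs_fps (\<lambda>s. c ^ s)"

lemma sum_pochhammer_fact:
  "(\<Sum>j\<le>s. pochhammer (real t) j / fact j) = pochhammer (real (Suc t)) s / fact s"
proof (induction s)
  case (Suc s)
  have "pochhammer (real t) (Suc s) = real t * pochhammer (real (Suc t)) s"
    by (simp add: pochhammer_rec add.commute)
  then show ?case
    using Suc by (simp add: pochhammer_Suc divide_simps) (simp add: algebra_simps)
qed simp

text \<open>The binomial series with a negative exponent; its coefficients are matched against the
  rising factorials that come from inserted loops.\<close>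

lemma geo_fps_power_nth:
  "fps_nth (geo_fps c ^ t) s = pochhammer (real t) s / fact s * c ^ s"
proof (induction t arbitrary: s)
  case 0
  then show ?case by (simp add: pochhammer_0_left)
next
  case (Suc t)
  have "fps_nth (geo_fps c ^ Suc t) s = (\<Sum>j\<le>s. fps_nth (geo_fps c ^ t) j * c ^ (s - j))"
    by (simp add: power_Suc2 fps_mult_nth geo_fps_def atMost_atLeast0 del: power_Suc)
  also have "\<dots> = (\<Sum>j\<le>s. pochhammer (real t) j / fact j * c ^ s)"
    by (intro sum.cong) (auto simp: Suc simp flip: power_add)
  also have "\<dots> = pochhammer (real (Suc t)) s / fact s * c ^ s"
    by (simp only: sum_distrib_right[symmetric] sum_pochhammer_fact)
  finally show ?case .
qed

text \<open>\<open>PiE\<close> fixes the values outside \<open>I\<close>, so each composition is a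
  single function and finite index sets give finite sets.\<close>

definition compositions :: "'a set \<Rightarrow> nat \<Rightarrow> ('a \<Rightarrow> nat) set" where
  "compositions I d = {s \<in> PiE I (\<lambda>_. UNIV). sum s I = d}"

lemma finite_compositions:
  assumes "finite I"
  shows "finite (compositions I d)"
proof (rule finite_subset)
  show "compositions I d \<subseteq> PiE I (\<lambda>_. {..d})"
    using assms by (auto simp: compositions_def intro!: PiE_I member_le_sum)
qed (use assms in \<open>auto intro: finite_PiE\<close>)

lemma sum_compositions_eq_fps_nth:
  fixes a :: "'a \<Rightarrow> nat \<Rightarrow> real"
  assumes "finite I"
  shows "(\<Sum>s\<in>compositions I d. \<Prod>i\<in>I. a i (s i)) = fps_nth (\<Prod>i\<in>I. Abs_fps (a i)) d"
  using assms
proof (induction I arbitrary: d)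
  case empty
  have "compositions ({} :: 'a set) d = (if d = 0 then {\<lambda>x. undefined} else {})"
    by (auto simp: compositions_def)
  then show ?case by (cases "d = 0") simp_all
next
  case (insert i I)
  have "(\<Sum>s\<in>compositions (insert i I) d. \<Prod>j\<in>insert i I. a j (s j))
      = (\<Sum>(c, s)\<in>(SIGMA c:{0..d}. compositions I (d - c)). a i c * (\<Prod>j\<in>I. a j (s j)))"
  proof (rule sum.reindex_bij_witness[where i = "\<lambda>(c, s). s(i := c)" and j = "\<lambda>s. (s i, s(i := undefined))"])
    fix s assume s: "s \<in> compositions (insert i I) d"
    have "sum (s(i := undefined)) I = sum s I"
      using insert by (intro sum.cong) auto
    then show "(s i, s(i := undefined)) \<in> (SIGMA c:{0..d}. compositions I (d - c))"
      using s insert by (auto simp: compositions_def PiE_iff extensional_def)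
    have "(\<Prod>j\<in>I. a j ((s(i := undefined)) j)) = (\<Prod>j\<in>I. a j (s j))"
      using insert by (intro prod.cong) auto
    then show "(case (s i, s(i := undefined)) of (c, s) \<Rightarrow> a i c * (\<Prod>j\<in>I. a j (s j)))
        = (\<Prod>j\<in>insert i I. a j (s j))"
      using insert by simp
  next
    fix x assume "x \<in> (SIGMA c:{0..d}. compositions I (d - c))"
    then obtain c s where x: "x = (c, s)" "c \<le> d" "s \<in> compositions I (d - c)" by auto
    have "sum (s(i := c)) I = sum s I"
      using insert by (intro sum.cong) auto
    then show "(case x of (c, s) \<Rightarrow> s(i := c)) \<in> compositions (insert i I) d"
      using x insert by (auto simp: compositions_def PiE_iff extensional_def)
    show "((case x of (c, s) \<Rightarrow> s(i := c)) i, (case x of (c, s) \<Rightarrow> s(i := c))(i := undefined)) = x"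
      using x insert by (auto simp: compositions_def PiE_iff extensional_def fun_eq_iff)
  qed auto
  also have "\<dots> = (\<Sum>c=0..d. a i c * (\<Sum>s\<in>compositions I (d - c). \<Prod>j\<in>I. a j (s j)))"
    using insert(1) by (subst sum.Sigma[symmetric]) (auto simp: finite_compositions sum_distrib_left)
  also have "\<dots> = fps_nth (\<Prod>j\<in>insert i I. Abs_fps (a j)) d"
    using insert by (simp add: fps_mult_nth)
  finally show ?case .
qed

text \<open>Since \<open>pochhammer a m\<close> is \<open>(a + m - 1)! / (a - 1)!\<close>, this is a
  relation between factorials; the multiplied form also covers \<open>a = 0\<close>.\<close>

lemma fact_times_pochhammer:
  "fact (a + m) * real a = fact a * pochhammer (real a) m * real (a + m)"
proof (induction m)
  case (Suc m)
  have "fact (a + Suc m) * real a = real (a + Suc m) * (fact (a + m) * real a)"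
    by (simp add: mult_ac)
  also have "\<dots> = fact a * pochhammer (real a) (Suc m) * real (a + Suc m)"
    unfolding Suc.IH by (simp add: pochhammer_Suc mult_ac)
  finally show ?case .
qed simp

lemma pochhammer_div_fact:
  assumes "a + m > 0"
  shows "pochhammer (real a) m / fact (a + m) = real a / (real (a + m) * fact a)"
proof -
  have "fact a * real (a + m) \<noteq> (0::real)" "fact (a + m) \<noteq> (0::real)"
    using assms by auto
  then show ?thesis
    using fact_times_pochhammer[of a m] by (simp add: frac_eq_eq) (simp add: mult_ac)
qed

text \<open>This cancellation is what makes the loops contribute a geometric series per visit.\<close>

lemma loop_coefficient:
  assumes "b \<ge> 1"
  shows "real ((s + t) choose s) * pochhammer (real (t * b)) (s * b) / fact ((s + t) * b)
    = pochhammer (real t) s / fact s / fact (t * b)"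
proof (cases "s + t = 0")
  case False
  have choose: "real ((s + t) choose s) = fact (t + s) / (fact s * fact t)"
    by (simp add: binomial_fact add.commute)
  have "pochhammer (real (t * b)) (s * b) / fact ((s + t) * b) = real (t * b) / (real ((s + t) * b) * fact (t * b))"
    using pochhammer_div_fact[of "t * b" "s * b"] False assms
    by (simp add: add.commute distrib_right)
  also have "\<dots> = real t / (real (t + s) * fact (t * b))"
    using assms by (simp add: add.commute)
  finally have loops: "pochhammer (real (t * b)) (s * b) / fact ((s + t) * b) = real t / (real (t + s) * fact (t * b))" .
  have poch: "pochhammer (real t) s = fact (t + s) * real t / (real (t + s) * fact t)"
    using pochhammer_div_fact[of t s] False by (simp add: field_simps)
  show ?thesis
    unfolding times_divide_eq_right[symmetric] loops unfolding choose poch by simp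
qed simp

text \<open>Lists keep the order of the factors, so every term of the expanded power appears once,
  without multinomial coefficients.\<close>

lemma power_sum_eq_sum_lists:
  fixes f :: "'a \<Rightarrow> 'b::comm_semiring_1"
  assumes "finite S"
  shows "(\<Sum>e\<in>S. f e) ^ t = (\<Sum>L\<in>{L. set L \<subseteq> S \<and> length L = t}. \<Prod>e\<leftarrow>L. f e)"
proof (induction t)
  case 0
  have "{L. set L \<subseteq> S \<and> length L = 0} = {[]}" by auto
  then show ?case by simp
next
  case (Suc t)
  have "(\<Sum>e\<in>S. f e) ^ Suc t = (\<Sum>(e, L)\<in>S \<times> {L. set L \<subseteq> S \<and> length L = t}. f e * (\<Prod>e\<leftarrow>L. f e))"
    using Suc by (simp add: sum_product sum.cartesian_product)
  also have "\<dots> = (\<Sum>L\<in>{L. set L \<subseteq> S \<and> length L = Suc t}. \<Prod>e\<leftarrow>L. f e)"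
    by (rule sum.reindex_bij_witness[where i = "\<lambda>L. (hd L, tl L)" and j = "\<lambda>(e, L). e # L"])
       (auto simp: length_Suc_conv)
  finally show ?case .
qed

section \<open>The symbol of the convex combination tensor\<close>

text \<open>The arcs that the vertex \<open>i\<close> emits when it uses the hyperedge
  \<open>e\<close> once.\<close>

definition edge_arcs :: "nat \<Rightarrow> nat set \<Rightarrow> arcs" where
  "edge_arcs i e = (\<Sum>j\<in>e - {i}. arc i j)"

definition edges_at :: "hgraph \<Rightarrow> nat \<Rightarrow> nat set set" where
  "edges_at H i = {e \<in> edges H. i \<in> e}"

lemma uniform_finite_edges:
  assumes "uniform k H"
  shows "finite (edges H)"
  by (rule finite_subset[of _ "Pow {..<nverts H}"]) (use assms in \<open>auto simp: uniform_def hypergraph_def\<close>)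

lemma uniform_edgeD:
  assumes "uniform k H" "e \<in> edges H"
  shows "card e = k" "e \<subseteq> {..<nverts H}" "finite e"
  using assms finite_subset[of e "{..<nverts H}"] by (auto simp: uniform_def hypergraph_def)

lemma finite_edges_at: "uniform k H \<Longrightarrow> finite (edges_at H i)"
  using uniform_finite_edges by (simp add: edges_at_def)

text \<open>The diagonal part contributes \<open>k - 1\<close> loops. In the adjacency part all
  \<open>(k - 1)!\<close> orderings of \<open>e - {i}\<close> give the same monomial and cancel the
  denominator of the tensor entries.\<close>

lemma tensor_symbol_A_tensor:
  assumes "uniform k H" "i < nverts H" "k \<ge> 1"
  shows "tensor_symbol (nverts H) k (A_tensor \<alpha> k H) i
    = const_poly (\<alpha> * real (degree H i)) * monomial (Poly_Mapping.single (i, i) (k - 1))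
      + (\<Sum>e\<in>edges_at H i. const_poly (1 - \<alpha>) * monomial (edge_arcs i e))"
proof -
  let ?n = "nverts H"
  let ?G = "{\<gamma>. length \<gamma> = k - 1 \<and> set \<gamma> \<subseteq> {..<?n}}"
  let ?m = "\<lambda>\<gamma>. monomial (\<Sum>j\<leftarrow>\<gamma>. arc i j)"
  have fin: "finite ?G"
    using finite_lists_length_eq[of "{..<?n}" "k - 1"] by (simp add: conj_commute)
  have "tensor_symbol ?n k (A_tensor \<alpha> k H) i = (\<Sum>\<gamma>\<in>?G. const_poly (A_tensor \<alpha> k H (i # \<gamma>)) * ?m \<gamma>)"
    by (simp add: tensor_symbol_def indet_def monomial_prod_list)
  also have "\<dots> = (\<Sum>\<gamma>\<in>?G. const_poly (\<alpha> * degree_tensor k H (i # \<gamma>)) * ?m \<gamma>)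
      + (\<Sum>\<gamma>\<in>?G. const_poly ((1 - \<alpha>) * adjacency_tensor k H (i # \<gamma>)) * ?m \<gamma>)"
    by (simp add: A_tensor_def distrib_right sum.distrib flip: const_poly_add)
  also have "(\<Sum>\<gamma>\<in>?G. const_poly (\<alpha> * degree_tensor k H (i # \<gamma>)) * ?m \<gamma>)
      = (\<Sum>\<gamma>\<in>?G. if \<gamma> = replicate (k - 1) i then const_poly (\<alpha> * real (degree H i)) * ?m \<gamma> else 0)"
    using assms(3) by (intro sum.cong) (auto simp: degree_tensor_def neq_Nil_conv Suc_le_eq gr0_conv_Suc)
  also have "\<dots> = const_poly (\<alpha> * real (degree H i)) * ?m (replicate (k - 1) i)"
  proof -
    have "replicate (k - 1) i \<in> ?G" using assms by (auto simp: set_replicate_conv_if)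
    then show ?thesis using fin by (subst sum.delta) auto
  qed
  also have "(\<Sum>j\<leftarrow>replicate (k - 1) i. arc i j) = Poly_Mapping.single (i, i) (k - 1)"
  proof -
    have "(\<Sum>j\<leftarrow>replicate m i. arc i j) = Poly_Mapping.single (i, i) m" for m
      by (induction m) (auto simp flip: single_add)
    then show ?thesis .
  qed
  also have "(\<Sum>\<gamma>\<in>?G. const_poly ((1 - \<alpha>) * adjacency_tensor k H (i # \<gamma>)) * ?m \<gamma>)
      = (\<Sum>\<gamma>\<in>{\<gamma>\<in>?G. set (i # \<gamma>) \<in> edges_at H i}. const_poly ((1 - \<alpha>) / fact (k - 1)) * ?m \<gamma>)"
    using fin by (intro sum.mono_neutral_cong_right) (auto simp: adjacency_tensor_def edges_at_def)
  also have "\<dots> = (\<Sum>e\<in>edges_at H i. \<Sum>\<gamma>\<in>{\<gamma>\<in>{\<gamma>\<in>?G. set (i # \<gamma>) \<in> edges_at H i}. set (i # \<gamma>) = e}.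
      const_poly ((1 - \<alpha>) / fact (k - 1)) * ?m \<gamma>)"
    by (rule sum.group[symmetric])
       (use finite_edges_at[OF assms(1)] in \<open>auto intro: finite_subset[OF _ fin]\<close>)
  also have "\<dots> = (\<Sum>e\<in>edges_at H i. const_poly (1 - \<alpha>) * monomial (edge_arcs i e))"
  proof (intro sum.cong refl)
    fix e assume "e \<in> edges_at H i"
    then have e: "e \<in> edges H" "i \<in> e" by (auto simp: edges_at_def)
    note ed = uniform_edgeD[OF assms(1) e(1)]
    have card: "card (e - {i}) = k - 1" using e(2) ed by simp
    \<comment> \<open>A hyperedge has \<open>k\<close> vertices, so \<open>k - 1\<close> further
      indices complete it only if they are distinct and avoid \<open>i\<close>.\<close>
    have "{\<gamma>\<in>{\<gamma>\<in>?G. set (i # \<gamma>) \<in> edges_at H i}. set (i # \<gamma>) = e} = permutations_of_set (e - {i})"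
      (is "?L = ?R")
    proof (intro Set.set_eqI iffI)
      fix \<gamma> assume g: "\<gamma> \<in> ?L"
      then have *: "insert i (set \<gamma>) = e" "length \<gamma> = k - 1" by auto
      have "e = insert i (set \<gamma> - {i})" using *(1) by auto
      then have "k = Suc (card (set \<gamma> - {i}))"
        using ed(1) by (metis Diff_iff List.finite_set card_insert_disjoint finite_Diff singletonI)
      then have "card (set \<gamma> - {i}) \<ge> length \<gamma>" using * by simp
      moreover have "card (set \<gamma> - {i}) \<le> card (set \<gamma>)" "card (set \<gamma>) \<le> length \<gamma>"
        by (auto intro: card_mono card_length)
      ultimately have "card (set \<gamma>) = length \<gamma>" "card (set \<gamma> - {i}) = card (set \<gamma>)" by linarith+
      then have "distinct \<gamma>" "i \<notin> set \<gamma>"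
        by (auto simp: card_distinct) (cases \<gamma>; auto)
      then show "\<gamma> \<in> ?R" using * by (auto simp: permutations_of_set_def)
    next
      fix \<gamma> assume "\<gamma> \<in> ?R"
      then have "set \<gamma> = e - {i}" "distinct \<gamma>" by (auto simp: permutations_of_set_def)
      then show "\<gamma> \<in> ?L"
        using card distinct_card[of \<gamma>] e ed \<open>e \<in> edges_at H i\<close> by (auto simp: insert_absorb)
    qed
    then have "(\<Sum>\<gamma>\<in>?L. const_poly ((1 - \<alpha>) / fact (k - 1)) * ?m \<gamma>)
        = (\<Sum>\<gamma>\<in>permutations_of_set (e - {i}). const_poly ((1 - \<alpha>) / fact (k - 1)) * monomial (edge_arcs i e))"
      by (intro sum.cong)
         (auto simp: permutations_of_set_def edge_arcs_def sum.distinct_set_conv_list[symmetric])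
    also have "\<dots> = const_poly (real (fact (k - 1))) * (const_poly ((1 - \<alpha>) / fact (k - 1)) * monomial (edge_arcs i e))"
      using card ed(3)
      by (simp only: sum_constant card_permutations_of_set[OF finite_Diff] const_poly_def single_of_nat)
    also have "\<dots> = const_poly (1 - \<alpha>) * monomial (edge_arcs i e)"
      by (simp add: const_poly_mult flip: mult.assoc)
    finally show "(\<Sum>\<gamma>\<in>?L. const_poly ((1 - \<alpha>) / fact (k - 1)) * ?m \<gamma>)
        = const_poly (1 - \<alpha>) * monomial (edge_arcs i e)" .
  qed
  finally show ?thesis .
qed

section \<open>Expansion of the product of symbols over all vertices\<close>

definition term_choices :: "hgraph \<Rightarrow> nat \<Rightarrow> nat \<Rightarrow> (nat \<times> nat set list) set" where
  "term_choices H i d = {(s, L). s + length L = d \<and> set L \<subseteq> edges_at H i}"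

lemma term_choices_eq_Sigma:
  "term_choices H i d = (SIGMA s:{..d}. {L. set L \<subseteq> edges_at H i \<and> length L = d - s})"
  by (auto simp: term_choices_def)

lemma finite_term_choices: "uniform k H \<Longrightarrow> finite (term_choices H i d)"
  unfolding term_choices_eq_Sigma
  by (intro finite_SigmaI finite_lists_length_eq finite_edges_at) auto

text \<open>The binomial coefficient counts the positions of the loop factors among the
  \<open>d\<close> factors, while the order of the hyperedges is kept in the list.\<close>

lemma tensor_symbol_power:
  assumes "uniform k H" "i < nverts H" "k \<ge> 1"
  shows "tensor_symbol (nverts H) k (A_tensor \<alpha> k H) i ^ d
    = (\<Sum>(s, L)\<in>term_choices H i d.
        const_poly (real (d choose s) * (\<alpha> * real (degree H i)) ^ s * (1 - \<alpha>) ^ length L)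
        * monomial (Poly_Mapping.single (i, i) (s * (k - 1)) + (\<Sum>e\<leftarrow>L. edge_arcs i e)))"
proof -
  let ?c = "\<alpha> * real (degree H i)"
  let ?l = "monomial (Poly_Mapping.single (i, i) (k - 1))"
  let ?f = "\<lambda>e. const_poly (1 - \<alpha>) * monomial (edge_arcs i e)"
  have loops: "?l ^ s = monomial (Poly_Mapping.single (i, i) (s * (k - 1)))" for s
    by (induction s) (auto simp: mult_single add.commute simp flip: single_add)
  have lists: "(\<Prod>e\<leftarrow>L. ?f e) = const_poly ((1 - \<alpha>) ^ length L) * monomial (\<Sum>e\<leftarrow>L. edge_arcs i e)" for L
    by (induction L) (auto simp: const_poly_def mult_single)
  have nat: "of_nat m = const_poly (real m)" for m
    by (simp add: const_poly_def)
  have "tensor_symbol (nverts H) k (A_tensor \<alpha> k H) i ^ d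
      = (\<Sum>s\<le>d. of_nat (d choose s) * (const_poly ?c * ?l) ^ s * (\<Sum>e\<in>edges_at H i. ?f e) ^ (d - s))"
    by (simp add: tensor_symbol_A_tensor[OF assms] binomial_ring)
  also have "\<dots> = (\<Sum>s\<le>d. \<Sum>L\<in>{L. set L \<subseteq> edges_at H i \<and> length L = d - s}.
        const_poly (real (d choose s) * ?c ^ s * (1 - \<alpha>) ^ length L)
        * monomial (Poly_Mapping.single (i, i) (s * (k - 1)) + (\<Sum>e\<leftarrow>L. edge_arcs i e)))"
    unfolding power_sum_eq_sum_lists[OF finite_edges_at[OF assms(1)]] sum_distrib_left
    by (intro sum.cong refl)
       (simp only: lists power_mult_distrib const_poly_power loops nat,
        simp add: const_poly_def mult_single del: single_of_nat)
  also have "\<dots> = (\<Sum>(s, L)\<in>term_choices H i d.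
        const_poly (real (d choose s) * ?c ^ s * (1 - \<alpha>) ^ length L)
        * monomial (Poly_Mapping.single (i, i) (s * (k - 1)) + (\<Sum>e\<leftarrow>L. edge_arcs i e)))"
    unfolding term_choices_eq_Sigma
    by (rule sum.Sigma) (auto intro: finite_lists_length_eq finite_edges_at[OF assms(1)])
  finally show ?thesis .
qed

definition list_arcs :: "nat \<Rightarrow> (nat \<Rightarrow> nat set list) \<Rightarrow> arcs" where
  "list_arcs n L = (\<Sum>i<n. \<Sum>e\<leftarrow>L i. edge_arcs i e)"

definition loop_arcs :: "nat \<Rightarrow> (nat \<Rightarrow> nat) \<Rightarrow> arcs" where
  "loop_arcs n s = (\<Sum>i<n. Poly_Mapping.single (i, i) (s i))"

text \<open>The exponent belonging to a vertex is not recorded: it is the number of loop factors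
  plus the length of the list there.\<close>

definition choices :: "hgraph \<Rightarrow> nat \<Rightarrow> (nat \<Rightarrow> nat \<times> nat set list) set" where
  "choices H d = {x \<in> PiE {..<nverts H} (\<lambda>i. UNIV \<times> {L. set L \<subseteq> edges_at H i}).
     (\<Sum>i<nverts H. fst (x i) + length (snd (x i))) = d}"

lemma finite_choices:
  assumes "uniform k H"
  shows "finite (choices H d)"
proof (rule finite_subset)
  show "choices H d \<subseteq> PiE {..<nverts H} (\<lambda>i. {..d} \<times> {L. set L \<subseteq> edges_at H i \<and> length L \<le> d})"
  proof
    fix x assume x: "x \<in> choices H d"
    have le: "fst (x i) + length (snd (x i)) \<le> d" if "i < nverts H" for i
      using x member_le_sum[of i "{..<nverts H}" "\<lambda>i. fst (x i) + length (snd (x i))"] that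
      by (auto simp: choices_def)
    show "x \<in> PiE {..<nverts H} (\<lambda>i. {..d} \<times> {L. set L \<subseteq> edges_at H i \<and> length L \<le> d})"
    proof (rule PiE_I)
      fix i assume "i \<in> {..<nverts H}"
      then show "x i \<in> {..d} \<times> {L. set L \<subseteq> edges_at H i \<and> length L \<le> d}"
        using x le[of i] by (auto simp: choices_def PiE_iff mem_Times_iff)
    qed (use x in \<open>auto simp: choices_def PiE_iff extensional_def\<close>)
  qed
qed (use assms in \<open>auto intro!: finite_PiE finite_lists_length_le finite_edges_at\<close>)

lemma size_edge_arcs: "finite e \<Longrightarrow> i \<in> e \<Longrightarrow> size_arcs (edge_arcs i e) = card e - 1"
  by (simp add: edge_arcs_def weight_sum)

lemma outdeg_edge_arcs:
  "finite e \<Longrightarrow> i \<in> e \<Longrightarrow> outdeg v (edge_arcs i e) = (if v = i then card e - 1 else 0)"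
  by (auto simp: edge_arcs_def weight_sum)

lemma keys_edge_arcs: "Poly_Mapping.keys (edge_arcs i e) \<subseteq> {i} \<times> e"
  using keys_sum[of "\<lambda>j. arc i j" "e - {i}"] by (auto simp: edge_arcs_def)

lemma keys_sum_list_subset:
  "(\<And>x. x \<in> set xs \<Longrightarrow> Poly_Mapping.keys (f x) \<subseteq> A) \<Longrightarrow> Poly_Mapping.keys (\<Sum>x\<leftarrow>xs. f x) \<subseteq> A"
proof (induction xs)
  case (Cons x xs)
  then show ?case using keys_add[of "f x" "\<Sum>x\<leftarrow>xs. f x"] by fastforce
qed simp

lemma keys_list_arcs:
  assumes "uniform k H" "\<And>i. i < nverts H \<Longrightarrow> set (L i) \<subseteq> edges_at H i"
  shows "Poly_Mapping.keys (list_arcs (nverts H) L) \<subseteq> {..<nverts H} \<times> {..<nverts H}"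
proof -
  have "Poly_Mapping.keys (\<Sum>e\<leftarrow>L i. edge_arcs i e) \<subseteq> {..<nverts H} \<times> {..<nverts H}" if "i < nverts H" for i
  proof (rule keys_sum_list_subset)
    fix e assume "e \<in> set (L i)"
    then have "e \<subseteq> {..<nverts H}"
      using assms that uniform_edgeD(2) by (fastforce simp: edges_at_def)
    then show "Poly_Mapping.keys (edge_arcs i e) \<subseteq> {..<nverts H} \<times> {..<nverts H}"
      using keys_edge_arcs[of i e] that by auto
  qed
  then show ?thesis
    unfolding list_arcs_def by (intro order_trans[OF keys_sum]) blast
qed

lemma outdeg_list_arcs:
  assumes "uniform k H" "\<And>i. i < nverts H \<Longrightarrow> set (L i) \<subseteq> edges_at H i" "v < nverts H"
  shows "outdeg v (list_arcs (nverts H) L) = length (L v) * (k - 1)"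
proof -
  have "outdeg v (\<Sum>e\<leftarrow>L i. edge_arcs i e) = (if i = v then length (L v) * (k - 1) else 0)" if "i < nverts H" for i
  proof -
    have "outdeg v (\<Sum>e\<leftarrow>L i. edge_arcs i e) = (\<Sum>e\<leftarrow>L i. if v = i then k - 1 else 0)"
      unfolding weight_sum_list
    proof (intro arg_cong[of _ _ sum_list] map_cong refl)
      fix e assume "e \<in> set (L i)"
      then have "e \<in> edges H" "i \<in> e" using assms(2)[OF that] by (auto simp: edges_at_def)
      then show "outdeg v (edge_arcs i e) = (if v = i then k - 1 else 0)"
        using uniform_edgeD[OF assms(1)] by (simp add: outdeg_edge_arcs)
    qed
    then show ?thesis by (auto simp: sum_list_triv)
  qed
  then show ?thesis
    using assms(3) by (simp add: list_arcs_def weight_sum)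
qed

lemma size_list_arcs:
  assumes "uniform k H" "\<And>i. i < nverts H \<Longrightarrow> set (L i) \<subseteq> edges_at H i"
  shows "size_arcs (list_arcs (nverts H) L) = (\<Sum>i<nverts H. length (L i)) * (k - 1)"
proof -
  have "size_arcs (\<Sum>e\<leftarrow>L i. edge_arcs i e) = length (L i) * (k - 1)" if "i < nverts H" for i
  proof -
    have "size_arcs (\<Sum>e\<leftarrow>L i. edge_arcs i e) = (\<Sum>e\<leftarrow>L i. k - 1)"
      unfolding weight_sum_list
    proof (intro arg_cong[of _ _ sum_list] map_cong refl)
      fix e assume "e \<in> set (L i)"
      then have "e \<in> edges H" "i \<in> e" using assms(2)[OF that] by (auto simp: edges_at_def)
      then show "size_arcs (edge_arcs i e) = k - 1"
        using uniform_edgeD[OF assms(1)] by (simp add: size_edge_arcs)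
    qed
    then show ?thesis by (simp add: sum_list_triv)
  qed
  then show ?thesis
    by (simp add: list_arcs_def weight_sum sum_distrib_right)
qed

definition choice_coeff :: "nat \<Rightarrow> real \<Rightarrow> hgraph \<Rightarrow> (nat \<Rightarrow> nat \<times> nat set list) \<Rightarrow> real" where
  "choice_coeff k \<alpha> H x = (\<Prod>i<nverts H. (case x i of (s, L) \<Rightarrow>
     real ((s + length L) choose s) * (\<alpha> * real (degree H i)) ^ s * (1 - \<alpha>) ^ length L
       / fact ((s + length L) * (k - 1))))"

text \<open>The sum over exponent vectors and the expansions of the powers merge into one sum, by
  grouping the choices according to the exponents that they determine.\<close>

lemma Tr_eq_sum_choices:
  assumes "uniform k H" "k \<ge> 2" "d \<ge> 1"
  defines "n \<equiv> nverts H"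
  shows "Tr n k (A_tensor \<alpha> k H) d = real ((k - 1) ^ (n - 1)) *
    (\<Sum>x\<in>choices H d. choice_coeff k \<alpha> H x * (real (d * (k - 1)) *
       closed_weight (list_arcs n (snd \<circ> x) + loop_arcs n (\<lambda>i. fst (x i) * (k - 1)))))"
proof -
  let ?T = "{ds. length ds = n \<and> sum_list ds = d}"
  let ?g = "\<lambda>x. map (\<lambda>i. fst (x i) + length (snd (x i))) [0..<n]"
  let ?p = "\<lambda>i y. case y of (s, L) \<Rightarrow>
     real ((s + length L) choose s) * (\<alpha> * real (degree H i)) ^ s * (1 - \<alpha>) ^ length L
       / fact ((s + length L) * (k - 1))"
  let ?\<mu> = "\<lambda>i y. Poly_Mapping.single (i, i) (fst y * (k - 1)) + (\<Sum>e\<leftarrow>snd y. edge_arcs i e)"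
  let ?h = "\<lambda>x. choice_coeff k \<alpha> H x * (real (d * (k - 1)) *
       closed_weight (list_arcs n (snd \<circ> x) + loop_arcs n (\<lambda>i. fst (x i) * (k - 1))))"
  have finT: "finite ?T"
  proof (rule finite_subset)
    show "?T \<subseteq> {ds. set ds \<subseteq> {..d} \<and> length ds = n}"
      by (auto intro: member_le_sum_list)
  qed (auto intro: finite_lists_length_eq)
  \<comment> \<open>With the exponents fixed, the choices at different vertices are independent;
    this is the index set that arises from expanding the product.\<close>
  have fiber: "{x \<in> choices H d. ?g x = ds} = PiE {..<n} (\<lambda>i. term_choices H i (ds ! i))"
    if "ds \<in> ?T" for ds
  proof (intro Set.set_eqI iffI)
    fix x assume x: "x \<in> {x \<in> choices H d. ?g x = ds}"
    then have ds: "ds ! i = fst (x i) + length (snd (x i))" if "i < n" for i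
      using that by auto
    show "x \<in> PiE {..<n} (\<lambda>i. term_choices H i (ds ! i))"
    proof (rule PiE_I)
      fix i assume i: "i \<in> {..<n}"
      then have "x i \<in> UNIV \<times> {L. set L \<subseteq> edges_at H i}"
        using x by (auto simp: choices_def n_def)
      then show "x i \<in> term_choices H i (ds ! i)"
        using ds[of i] i by (auto simp: term_choices_def)
    qed (use x in \<open>auto simp: choices_def n_def PiE_iff extensional_def\<close>)
  next
    fix x assume x: "x \<in> PiE {..<n} (\<lambda>i. term_choices H i (ds ! i))"
    then have ds: "fst (x i) + length (snd (x i)) = ds ! i" if "i < n" for i
      using that by (auto simp: PiE_iff term_choices_def split: prod.splits)
    then have g: "?g x = ds"
      using that by (intro nth_equalityI) auto
    have "(\<Sum>i<n. fst (x i) + length (snd (x i))) = sum_list ds"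
      unfolding g[symmetric] by (simp add: sum_list_distinct_conv_sum_set lessThan_atLeast0 interv_sum_list_conv_sum_set_nat)
    moreover have "x \<in> PiE {..<n} (\<lambda>i. UNIV \<times> {L. set L \<subseteq> edges_at H i})"
    proof (rule PiE_I)
      fix i assume "i \<in> {..<n}"
      then have "x i \<in> term_choices H i (ds ! i)" using x by auto
      then show "x i \<in> UNIV \<times> {L. set L \<subseteq> edges_at H i}" by (auto simp: term_choices_def)
    qed (use x in \<open>auto simp: PiE_iff extensional_def\<close>)
    ultimately show "x \<in> {x \<in> choices H d. ?g x = ds}"
      using g that by (simp add: choices_def n_def)
  qed
  have "diff_pairing (\<Prod>i<n. const_poly (1 / fact (ds ! i * (k - 1))) * tensor_symbol n k (A_tensor \<alpha> k H) i ^ (ds ! i))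
         (trace_power n (d * (k - 1)))
      = (\<Sum>x\<in>{x \<in> choices H d. ?g x = ds}. ?h x)" if ds: "ds \<in> ?T" for ds
  proof -
    have "(\<Prod>i<n. const_poly (1 / fact (ds ! i * (k - 1))) * tensor_symbol n k (A_tensor \<alpha> k H) i ^ (ds ! i))
        = (\<Prod>i<n. \<Sum>y\<in>term_choices H i (ds ! i). const_poly (?p i y) * monomial (?\<mu> i y))"
    proof (intro prod.cong refl)
      fix i assume "i \<in> {..<n}"
      then have i: "i < nverts H" by (simp add: n_def)
      have "const_poly (1 / fact (ds ! i * (k - 1))) * tensor_symbol n k (A_tensor \<alpha> k H) i ^ (ds ! i)
          = (\<Sum>y\<in>term_choices H i (ds ! i). const_poly (1 / fact (ds ! i * (k - 1))) *
              (case y of (s, L) \<Rightarrow> const_poly (real (ds ! i choose s) * (\<alpha> * real (degree H i)) ^ s * (1 - \<alpha>) ^ length L)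
        * monomial (Poly_Mapping.single (i, i) (s * (k - 1)) + (\<Sum>e\<leftarrow>L. edge_arcs i e))))"
        using assms(2) unfolding n_def by (subst tensor_symbol_power[OF assms(1) i]) (auto simp: sum_distrib_left)
      also have "\<dots> = (\<Sum>y\<in>term_choices H i (ds ! i). const_poly (?p i y) * monomial (?\<mu> i y))"
        by (intro sum.cong refl) (auto simp: term_choices_def const_poly_def mult_single)
      finally show "const_poly (1 / fact (ds ! i * (k - 1))) * tensor_symbol n k (A_tensor \<alpha> k H) i ^ (ds ! i)
          = (\<Sum>y\<in>term_choices H i (ds ! i). const_poly (?p i y) * monomial (?\<mu> i y))" .
    qed
    also have "\<dots> = (\<Sum>x\<in>PiE {..<n} (\<lambda>i. term_choices H i (ds ! i)).
        const_poly (\<Prod>i<n. ?p i (x i)) * monomial (\<Sum>i<n. ?\<mu> i (x i)))"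
      using finite_term_choices[OF assms(1)]
      by (subst prod_sum_PiE) (auto simp only: prod.distrib const_poly_prod monomial_prod finite_lessThan)
    finally have prod_eq: "(\<Prod>i<n. const_poly (1 / fact (ds ! i * (k - 1))) * tensor_symbol n k (A_tensor \<alpha> k H) i ^ (ds ! i))
        = (\<Sum>x\<in>PiE {..<n} (\<lambda>i. term_choices H i (ds ! i)).
        const_poly (\<Prod>i<n. ?p i (x i)) * monomial (\<Sum>i<n. ?\<mu> i (x i)))" .
    show ?thesis
      unfolding prod_eq fiber[OF ds] diff_pairing_sum_left diff_pairing_const_left
    proof (intro sum.cong refl)
      fix x assume "x \<in> PiE {..<n} (\<lambda>i. term_choices H i (ds ! i))"
      then have x: "x \<in> choices H d" using fiber[OF ds] by blast
      then have L: "set ((snd \<circ> x) i) \<subseteq> edges_at H i" if "i < nverts H" for i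
        using that by (auto simp: choices_def PiE_iff mem_Times_iff)
      have \<mu>: "(\<Sum>i<n. ?\<mu> i (x i)) = list_arcs n (snd \<circ> x) + loop_arcs n (\<lambda>i. fst (x i) * (k - 1))"
        by (simp add: list_arcs_def loop_arcs_def sum.distrib add.commute)
      have "size_arcs (loop_arcs n (\<lambda>i. fst (x i) * (k - 1))) = (\<Sum>i<n. fst (x i)) * (k - 1)"
        by (simp add: loop_arcs_def weight_sum sum_distrib_right)
      then have size: "size_arcs (\<Sum>i<n. ?\<mu> i (x i)) = d * (k - 1)"
        using x size_list_arcs[of k H "snd \<circ> x", OF assms(1) L]
        unfolding \<mu> by (simp add: weight_add n_def choices_def sum.distrib add.commute flip: distrib_right)
      have "Poly_Mapping.keys (loop_arcs n (\<lambda>i. fst (x i) * (k - 1))) \<subseteq> {..<n} \<times> {..<n}"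
        unfolding loop_arcs_def by (rule order_trans[OF keys_sum]) auto
      then have keys: "Poly_Mapping.keys (\<Sum>i<n. ?\<mu> i (x i)) \<subseteq> {..<n} \<times> {..<n}"
        unfolding \<mu> using keys_list_arcs[of k H "snd \<circ> x", OF assms(1) L]
        by (intro order_trans[OF keys_add]) (auto simp: n_def)
      have "d * (k - 1) \<ge> 1" using assms by simp
      from diff_pairing_trace_power[OF size this keys]
      have "diff_pairing (monomial (\<Sum>i<n. ?\<mu> i (x i))) (trace_power n (d * (k - 1)))
          = real (d * (k - 1)) * closed_weight (list_arcs n (snd \<circ> x) + loop_arcs n (\<lambda>i. fst (x i) * (k - 1)))"
        unfolding \<mu> .
      then show "(\<Prod>i<n. ?p i (x i)) * diff_pairing (monomial (\<Sum>i<n. ?\<mu> i (x i))) (trace_power n (d * (k - 1))) = ?h x"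
        by (simp only: choice_coeff_def n_def)
    qed
  qed
  then have "Tr n k (A_tensor \<alpha> k H) d = real ((k - 1) ^ (n - 1)) *
      (\<Sum>ds\<in>?T. \<Sum>x\<in>{x \<in> choices H d. ?g x = ds}. ?h x)"
    by (simp add: Tr_eq_diff_pairing[OF assms(3)])
  also have "(\<Sum>ds\<in>?T. \<Sum>x\<in>{x \<in> choices H d. ?g x = ds}. ?h x) = (\<Sum>x\<in>choices H d. ?h x)"
  proof (rule sum.group)
    show "?g ` choices H d \<subseteq> ?T"
      by (auto simp: choices_def n_def interv_sum_list_conv_sum_set_nat lessThan_atLeast0)
  qed (use finT finite_choices[OF assms(1)] in auto)
  finally show ?thesis .
qed

section \<open>Separating the loops\<close>

definition edge_lists :: "hgraph \<Rightarrow> nat set \<Rightarrow> (nat \<Rightarrow> nat set list) set" where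
  "edge_lists H D = {L \<in> PiE {..<nverts H} (\<lambda>i. {L. set L \<subseteq> edges_at H i}).
     (\<Sum>i<nverts H. length (L i)) \<in> D}"

definition list_coeff :: "nat \<Rightarrow> real \<Rightarrow> nat \<Rightarrow> (nat \<Rightarrow> nat set list) \<Rightarrow> real" where
  "list_coeff k \<alpha> n L = (\<Prod>i<n. (1 - \<alpha>) ^ length (L i) / fact (length (L i) * (k - 1)))"

text \<open>The generating function of the inserted loops when vertex \<open>i\<close> uses
  hyperedges \<open>t i\<close> times.\<close>

definition visit_fps :: "real \<Rightarrow> hgraph \<Rightarrow> (nat \<Rightarrow> nat) \<Rightarrow> real fps" where
  "visit_fps \<alpha> H t = (\<Prod>i<nverts H. geo_fps (\<alpha> * real (degree H i)) ^ t i)"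

lemma finite_edge_lists:
  assumes "uniform k H" "finite D"
  shows "finite (edge_lists H D)"
proof (rule finite_subset)
  show "edge_lists H D \<subseteq> PiE {..<nverts H} (\<lambda>i. {L. set L \<subseteq> edges_at H i \<and> length L \<le> Max D})"
  proof
    fix L assume L: "L \<in> edge_lists H D"
    have le: "length (L i) \<le> Max D" if "i < nverts H" for i
    proof -
      have "length (L i) \<le> (\<Sum>i<nverts H. length (L i))"
        using that by (intro member_le_sum) auto
      also have "\<dots> \<le> Max D"
        using L assms(2) by (intro Max_ge) (auto simp: edge_lists_def)
      finally show ?thesis .
    qed
    show "L \<in> PiE {..<nverts H} (\<lambda>i. {L. set L \<subseteq> edges_at H i \<and> length L \<le> Max D})"
    proof (rule PiE_I)
      fix i assume "i \<in> {..<nverts H}"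
      then show "L i \<in> {L. set L \<subseteq> edges_at H i \<and> length L \<le> Max D}"
        using L le[of i] by (auto simp: edge_lists_def PiE_iff)
    qed (use L in \<open>auto simp: edge_lists_def PiE_iff extensional_def\<close>)
  qed
qed (use assms in \<open>auto intro!: finite_PiE finite_lists_length_le finite_edges_at\<close>)

text \<open>\<open>restrict\<close> is applied because the two components of an extensional
  \<open>x\<close> need not be \<open>undefined\<close> outside the vertex set.\<close>

lemma sum_choices_eq:
  fixes h :: "(nat \<Rightarrow> nat) \<Rightarrow> (nat \<Rightarrow> nat set list) \<Rightarrow> real"
  assumes "uniform k H"
  defines "n \<equiv> nverts H"
  shows "(\<Sum>x\<in>choices H d. h (restrict (fst \<circ> x) {..<n}) (restrict (snd \<circ> x) {..<n}))
    = (\<Sum>L\<in>edge_lists H {..d}. \<Sum>s\<in>compositions {..<n} (d - (\<Sum>i<n. length (L i))). h s L)"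
proof -
  have "(\<Sum>x\<in>choices H d. h (restrict (fst \<circ> x) {..<n}) (restrict (snd \<circ> x) {..<n}))
      = (\<Sum>(L, s)\<in>(SIGMA L:edge_lists H {..d}. compositions {..<n} (d - (\<Sum>i<n. length (L i)))). h s L)"
  proof (rule sum.reindex_bij_witness[where
        j = "\<lambda>x. (restrict (snd \<circ> x) {..<n}, restrict (fst \<circ> x) {..<n})" and
        i = "\<lambda>(L, s). restrict (\<lambda>i. (s i, L i)) {..<n}"])
    fix x assume x: "x \<in> choices H d"
    then have mem: "x i \<in> UNIV \<times> {L. set L \<subseteq> edges_at H i}" if "i < n" for i
      using that by (auto simp: choices_def n_def PiE_iff)
    have ext: "x \<in> extensional {..<n}"
      using x by (auto simp: choices_def n_def PiE_iff)
    have d: "(\<Sum>i<n. fst (x i)) + (\<Sum>i<n. length (snd (x i))) = d"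
      using x by (simp add: choices_def n_def sum.distrib)
    show "(restrict (snd \<circ> x) {..<n}, restrict (fst \<circ> x) {..<n})
        \<in> (SIGMA L:edge_lists H {..d}. compositions {..<n} (d - (\<Sum>i<n. length (L i))))"
      using mem d by (auto simp: edge_lists_def compositions_def n_def[symmetric] mem_Times_iff)
    show "(case (restrict (snd \<circ> x) {..<n}, restrict (fst \<circ> x) {..<n}) of (L, s) \<Rightarrow>
        restrict (\<lambda>i. (s i, L i)) {..<n}) = x"
      using ext by (auto simp: fun_eq_iff extensional_def)
  next
    fix y assume "y \<in> (SIGMA L:edge_lists H {..d}. compositions {..<n} (d - (\<Sum>i<n. length (L i))))"
    then obtain L s where y: "y = (L, s)" "L \<in> edge_lists H {..d}"
      "s \<in> compositions {..<n} (d - (\<Sum>i<n. length (L i)))" by auto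
    then have d: "(\<Sum>i<n. s i) + (\<Sum>i<n. length (L i)) = d"
      by (auto simp: edge_lists_def n_def compositions_def)
    show "(case y of (L, s) \<Rightarrow> restrict (\<lambda>i. (s i, L i)) {..<n}) \<in> choices H d"
      using y d by (auto simp: choices_def n_def[symmetric] sum.distrib edge_lists_def PiE_iff)
    show "(restrict (snd \<circ> (case y of (L, s) \<Rightarrow> restrict (\<lambda>i. (s i, L i)) {..<n})) {..<n},
           restrict (fst \<circ> (case y of (L, s) \<Rightarrow> restrict (\<lambda>i. (s i, L i)) {..<n})) {..<n}) = y"
      using y by (auto simp: fun_eq_iff edge_lists_def compositions_def PiE_iff extensional_def n_def)
  qed auto
  also have "\<dots> = (\<Sum>L\<in>edge_lists H {..d}. \<Sum>s\<in>compositions {..<n} (d - (\<Sum>i<n. length (L i))). h s L)"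
    using finite_edge_lists[OF assms(1)] by (subst sum.Sigma) (auto simp: finite_compositions)
  finally show ?thesis .
qed

text \<open>The terms without hyperedges; up to the common prefactor they form the trace of the
  diagonal tensor with entries \<open>a v\<close>.\<close>

lemma sum_pure_loops:
  assumes "k \<ge> 2" "d \<ge> 1"
  shows "(\<Sum>s\<in>compositions {..<n} d. (\<Prod>i<n. a i ^ s i / fact (s i * (k - 1))) *
       (real (d * (k - 1)) * closed_weight (loop_arcs n (\<lambda>i. s i * (k - 1)))))
    = (\<Sum>v<n. a v ^ d)"
proof -
  let ?P = "\<lambda>s. \<Prod>i<n. a i ^ s i / fact (s i * (k - 1))"
  \<comment> \<open>All \<open>d\<close> loop factors at the vertex \<open>v\<close>; the value
    \<open>undefined\<close> outside the vertex set keeps the function extensional.\<close>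
  let ?s = "\<lambda>v i. if i = v then d else if i < n then 0 else undefined"
  have "?P s * (real (d * (k - 1)) * closed_weight (loop_arcs n (\<lambda>i. s i * (k - 1))))
      = (\<Sum>v<n. if s = ?s v then a v ^ d else 0)" if s: "s \<in> compositions {..<n} d" for s
  proof -
    have if_mult: "x * (if b then y else 0) = (if b then x * y else 0)" for x y :: real and b
      by simp
    have d: "(\<Sum>i<n. s i) = d" and ext: "s \<in> extensional {..<n}"
      using s by (auto simp: compositions_def PiE_iff)
    have sum: "(\<Sum>i<n. s i * (k - 1)) = d * (k - 1)"
      using d by (simp flip: sum_distrib_right)
    have "real (d * (k - 1)) * closed_weight (loop_arcs n (\<lambda>i. s i * (k - 1)))
        = (\<Sum>v<n. if s v * (k - 1) = d * (k - 1) then fact (s v * (k - 1)) else 0)"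
      using closed_weight_loops[of "{..<n}" "\<lambda>i. s i * (k - 1)"] assms unfolding sum loop_arcs_def
      by (simp add: mult.commute)
    also have "\<dots> = (\<Sum>v<n. if s v = d then fact (d * (k - 1)) else 0)"
      using assms by (intro sum.cong) auto
    finally have loops: "real (d * (k - 1)) * closed_weight (loop_arcs n (\<lambda>i. s i * (k - 1)))
        = (\<Sum>v<n. if s v = d then fact (d * (k - 1)) else 0)" .
    have "?P s * (real (d * (k - 1)) * closed_weight (loop_arcs n (\<lambda>i. s i * (k - 1))))
        = (\<Sum>v<n. if s v = d then ?P s * fact (d * (k - 1)) else 0)"
      unfolding loops sum_distrib_left by (rule sum.cong[OF refl], rule if_mult)
    also have "\<dots> = (\<Sum>v<n. if s = ?s v then a v ^ d else 0)"
    proof (intro sum.cong refl)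
      fix v assume v: "v \<in> {..<n}"
      have eq: "s = ?s v" if sv: "s v = d"
      proof
        fix i
        have "s i = 0" if "i < n" "i \<noteq> v"
        proof -
          have "s v + (\<Sum>i\<in>{..<n} - {v}. s i) = d"
            using d v by (simp add: sum.remove)
          then have "(\<Sum>i\<in>{..<n} - {v}. s i) = 0" using sv by simp
          then show ?thesis using that by simp
        qed
        then show "s i = ?s v i"
          using ext sv v by (auto simp: extensional_def)
      qed
      have P: "?P (?s v) = a v ^ d / fact (d * (k - 1))"
      proof -
        have "?P (?s v) = (\<Prod>i<n. if i = v then a v ^ d / fact (d * (k - 1)) else 1)"
          by (intro prod.cong) auto
        then show ?thesis using v by simp
      qed
      show "(if s v = d then ?P s * fact (d * (k - 1)) else 0) = (if s = ?s v then a v ^ d else 0)"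
      proof (cases "s v = d")
        case True
        have "?P s = a v ^ d / fact (d * (k - 1))"
          using arg_cong[OF eq[OF True], of ?P] P by (rule trans)
        then show ?thesis
          unfolding if_P[OF True] if_P[OF eq[OF True]] by simp
      next
        case False
        then have "s \<noteq> ?s v"
          using fun_cong[of s "?s v" v] by auto
        then show ?thesis
          by (simp only: False if_False)
      qed
    qed
    finally show ?thesis .
  qed
  then have "(\<Sum>s\<in>compositions {..<n} d. ?P s * (real (d * (k - 1)) * closed_weight (loop_arcs n (\<lambda>i. s i * (k - 1)))))
      = (\<Sum>s\<in>compositions {..<n} d. \<Sum>v<n. if s = ?s v then a v ^ d else 0)"
    by (intro sum.cong) auto
  also have "\<dots> = (\<Sum>v<n. \<Sum>s\<in>compositions {..<n} d. if s = ?s v then a v ^ d else 0)"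
    by (rule sum.swap)
  also have "\<dots> = (\<Sum>v<n. a v ^ d)"
  proof (intro sum.cong refl)
    fix v assume v: "v \<in> {..<n}"
    have "(\<Sum>i<n. ?s v i) = (\<Sum>i<n. if i = v then d else 0)"
      by (intro sum.cong) auto
    then have "?s v \<in> compositions {..<n} d"
      using v by (auto simp: compositions_def PiE_iff extensional_def)
    then show "(\<Sum>s\<in>compositions {..<n} d. if s = ?s v then a v ^ d else 0) = a v ^ d"
      by (simp add: finite_compositions)
  qed
  finally show ?thesis .
qed

lemma Tr_eq_sum_edge_lists:
  assumes "uniform k H" "k \<ge> 2" "d \<ge> 1"
  defines "n \<equiv> nverts H"
  shows "Tr n k (A_tensor \<alpha> k H) d = real ((k - 1) ^ (n - 1)) *
    ((\<Sum>v<n. (\<alpha> * real (degree H v)) ^ d) + real (d * (k - 1)) *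
     (\<Sum>L\<in>edge_lists H {1..d}. list_coeff k \<alpha> n L * closed_weight (list_arcs n L) *
        fps_nth (visit_fps \<alpha> H (length \<circ> L)) (d - (\<Sum>i<n. length (L i)))))"
proof -
  define a where "a = (\<lambda>i. \<alpha> * real (degree H i))"
  define h where "h = (\<lambda>s (L :: nat \<Rightarrow> nat set list). (\<Prod>i<n. real ((s i + length (L i)) choose s i) * a i ^ s i *
      (1 - \<alpha>) ^ length (L i) / fact ((s i + length (L i)) * (k - 1))) *
    (real (d * (k - 1)) * closed_weight (list_arcs n L + loop_arcs n (\<lambda>i. s i * (k - 1)))))"
  let ?E = "restrict (\<lambda>i. []) {..<n} :: nat \<Rightarrow> nat set list"
  have "Tr n k (A_tensor \<alpha> k H) d = real ((k - 1) ^ (n - 1)) *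
      (\<Sum>x\<in>choices H d. h (restrict (fst \<circ> x) {..<n}) (restrict (snd \<circ> x) {..<n}))"
    unfolding n_def Tr_eq_sum_choices[OF assms(1-3)]
    by (simp add: h_def a_def choice_coeff_def n_def list_arcs_def loop_arcs_def case_prod_unfold)
  also have "\<dots> = real ((k - 1) ^ (n - 1)) *
      (\<Sum>L\<in>edge_lists H {..d}. \<Sum>s\<in>compositions {..<n} (d - (\<Sum>i<n. length (L i))). h s L)"
    unfolding n_def sum_choices_eq[OF assms(1)] ..
  \<comment> \<open>The empty choice is set apart, because the insertion of loops starts from at
    least one arc.\<close>
  also have "edge_lists H {..d} = insert ?E (edge_lists H {1..d})"
  proof (intro Set.set_eqI iffI)
    fix L assume L: "L \<in> edge_lists H {..d}"
    show "L \<in> insert ?E (edge_lists H {1..d})"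
    proof (cases "(\<Sum>i<n. length (L i)) = 0")
      case True
      then have "L = ?E"
        using L by (auto simp: edge_lists_def n_def PiE_iff extensional_def fun_eq_iff)
      then show ?thesis by simp
    next
      case False
      then have "L \<in> edge_lists H {1..d}"
        using L unfolding edge_lists_def n_def mem_Collect_eq atMost_iff atLeastAtMost_iff by linarith
      then show ?thesis by blast
    qed
  qed (auto simp: edge_lists_def n_def PiE_iff)
  also have "(\<Sum>L\<in>insert ?E (edge_lists H {1..d}). \<Sum>s\<in>compositions {..<n} (d - (\<Sum>i<n. length (L i))). h s L)
      = (\<Sum>s\<in>compositions {..<n} d. h s ?E) +
        (\<Sum>L\<in>edge_lists H {1..d}. \<Sum>s\<in>compositions {..<n} (d - (\<Sum>i<n. length (L i))). h s L)"
  proof -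
    define g where "g = (\<lambda>L. \<Sum>s\<in>compositions {..<n} (d - (\<Sum>i<n. length (L i))). h s L)"
    have nin: "?E \<notin> edge_lists H {1..d}" by (simp add: edge_lists_def n_def)
    have fin: "finite (edge_lists H {1..d})" by (rule finite_edge_lists[OF assms(1)]) simp
    have "d - (\<Sum>i<n. length (?E i)) = d" by simp
    then have gE: "g ?E = (\<Sum>s\<in>compositions {..<n} d. h s ?E)" by (simp only: g_def)
    have "sum g (insert ?E (edge_lists H {1..d})) = (\<Sum>s\<in>compositions {..<n} d. h s ?E) + sum g (edge_lists H {1..d})"
      unfolding sum.insert[OF fin nin] gE ..
    then show ?thesis unfolding g_def .
  qed
  also have "(\<Sum>s\<in>compositions {..<n} d. h s ?E) = (\<Sum>v<n. a v ^ d)"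
  proof -
    have "list_arcs n ?E = 0" by (simp add: list_arcs_def)
    then show ?thesis
      using sum_pure_loops[OF assms(2,3), where n = n and a = a] by (simp add: h_def)
  qed
  also have "(\<Sum>L\<in>edge_lists H {1..d}. \<Sum>s\<in>compositions {..<n} (d - (\<Sum>i<n. length (L i))). h s L)
      = (\<Sum>L\<in>edge_lists H {1..d}. real (d * (k - 1)) * (list_coeff k \<alpha> n L * closed_weight (list_arcs n L) *
        fps_nth (visit_fps \<alpha> H (length \<circ> L)) (d - (\<Sum>i<n. length (L i)))))"
  proof (intro sum.cong refl)
    fix L assume L: "L \<in> edge_lists H {1..d}"
    then have sub: "set (L i) \<subseteq> edges_at H i" if "i < nverts H" for i
      using that by (auto simp: edge_lists_def PiE_iff)
    define c where "c = (\<lambda>i s. pochhammer (real (length (L i))) s / fact s * a i ^ s)"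
    have size: "size_arcs (list_arcs n L) \<ge> 1"
      using L assms(2) size_list_arcs[OF assms(1) sub] by (auto simp: edge_lists_def n_def)
    \<comment> \<open>The rising factorials separate over the vertices. At each vertex,
      \<open>loop_coefficient\<close> turns the binomial coefficient, the factorial and the rising
      factorial into a coefficient of a power of a geometric series.\<close>
    have "h s L = real (d * (k - 1)) * (list_coeff k \<alpha> n L * closed_weight (list_arcs n L)) * (\<Prod>i<n. c i (s i))" for s
    proof -
      have "closed_weight (list_arcs n L + loop_arcs n (\<lambda>i. s i * (k - 1)))
          = (\<Prod>i<n. pochhammer (real (outdeg i (list_arcs n L))) (s i * (k - 1))) * closed_weight (list_arcs n L)"
        unfolding loop_arcs_def by (rule closed_weight_add_all_loops[OF size]) simp
      also have "(\<Prod>i<n. pochhammer (real (outdeg i (list_arcs n L))) (s i * (k - 1)))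
          = (\<Prod>i<n. pochhammer (real (length (L i) * (k - 1))) (s i * (k - 1)))"
        using outdeg_list_arcs[OF assms(1) sub] by (intro prod.cong) (auto simp: n_def)
      finally have "h s L = real (d * (k - 1)) * closed_weight (list_arcs n L) *
          (\<Prod>i<n. real ((s i + length (L i)) choose s i) * a i ^ s i *
      (1 - \<alpha>) ^ length (L i) / fact ((s i + length (L i)) * (k - 1)) *
            pochhammer (real (length (L i) * (k - 1))) (s i * (k - 1)))"
        unfolding h_def prod.distrib by (simp only: mult_ac)
      also have "(\<Prod>i<n. real ((s i + length (L i)) choose s i) * a i ^ s i *
      (1 - \<alpha>) ^ length (L i) / fact ((s i + length (L i)) * (k - 1)) *
            pochhammer (real (length (L i) * (k - 1))) (s i * (k - 1)))
          = (\<Prod>i<n. (1 - \<alpha>) ^ length (L i) / fact (length (L i) * (k - 1)) * c i (s i))"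
      proof (intro prod.cong refl)
        fix i
        have "real ((s i + length (L i)) choose s i) * a i ^ s i * (1 - \<alpha>) ^ length (L i)
              / fact ((s i + length (L i)) * (k - 1)) * pochhammer (real (length (L i) * (k - 1))) (s i * (k - 1))
            = (real ((s i + length (L i)) choose s i) * pochhammer (real (length (L i) * (k - 1))) (s i * (k - 1))
              / fact ((s i + length (L i)) * (k - 1))) * (a i ^ s i * (1 - \<alpha>) ^ length (L i))"
          by simp
        also have "\<dots> = (1 - \<alpha>) ^ length (L i) / fact (length (L i) * (k - 1)) * c i (s i)"
          using assms(2) by (subst loop_coefficient) (auto simp: c_def mult_ac)
        finally show "real ((s i + length (L i)) choose s i) * a i ^ s i * (1 - \<alpha>) ^ length (L i)
              / fact ((s i + length (L i)) * (k - 1)) * pochhammer (real (length (L i) * (k - 1))) (s i * (k - 1))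
            = (1 - \<alpha>) ^ length (L i) / fact (length (L i) * (k - 1)) * c i (s i)" .
      qed
      finally show ?thesis
        by (simp only: list_coeff_def prod.distrib mult_ac)
    qed
    then have "(\<Sum>s\<in>compositions {..<n} (d - (\<Sum>i<n. length (L i))). h s L)
        = real (d * (k - 1)) * (list_coeff k \<alpha> n L * closed_weight (list_arcs n L)) *
          (\<Sum>s\<in>compositions {..<n} (d - (\<Sum>i<n. length (L i))). \<Prod>i<n. c i (s i))"
      by (simp add: sum_distrib_left)
    also have "(\<Sum>s\<in>compositions {..<n} (d - (\<Sum>i<n. length (L i))). \<Prod>i<n. c i (s i))
        = fps_nth (\<Prod>i<n. Abs_fps (c i)) (d - (\<Sum>i<n. length (L i)))"
      by (rule sum_compositions_eq_fps_nth) simp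
    also have "(\<Prod>i<n. Abs_fps (c i)) = visit_fps \<alpha> H (length \<circ> L)"
    proof -
      have "Abs_fps (c i) = geo_fps (a i) ^ length (L i)" for i
        by (rule fps_ext) (simp add: c_def geo_fps_power_nth)
      then show ?thesis by (simp add: visit_fps_def n_def a_def)
    qed
    finally show "(\<Sum>s\<in>compositions {..<n} (d - (\<Sum>i<n. length (L i))). h s L)
        = real (d * (k - 1)) * (list_coeff k \<alpha> n L * closed_weight (list_arcs n L) *
        fps_nth (visit_fps \<alpha> H (length \<circ> L)) (d - (\<Sum>i<n. length (L i))))"
      by (simp add: mult.assoc)
  qed
  finally show ?thesis
    by (simp add: a_def sum_distrib_left)
qed

section \<open>Uniform trees of edges\<close>

definition vdeg :: "nat set set \<Rightarrow> nat \<Rightarrow> nat" where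
  "vdeg E v = card {e \<in> E. v \<in> e}"

definition nbrs :: "nat set set \<Rightarrow> nat set \<Rightarrow> nat set set" where
  "nbrs E e = {f \<in> E. f \<noteq> e \<and> f \<inter> e \<noteq> {}}"

text \<open>\<open>hcycle\<close> looks at the hyperedges only, so the number of vertices is filled
  in with 0.\<close>

definition acyclic_edges :: "nat set set \<Rightarrow> bool" where
  "acyclic_edges E \<longleftrightarrow> (\<nexists>vs es. hcycle (HG 0 E) vs es)"

text \<open>Phrased with cuts instead of walks, since this is what enlarges a subtree by one
  hyperedge.\<close>

definition edge_connected :: "nat set set \<Rightarrow> bool" where
  "edge_connected E \<longleftrightarrow> (\<forall>S. S \<subset> E \<longrightarrow> S \<noteq> {} \<longrightarrow> (\<exists>h\<in>E - S. h \<inter> \<Union>S \<noteq> {}))"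

definition edge_tree :: "nat \<Rightarrow> nat set set \<Rightarrow> bool" where
  "edge_tree k E \<longleftrightarrow> finite E \<and> E \<noteq> {} \<and> (\<forall>e\<in>E. finite e \<and> card e = k) \<and>
     edge_connected E \<and> acyclic_edges E"

text \<open>A construction order for trees. Read backwards it removes a hyperedge that meets the
  rest in one vertex, so rule induction peels pendant hyperedges.\<close>

inductive grown :: "nat \<Rightarrow> nat set set \<Rightarrow> bool" for k where
  single: "finite e \<Longrightarrow> card e = k \<Longrightarrow> grown k {e}"
| step: "grown k E \<Longrightarrow> finite e \<Longrightarrow> card e = k \<Longrightarrow> e \<inter> \<Union>E = {v} \<Longrightarrow> grown k (insert e E)"

lemma degree_eq_vdeg: "degree H v = vdeg (edges H) v"
  by (simp add: degree_def vdeg_def)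

lemma acyclic_edges_iff: "acyclic_edges (edges H) \<longleftrightarrow> (\<nexists>vs es. hcycle H vs es)"
  by (simp add: acyclic_edges_def hcycle_def)

lemma acyclic_edges_subset: "acyclic_edges E \<Longrightarrow> F \<subseteq> E \<Longrightarrow> acyclic_edges F"
  unfolding acyclic_edges_def hcycle_def by (metis hgraph.sel(2) order_trans)

lemma acyclic_edges_card_Int:
  assumes "acyclic_edges E" "e \<in> E" "f \<in> E" "e \<noteq> f" "u \<in> e \<inter> f" "v \<in> e \<inter> f"
  shows "u = v"
proof (rule ccontr)
  assume "u \<noteq> v"
  then have "hcycle (HG 0 E) [u, v] [e, f]"
    using assms by (auto simp: hcycle_def less_Suc_eq)
  then show False using assms(1) by (auto simp: acyclic_edges_def)
qed

lemma grown_uniform: "grown k E \<Longrightarrow> e \<in> E \<Longrightarrow> finite e \<and> card e = k"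
  by (induction rule: grown.induct) auto

lemma grown_finite: "grown k E \<Longrightarrow> finite E \<and> E \<noteq> {}"
  by (induction rule: grown.induct) auto

lemma grown_finite_Union: "grown k E \<Longrightarrow> finite (\<Union>E)"
  using grown_uniform grown_finite by blast

lemma grown_step_new:
  assumes "k \<ge> 2" "card e = k" "e \<inter> \<Union>E = {v}"
  shows "e \<notin> E"
proof
  assume "e \<in> E"
  then have "e = {v}" using assms(3) by blast
  then show False using assms by simp
qed

lemma grown_card_Union:
  assumes "grown k E" "k \<ge> 2"
  shows "card (\<Union>E) = card E * (k - 1) + 1"
  using assms(1)
proof (induction rule: grown.induct)
  case (single e)
  then show ?case using assms by simp
next
  case (step E e v)
  have v: "v \<in> e" "v \<in> \<Union>E" using step.hyps(4) by auto
  have "\<Union>(insert e E) = \<Union>E \<union> (e - {v})" using v(2) by auto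
  moreover have "\<Union>E \<inter> (e - {v}) = {}" using step.hyps(4) by auto
  ultimately have "card (\<Union>(insert e E)) = card (\<Union>E) + card (e - {v})"
    using grown_finite_Union[OF step.hyps(1)] step.hyps(2) by (simp add: card_Un_disjoint)
  moreover have "card (e - {v}) = k - 1"
    using step.hyps v(1) by simp
  moreover have "e \<notin> E"
    by (rule grown_step_new[OF assms(2) step.hyps(3,4)])
  ultimately show ?case
    using step.IH grown_finite[OF step.hyps(1)] by simp
qed

text \<open>A cycle through the newest hyperedge would enter and leave it at two different vertices,
  both shared with older hyperedges.\<close>

lemma grown_acyclic:
  assumes "grown k E" "k \<ge> 2"
  shows "acyclic_edges E"
  using assms(1)
proof (induction rule: grown.induct)
  case (single e)
  have False if c: "hcycle (HG 0 {e}) vs es" for vs es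
  proof -
    have "card (set es) \<le> card {e}" using c by (intro card_mono) (auto simp: hcycle_def)
    then show False using c by (simp add: hcycle_def distinct_card)
  qed
  then show ?case by (auto simp: acyclic_edges_def)
next
  case (step E e v)
  have False if c: "hcycle (HG 0 (insert e E)) vs es" for vs es
  proof (cases "e \<in> set es")
    case False
    then have "hcycle (HG 0 E) vs es" using c by (auto simp: hcycle_def)
    then show False using step.IH by (auto simp: acyclic_edges_def)
  next
    case True
    define m where "m = length es"
    from c have m: "m \<ge> 2" "length vs = m" "distinct vs" "distinct es" "set es \<subseteq> insert e E"
      and inc: "\<And>i. i < m \<Longrightarrow> vs ! i \<in> es ! i \<and> vs ! (Suc i mod m) \<in> es ! i"
      by (auto simp: hcycle_def m_def)
    obtain i where i: "i < m" "es ! i = e" using True by (auto simp: in_set_conv_nth m_def)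
    have other: "es ! j \<in> E" if "j < m" "j \<noteq> i" for j
    proof -
      have "es ! j \<in> insert e E" using subsetD[OF m(5) nth_mem[of j es]] that(1) by (simp add: m_def)
      moreover have "es ! j \<noteq> e"
        using m(4) i that nth_eq_iff_index_eq[of es j i] by (auto simp: m_def)
      ultimately show ?thesis by simp
    qed
    \<comment> \<open>\<open>j\<close> and \<open>l\<close> are the cyclic successor and predecessor
      of the position \<open>i\<close> of \<open>e\<close>; the cycle meets \<open>e\<close> in
      \<open>vs ! i\<close> and \<open>vs ! j\<close>.\<close>
    define j where "j = Suc i mod m"
    define l where "l = (i + m - 1) mod m"
    have j: "j < m" "j \<noteq> i" and l: "l < m" "l \<noteq> i" "Suc l mod m = i"
      using m(1) i(1) by (auto simp: j_def l_def mod_Suc mod_if)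
    have "vs ! i \<in> e \<inter> \<Union>E"
      using inc[OF i(1)] inc[OF l(1)] l other[OF l(1,2)] i(2) by auto
    moreover have "vs ! j \<in> e \<inter> \<Union>E"
      using inc[OF i(1)] inc[OF j(1)] other[OF j] i(2) by (auto simp: j_def)
    ultimately have "vs ! i = vs ! j" unfolding step.hyps(4) by simp
    then show False
      using m(2,3) i(1) j nth_eq_iff_index_eq[of vs i j] by auto
  qed
  then show ?case by (auto simp: acyclic_edges_def)
qed

section \<open>Berge paths, and the passage between hypertrees and grown sets of hyperedges\<close>

definition berge_path :: "nat set set \<Rightarrow> nat \<Rightarrow> nat \<Rightarrow> nat list \<Rightarrow> nat set list \<Rightarrow> bool" where
  "berge_path E u v vs es \<longleftrightarrow> length vs = Suc (length es) \<and> distinct vs \<and> distinct es \<and> set es \<subseteq> E \<and>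
     vs ! 0 = u \<and> vs ! length es = v \<and> (\<forall>i<length es. vs ! i \<in> es ! i \<and> vs ! Suc i \<in> es ! i)"

lemma berge_path_set:
  assumes "berge_path E u v vs es" "es \<noteq> []"
  shows "set vs \<subseteq> \<Union>E"
proof
  fix x assume "x \<in> set vs"
  then obtain i where i: "i < length vs" "vs ! i = x" by (auto simp: in_set_conv_nth)
  have mem: "es ! j \<in> E" if "j < length es" for j
    using assms that nth_mem by (auto simp: berge_path_def)
  show "x \<in> \<Union>E"
  proof (cases "i < length es")
    case True
    then show ?thesis using assms i mem[of i] by (auto simp: berge_path_def)
  next
    case False
    then have "i = Suc (length es - 1)" "length es - 1 < length es"
      using i assms by (auto simp: berge_path_def)
    then show ?thesis using assms(1) i mem[of "length es - 1"] unfolding berge_path_def by (metis UnionI)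
  qed
qed

lemma berge_path_Cons:
  assumes "berge_path E u v vs es" "es \<noteq> []" "e \<notin> E" "w \<in> e" "u \<in> e" "w \<notin> \<Union>E"
  shows "berge_path (insert e E) w v (w # vs) (e # es)"
proof -
  have ne: "vs ! 0 = u" using assms(1) by (simp add: berge_path_def)
  have "w \<notin> set vs" using berge_path_set[OF assms(1,2)] assms(6) by blast
  then show ?thesis
    using assms ne by (auto simp: berge_path_def nth_Cons split: nat.splits)
qed

lemma berge_path_rev:
  assumes "berge_path E u v vs es"
  shows "berge_path E v u (rev vs) (rev es)"
proof -
  have "rev vs ! i \<in> rev es ! i \<and> rev vs ! Suc i \<in> rev es ! i" if "i < length es" for i
  proof -
    define j where "j = length es - Suc i"
    have "j < length es" "Suc j = length es - i" using that by (auto simp: j_def)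
    then show ?thesis
      using assms that unfolding berge_path_def j_def by (auto simp: rev_nth)
  qed
  then show ?thesis
    using assms by (auto simp: berge_path_def rev_nth)
qed

lemma grown_berge_path:
  assumes "grown k E" "k \<ge> 2" "u \<in> \<Union>E" "v \<in> \<Union>E" "u \<noteq> v"
  shows "\<exists>vs es. es \<noteq> [] \<and> berge_path E u v vs es"
  using assms(1,3-5)
proof (induction arbitrary: u v rule: grown.induct)
  case (single e)
  then have "berge_path {e} u v [u, v] [e]" by (auto simp: berge_path_def)
  then show ?case by blast
next
  case (step E e w)
  have e: "e \<notin> E" by (rule grown_step_new[OF assms(2) step.hyps(3,4)])
  have direct: ?case if "u \<in> e" "v \<in> e"
  proof -
    have "berge_path (insert e E) u v [u, v] [e]"
      using that step.prems by (auto simp: berge_path_def)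
    then show ?thesis by blast
  qed
  have mono: "berge_path (insert e E) x y vs es" if "berge_path E x y vs es" for x y vs es
    using that by (auto simp: berge_path_def)
  have attach: "\<exists>vs es. es \<noteq> [] \<and> berge_path (insert e E) x y vs es"
    if x: "x \<in> e" "x \<notin> \<Union>E" "y \<in> \<Union>E" "y \<notin> e" for x y
  proof -
    have w: "w \<in> e" "w \<in> \<Union>E" using step.hyps by blast+
    then obtain vs es where "es \<noteq> []" "berge_path E w y vs es"
      using step.IH[of w y] x by blast
    then have "berge_path (insert e E) x y (x # vs) (e # es)"
      using berge_path_Cons e w x by blast
    then show ?thesis by blast
  qed
  consider "u \<in> e" "v \<in> e" | "u \<in> \<Union>E" "v \<in> \<Union>E" | "u \<in> e" "u \<notin> \<Union>E" "v \<in> \<Union>E" "v \<notin> e"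
    | "v \<in> e" "v \<notin> \<Union>E" "u \<in> \<Union>E" "u \<notin> e"
    using step.prems by blast
  then show ?case
  proof cases
    case 2
    then show ?thesis using step.IH step.prems mono by meson
  next
    case 4
    then obtain vs es where "es \<noteq> []" "berge_path (insert e E) v u vs es"
      using attach by blast
    then show ?thesis using berge_path_rev by (metis rev_is_Nil_conv)
  qed (use direct attach in blast)+
qed

text \<open>Two common vertices would be joined by a Berge path inside \<open>E\<close>, and
  \<open>e\<close> would close it to a cycle in \<open>F\<close>.\<close>

lemma grown_touch_once:
  assumes "acyclic_edges F" "grown k E" "k \<ge> 2" "E \<subseteq> F" "e \<in> F" "e \<notin> E" "e \<inter> \<Union>E \<noteq> {}"
  shows "\<exists>v. e \<inter> \<Union>E = {v}"
proof -
  have "u = v" if uv: "u \<in> e \<inter> \<Union>E" "v \<in> e \<inter> \<Union>E" for u v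
  proof (rule ccontr)
    assume "u \<noteq> v"
    then obtain vs es where p: "es \<noteq> []" "berge_path E u v vs es"
      using grown_berge_path[OF assms(2,3), of u v] uv by blast
    define m where "m = length es"
    have vs: "vs \<noteq> []" "length vs = Suc m" "vs ! 0 = u" "vs ! m = v"
      using p by (auto simp: berge_path_def m_def)
    have m: "m > 0" using p by (simp add: m_def)
    have "hcycle (HG 0 F) vs (es @ [e])"
      unfolding hcycle_def
    proof (intro conjI allI impI)
      show "length vs = length (es @ [e])" "2 \<le> length (es @ [e])" "distinct vs" "distinct (es @ [e])"
        "set (es @ [e]) \<subseteq> edges (HG 0 F)"
        using p assms(4-6) m vs(2) by (auto simp: berge_path_def m_def Suc_le_eq)
      fix i assume "i < length (es @ [e])"
      then consider "i < m" | "i = m" by (force simp: m_def)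
      then show "vs ! i \<in> (es @ [e]) ! i" "vs ! (Suc i mod length (es @ [e])) \<in> (es @ [e]) ! i"
        using p uv vs by (cases; auto simp: berge_path_def nth_append m_def)+
    qed
    then show False using assms(1) by (auto simp: acyclic_edges_def)
  qed
  then show ?thesis using assms(7) by blast
qed

text \<open>Take a grown subset of maximal size. If it were proper, connectedness would supply a
  touching hyperedge, and acyclicity would make it attach at a single vertex.\<close>

lemma edge_tree_grown:
  assumes "edge_tree k F" "k \<ge> 2"
  shows "grown k F"
proof -
  have fin: "finite F" "F \<noteq> {}" and uni: "\<And>e. e \<in> F \<Longrightarrow> finite e \<and> card e = k"
    and con: "edge_connected F" and acyc: "acyclic_edges F"
    using assms(1) by (auto simp: edge_tree_def)
  obtain e0 where "e0 \<in> F" using fin by blast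
  then have "grown k {e0}" "{e0} \<subseteq> F" using uni by (auto intro: grown.single)
  moreover have "\<forall>E. grown k E \<and> E \<subseteq> F \<longrightarrow> card E < Suc (card F)"
    using fin card_mono by (auto simp: less_Suc_eq_le)
  ultimately obtain E where E: "grown k E" "E \<subseteq> F" and max: "\<And>E'. grown k E' \<Longrightarrow> E' \<subseteq> F \<Longrightarrow> card E' \<le> card E"
    using ex_has_greatest_nat[of "\<lambda>E. grown k E \<and> E \<subseteq> F" "{e0}" card "Suc (card F)"] by blast
  have "E = F"
  proof (rule ccontr)
    assume "E \<noteq> F"
    then obtain h where h: "h \<in> F - E" "h \<inter> \<Union>E \<noteq> {}"
      using con[unfolded edge_connected_def, rule_format, of E] E grown_finite[OF E(1)] by blast
    then obtain v where "h \<inter> \<Union>E = {v}"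
      using grown_touch_once[OF acyc E(1) assms(2) E(2)] by blast
    then have "grown k (insert h E)" using grown.step[OF E(1)] uni[of h] h(1) by simp
    then have "card (insert h E) \<le> card E" using max h(1) E(2) by blast
    then show False using h(1) grown_finite[OF E(1)] by simp
  qed
  then show ?thesis using E by simp
qed

text \<open>If no hyperedge left \<open>S\<close>, a walk starting in \<open>\<Union>S\<close> could
  never get out. The same kind of walk, started in any hyperedge, shows that every vertex is
  covered.\<close>

lemma hypertree_edge_tree:
  assumes "hypertree H" "uniform k H" "edges H \<noteq> {}" "k \<ge> 2"
  shows "edge_tree k (edges H)" "\<Union>(edges H) = {..<nverts H}"
proof -
  let ?R = "adjacency_rel H"
  have sub: "e \<subseteq> {..<nverts H}" "finite e" "card e = k" if "e \<in> edges H" for e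
    using assms(2) that finite_subset[of e "{..<nverts H}"] by (auto simp: uniform_def hypergraph_def)
  have ne: "\<exists>x. x \<in> e" if "e \<in> edges H" for e
    using sub[OF that] assms(4) by (metis all_not_in_conv card.empty not_numeral_le_zero)
  have con: "(u, v) \<in> ?R\<^sup>*" if "u < nverts H" "v < nverts H" for u v
    using assms(1) that by (auto simp: hypertree_def connected_hg_def)
  have fin: "finite (edges H)"
    by (rule finite_subset[of _ "Pow {..<nverts H}"]) (use sub in auto)
  have "edge_connected (edges H)"
    unfolding edge_connected_def
  proof (intro allI impI, rule ccontr)
    fix S assume S: "S \<subset> edges H" "S \<noteq> {}" and no: "\<not> (\<exists>h\<in>edges H - S. h \<inter> \<Union>S \<noteq> {})"
    obtain e u where u: "e \<in> S" "u \<in> e" using S ne by blast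
    obtain h v where v: "h \<in> edges H - S" "v \<in> h" using S ne by blast
    have "u < nverts H" "v < nverts H" using u v S sub(1) by blast+
    then have "(u, v) \<in> ?R\<^sup>*" by (rule con)
    then have "v \<in> \<Union>S"
    proof (induction rule: rtrancl_induct)
      case base
      then show ?case using u by blast
    next
      case (step y z)
      then show ?case using no by (auto simp: adjacency_rel_def)
    qed
    then show False using no v by blast
  qed
  then show "edge_tree k (edges H)"
    using assms fin sub by (auto simp: edge_tree_def acyclic_edges_iff hypertree_def)
  obtain e u where u: "e \<in> edges H" "u \<in> e" using assms(3) ne by blast
  have "v \<in> \<Union>(edges H)" if "v < nverts H" for v
  proof -
    have "(u, v) \<in> ?R\<^sup>*" using con that u sub(1) by blast
    then show ?thesis
      by (cases rule: rtranclE) (use u in \<open>auto simp: adjacency_rel_def\<close>)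
  qed
  then show "\<Union>(edges H) = {..<nverts H}" using sub(1) by blast
qed

lemma grown_hypertree:
  assumes "grown k E" "k \<ge> 2" "\<Union>E = {..<n}"
  shows "hypertree (HG n E)" "uniform k (HG n E)"
proof -
  have uni: "finite e" "card e = k" if "e \<in> E" for e
    using grown_uniform[OF assms(1) that] by auto
  then show "uniform k (HG n E)"
    using assms by (force simp: uniform_def hypergraph_def)
  have "(u, v) \<in> (adjacency_rel (HG n E))\<^sup>*" if "u \<in> \<Union>E" "v \<in> \<Union>E" for u v
  proof (cases "u = v")
    case False
    have "(u, v) \<in> (adjacency_rel (HG n E))\<^sup>*" if "berge_path E u v vs es" for vs es
      using that
    proof (induction es arbitrary: u vs)
      case Nil
      then show ?case by (auto simp: berge_path_def length_Suc_conv)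
    next
      case (Cons e es)
      then obtain w ws where vs: "vs = u # w # ws"
        by (auto simp: berge_path_def length_Suc_conv)
      have "u \<in> e" "w \<in> e" "e \<in> E"
        using Cons.prems unfolding vs berge_path_def by (auto dest: spec[of _ 0])
      moreover have "berge_path E w v (w # ws) es"
        using Cons.prems unfolding vs berge_path_def by (auto dest: spec[of _ "Suc _"])
      ultimately show ?case
        using Cons.IH by (auto simp: adjacency_rel_def intro: converse_rtrancl_into_rtrancl)
    qed
    then show ?thesis using grown_berge_path[OF assms(1,2) that False] by blast
  qed simp
  then have "connected_hg (HG n E)" using assms(3) by (auto simp: connected_hg_def)
  then show "hypertree (HG n E)"
    using \<open>uniform k (HG n E)\<close> grown_acyclic[OF assms(1,2)] acyclic_edges_iff[of "HG n E"]
    by (auto simp: hypertree_def uniform_def)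
qed

lemma grown_image:
  assumes "grown k E" "inj_on f (\<Union>E)"
  shows "grown k ((`) f ` E)"
  using assms
proof (induction rule: grown.induct)
  case (single e)
  then show ?case by (auto intro!: grown.single simp: card_image)
next
  case (step E e v)
  have "inj_on f (\<Union>E)" "inj_on f e"
    using step.prems by (auto intro: inj_on_subset)
  moreover have "f ` e \<inter> \<Union>((`) f ` E) = f ` (e \<inter> \<Union>E)"
    using step.prems by (auto simp: inj_on_def)
  ultimately show ?case
    using step by (auto intro!: grown.step simp: card_image)
qed

section \<open>Recognising hyperpaths\<close>

lemma path_hyperedge_Suc: "path_hyperedge k (Suc i) = {i * (k - 1)..i * (k - 1) + (k - 1)}"
  by (simp add: path_hyperedge_def add.commute)

lemma path_hyperedge_subset: "1 \<le> i \<Longrightarrow> i \<le> l \<Longrightarrow> path_hyperedge k i \<subseteq> {..l * (k - 1)}"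
  by (auto simp: path_hyperedge_def intro: order_trans[OF _ mult_le_mono1])

lemma card_path_hyperedge: "1 \<le> i \<Longrightarrow> k \<ge> 1 \<Longrightarrow> card (path_hyperedge k i) = k"
  by (cases i) (auto simp: path_hyperedge_Suc)

lemma Union_path_hyperedges: "l \<ge> 1 \<Longrightarrow> (\<Union>i\<in>{1..l}. path_hyperedge k i) = {..l * (k - 1)}"
proof (induction l)
  case (Suc l)
  show ?case
  proof (cases "l = 0")
    case False
    then have "(\<Union>i\<in>{1..Suc l}. path_hyperedge k i) = {..l * (k - 1)} \<union> {l * (k - 1)..l * (k - 1) + (k - 1)}"
      using Suc.IH by (simp add: atLeastAtMostSuc_conv path_hyperedge_Suc Un_commute del: One_nat_def)
    also have "\<dots> = {..Suc l * (k - 1)}" by (auto simp: add.commute)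
    finally show ?thesis .
  qed (auto simp: path_hyperedge_def)
qed simp

lemma grown_path_hyperedges:
  assumes "k \<ge> 2" "l \<ge> 1"
  shows "grown k (path_hyperedge k ` {1..l})"
  using assms(2)
proof (induction l)
  case (Suc l)
  show ?case
  proof (cases "l = 0")
    case True
    then show ?thesis using assms card_path_hyperedge[of 1 k] by (auto intro!: grown.single simp: path_hyperedge_def)
  next
    case False
    have "path_hyperedge k ` {1..Suc l} = insert (path_hyperedge k (Suc l)) (path_hyperedge k ` {1..l})"
      by (simp add: atLeastAtMostSuc_conv)
    moreover have "path_hyperedge k (Suc l) \<inter> \<Union>(path_hyperedge k ` {1..l}) = {l * (k - 1)}"
      using False Union_path_hyperedges[of l k] by (auto simp: path_hyperedge_Suc)
    moreover have "grown k (path_hyperedge k ` {1..l})" using Suc.IH False by simp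
    moreover have "card (path_hyperedge k (Suc l)) = k" "finite (path_hyperedge k (Suc l))"
      using assms card_path_hyperedge[of "Suc l" k] by (simp_all add: path_hyperedge_def)
    ultimately show ?thesis
      using grown.step by metis
  qed
qed simp

lemma path_hyperedge_Int_far:
  assumes "1 \<le> i" "i + 2 \<le> j" "k \<ge> 2"
  shows "path_hyperedge k i \<inter> path_hyperedge k j = {}"
proof -
  have "i * (k - 1) < (j - 1) * (k - 1)" using assms by (intro mult_less_mono1) auto
  then show ?thesis by (auto simp: path_hyperedge_def)
qed

lemma path_hyperedge_Int_next:
  assumes "1 \<le> i"
  shows "i * (k - 1) \<in> path_hyperedge k i \<inter> path_hyperedge k (Suc i)"
  using assms by (auto simp: path_hyperedge_def)

lemma path_hyperedge_inj:
  assumes "k \<ge> 2"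
  shows "inj_on (path_hyperedge k) {1..l}"
proof (rule inj_onI)
  fix i j assume ij: "i \<in> {1..l}" "j \<in> {1..l}" and eq: "path_hyperedge k i = path_hyperedge k j"
  have Max: "Max (path_hyperedge k i) = i * (k - 1)" for i
    by (auto simp: path_hyperedge_def intro!: Max_eqI)
  have "i * (k - 1) = j * (k - 1)" by (metis Max eq)
  then show "i = j" using assms by simp
qed

text \<open>Isomorphisms are built one hyperedge at a time: an embedding of the old numbers
  \<open>A\<close> is extended by mapping the fresh numbers \<open>B\<close> onto the new vertices
  \<open>C\<close>.\<close>

lemma inj_on_extend:
  assumes "inj_on f A" "finite C" "card B = card C" "finite B" "A \<inter> B = {}" "C \<inter> f ` A = {}"
  obtains g where "inj_on g (A \<union> B)" "\<And>a. a \<in> A \<Longrightarrow> g a = f a" "g ` B = C"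
proof -
  obtain h where h: "bij_betw h B C"
    using finite_same_card_bij[OF assms(4,2,3)] by blast
  define g where "g x = (if x \<in> A then f x else h x)" for x
  have gB: "\<And>b. b \<in> B \<Longrightarrow> g b = h b"
    using assms(5) by (auto simp: g_def)
  then have "g ` B = C"
    using h unfolding bij_betw_def by (metis image_cong)
  moreover have "inj_on g (A \<union> B)"
  proof (rule inj_onI)
    fix x y assume xy: "x \<in> A \<union> B" "y \<in> A \<union> B" "g x = g y"
    have A: "g z \<in> f ` A" "g z = f z" if "z \<in> A" for z using that by (auto simp: g_def)
    have B: "g z \<in> C" "g z = h z" if "z \<in> B" for z
      using that h assms(5) by (auto simp: g_def bij_betw_def)
    consider "x \<in> A" "y \<in> A" | "x \<in> B" "y \<in> B" | "x \<in> A" "y \<in> B" | "x \<in> B" "y \<in> A"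
      using xy by blast
    then show "x = y"
    proof cases
      case 1
      then show ?thesis using A(2) assms(1) xy(3) by (auto simp: inj_on_def)
    next
      case 2
      then show ?thesis using B(2) h xy(3) by (auto simp: bij_betw_def inj_on_def)
    next
      case 3
      then show ?thesis using A(1)[of x] B(1)[of y] xy(3) assms(6) by auto
    next
      case 4
      then show ?thesis using A(1)[of y] B(1)[of x] xy(3) assms(6) by auto
    qed
  qed
  moreover have "g a = f a" if "a \<in> A" for a using that by (simp add: g_def)
  ultimately show thesis using that[of g] \<open>g ` B = C\<close> by blast
qed

lemma transpose_image_same:
  assumes "a \<in> A \<longleftrightarrow> b \<in> A"
  shows "transpose a b ` A = A"
  using assms by (auto simp: transpose_def image_def split: if_splits)

text \<open>The path is followed from the leaf \<open>g\<close>. The next hyperedge must attach to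
  the last one, since otherwise an inner hyperedge would get a third neighbour or \<open>g\<close> a
  second. As labels within a hyperedge are free, the vertex of attachment can be moved to the end
  position.\<close>

lemma path_embedding:
  assumes "edge_tree k E" "k \<ge> 2" "g \<in> E" "card (nbrs E g) \<le> 1"
    and nb: "\<And>e. e \<in> E \<Longrightarrow> card (nbrs E e) \<le> 2" and l: "1 \<le> l" "l \<le> card E"
  shows "\<exists>f. inj_on f {..l * (k - 1)} \<and> f ` path_hyperedge k 1 = g \<and>
    (\<forall>i\<in>{1..l}. f ` path_hyperedge k i \<in> E)"
  using l
proof (induction l rule: nat_induct_at_least)
  case base
  have "card {..k - 1} = card g" "finite g"
    using assms(1-3) by (auto simp: edge_tree_def)
  then obtain f where "bij_betw f {..k - 1} g"
    using finite_same_card_bij[of "{..k - 1}" g] by auto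
  moreover have "path_hyperedge k 1 = {..k - 1}"
    by (auto simp: path_hyperedge_def)
  ultimately show ?case
    using assms(3) by (auto simp: bij_betw_def)
next
  case (Suc l)
  let ?P = "path_hyperedge k"
  obtain f where f: "inj_on f {..l * (k - 1)}" "f ` ?P 1 = g" "\<And>i. i \<in> {1..l} \<Longrightarrow> f ` ?P i \<in> E"
    using Suc by auto
  have uni: "\<And>e. e \<in> E \<Longrightarrow> finite e \<and> card e = k" and finE: "finite E"
    and con: "edge_connected E" and acyc: "acyclic_edges E"
    using assms(1) by (auto simp: edge_tree_def)
  have Psub: "?P i \<subseteq> {..l * (k - 1)}" if "i \<in> {1..l}" for i
    using path_hyperedge_subset[of i l k] that by auto
  have Pinj: "i = j" if "f ` ?P i = f ` ?P j" "i \<in> {1..l}" "j \<in> {1..l}" for i j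
  proof -
    have "?P i = ?P j"
      using inj_on_image_eq_iff[OF f(1) Psub[OF that(2)] Psub[OF that(3)]] that(1) by simp
    then show ?thesis by (rule inj_onD[OF path_hyperedge_inj[OF assms(2), of l] _ that(2,3)])
  qed
  define F where "F = (`) f ` ?P ` {1..l}"
  have UP: "\<Union>(?P ` {1..l}) = {..l * (k - 1)}"
    using Union_path_hyperedges[of l k] Suc.hyps by simp
  have grF: "grown k F"
    unfolding F_def using Suc.hyps assms(2) f(1) UP by (intro grown_image grown_path_hyperedges) auto
  have UF: "\<Union>F = f ` {..l * (k - 1)}"
    unfolding F_def UP[symmetric] by blast
  have FE: "F \<subseteq> E" using f(3) by (auto simp: F_def)
  have "card F \<le> l"
    unfolding F_def by (metis card_image_le card_atLeastAtMost diff_Suc_1 finite_atLeastAtMost finite_imageI order_trans)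
  then have "F \<noteq> E" using Suc.prems by auto
  then obtain h where h: "h \<in> E" "h \<notin> F" "h \<inter> \<Union>F \<noteq> {}"
    using con[unfolded edge_connected_def, rule_format, of F] FE grown_finite[OF grF] by blast
  obtain x where x: "h \<inter> \<Union>F = {x}"
    using grown_touch_once[OF acyc grF assms(2) FE h] by blast
  then have "x \<in> f ` {..l * (k - 1)}" using UF by blast
  then obtain y where y: "y \<le> l * (k - 1)" "f y = x" by auto
  have notin: "y \<notin> ?P j" if j: "1 \<le> j" "j < l" for j
  proof
    assume yj: "y \<in> ?P j"
    have jl: "j \<in> {1..l}" "Suc j \<in> {1..l}" using j by auto
    have nbI: "f ` ?P i \<in> nbrs E (f ` ?P j)" if "i \<in> {1..l}" "i \<noteq> j" "z \<in> ?P i \<inter> ?P j" for i z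
      using f(3)[OF that(1)] Pinj[of i j] that jl by (auto simp: nbrs_def)
    have S: "f ` ?P (Suc j) \<in> nbrs E (f ` ?P j)"
      using nbI[of "Suc j"] jl path_hyperedge_Int_next[of j k] by auto
    have hj: "h \<in> nbrs E (f ` ?P j)"
    proof -
      have "x \<in> h \<inter> f ` ?P j" using x y yj by blast
      moreover have "f ` ?P j \<in> F" using jl by (auto simp: F_def)
      ultimately show ?thesis using h by (auto simp: nbrs_def)
    qed
    have hS: "h \<noteq> f ` ?P (Suc j)" using h(2) jl by (auto simp: F_def)
    have fin: "finite (nbrs E e)" for e using finE by (simp add: nbrs_def)
    show False
    proof (cases "j = 1")
      case True
      then have "card {h, f ` ?P (Suc j)} \<le> card (nbrs E g)"
        using S hj f(2) fin by (intro card_mono) auto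
      then show False using hS assms(4) by simp
    next
      case False
      then obtain i where i: "j = Suc i" "i \<in> {1..l}" using j by (cases j) auto
      have B: "f ` ?P i \<in> nbrs E (f ` ?P j)"
        using nbI[of i] i path_hyperedge_Int_next[of i k] by auto
      have "f ` ?P i \<noteq> f ` ?P (Suc j)" using Pinj[of i "Suc j"] i jl by auto
      moreover have "h \<noteq> f ` ?P i" using h(2) i by (auto simp: F_def)
      ultimately have "card {h, f ` ?P (Suc j), f ` ?P i} = 3" using hS by simp
      moreover have "card {h, f ` ?P (Suc j), f ` ?P i} \<le> card (nbrs E (f ` ?P j))"
        using S hj B fin by (intro card_mono) auto
      ultimately show False using nb[OF f(3)[OF jl(1)]] by simp
    qed
  qed
  let ?t = "transpose y (l * (k - 1))"
  \<comment> \<open>Both \<open>y\<close> and the end vertex lie in the last path hyperedge and in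
    no earlier one, so exchanging them maps every path hyperedge onto itself.\<close>
  have iff: "y \<in> ?P i \<longleftrightarrow> l * (k - 1) \<in> ?P i" if "i \<in> {1..l}" for i
  proof (cases "i = l")
    case True
    have "y \<in> ?P l"
    proof -
      have "y \<in> (\<Union>i\<in>{1..l}. ?P i)" using y(1) UP by simp
      then obtain j where "j \<in> {1..l}" "y \<in> ?P j" by blast
      then show ?thesis using notin[of j] by (cases "j = l") auto
    qed
    then show ?thesis using True by (simp add: path_hyperedge_def)
  next
    case False
    then have "i < l" using that by simp
    then have "i * (k - 1) < l * (k - 1)" using assms(2) by simp
    then show ?thesis using notin[of i] that \<open>i < l\<close> by (auto simp: path_hyperedge_def)
  qed
  define f' where "f' = f \<circ> ?t"
  have f'P: "f' ` ?P i = f ` ?P i" if "i \<in> {1..l}" for i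
    unfolding f'_def image_comp[symmetric] using transpose_image_same[OF iff[OF that]] by simp
  have f'A: "f' ` {..l * (k - 1)} = f ` {..l * (k - 1)}"
    unfolding f'_def image_comp[symmetric] using transpose_image_same[of y "{..l * (k - 1)}"] y by simp
  have f'inj: "inj_on f' {..l * (k - 1)}"
    unfolding f'_def using transpose_image_same[of y "{..l * (k - 1)}" "l * (k - 1)"] f(1) y
    by (intro comp_inj_on) (auto simp: inj_on_def dest: transpose_eq_imp_eq)
  have f'x: "f' (l * (k - 1)) = x" using y by (simp add: f'_def)
  let ?B = "{l * (k - 1)<..Suc l * (k - 1)}"
  have "finite h" "card h = k" "x \<in> h" using uni h(1) x by blast+
  then have "card ?B = card (h - {x})" by simp
  moreover have "(h - {x}) \<inter> f' ` {..l * (k - 1)} = {}" using x UF f'A by blast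
  moreover have disjB: "{..l * (k - 1)} \<inter> ?B = {}" by auto
  ultimately obtain f'' where f'': "inj_on f'' ({..l * (k - 1)} \<union> ?B)"
      "\<And>a. a \<in> {..l * (k - 1)} \<Longrightarrow> f'' a = f' a" "f'' ` ?B = h - {x}"
    using inj_on_extend[OF f'inj, of "h - {x}" ?B] \<open>finite h\<close>
    by (metis finite_Diff finite_greaterThanAtMost disjB)
  have "{..l * (k - 1)} \<union> ?B = {..Suc l * (k - 1)}" by auto
  then have inj: "inj_on f'' {..Suc l * (k - 1)}" using f''(1) by simp
  have old: "f'' ` ?P i = f ` ?P i" if "i \<in> {1..l}" for i
    using f'P[OF that] Psub[OF that] f''(2) by (metis image_cong subsetD)
  have "?P (Suc l) = insert (l * (k - 1)) ?B" by (auto simp: path_hyperedge_def)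
  then have "f'' ` ?P (Suc l) = insert (f'' (l * (k - 1))) (h - {x})"
    using f''(3) by simp
  then have new: "f'' ` ?P (Suc l) = h"
    using f''(2) f'x \<open>x \<in> h\<close> by auto
  have "f'' ` ?P i \<in> E" if "i \<in> {1..Suc l}" for i
    using that old f(3) new h(1) by (cases "i = Suc l") auto
  moreover have "f'' ` ?P 1 = g" using old[of 1] f(2) Suc.hyps by simp
  ultimately show ?case using inj by blast
qed

lemma path_embedding_onto:
  assumes "edge_tree k E" "k \<ge> 2" "g \<in> E" "card (nbrs E g) \<le> 1"
    and nb: "\<And>e. e \<in> E \<Longrightarrow> card (nbrs E e) \<le> 2"
  obtains f where "inj_on f {..card E * (k - 1)}" "f ` path_hyperedge k 1 = g"
    "(\<lambda>i. f ` path_hyperedge k i) ` {1..card E} = E"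
proof -
  have finE: "finite E" and "card E \<ge> 1"
    using assms(1) by (auto simp: edge_tree_def Suc_le_eq card_gt_0_iff)
  then obtain f where f: "inj_on f {..card E * (k - 1)}" "f ` path_hyperedge k 1 = g"
    "\<And>i. i \<in> {1..card E} \<Longrightarrow> f ` path_hyperedge k i \<in> E"
    using path_embedding[OF assms, of "card E"] by auto
  have "inj_on (\<lambda>i. f ` path_hyperedge k i) {1..card E}"
  proof (rule inj_onI)
    fix i j assume ij: "i \<in> {1..card E}" "j \<in> {1..card E}" "f ` path_hyperedge k i = f ` path_hyperedge k j"
    then have "path_hyperedge k i = path_hyperedge k j"
      using inj_on_image_eq_iff[OF f(1) path_hyperedge_subset path_hyperedge_subset, of i j] by simp
    then show "i = j" by (rule inj_onD[OF path_hyperedge_inj[OF assms(2), of "card E"] _ ij(1,2)])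
  qed
  then have "card ((\<lambda>i. f ` path_hyperedge k i) ` {1..card E}) = card E"
    by (simp add: card_image)
  then have "(\<lambda>i. f ` path_hyperedge k i) ` {1..card E} = E"
    using finE f(3) by (intro card_subset_eq) auto
  then show thesis using that f by blast
qed

lemma hg_iso_hyperpathI:
  assumes "edge_tree k (edges H)" "\<Union>(edges H) = {..<nverts H}" "k \<ge> 2" "g \<in> edges H"
    and "card (nbrs (edges H) g) \<le> 1" "\<And>e. e \<in> edges H \<Longrightarrow> card (nbrs (edges H) e) \<le> 2"
  shows "hg_iso (hyperpath k (card (edges H))) H"
proof -
  let ?m = "card (edges H)"
  obtain f where f: "inj_on f {..?m * (k - 1)}" "(\<lambda>i. f ` path_hyperedge k i) ` {1..?m} = edges H"
    using path_embedding_onto[OF assms(1,3-6)] by metis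
  have "?m \<ge> 1" using assms(1) by (auto simp: edge_tree_def Suc_le_eq card_gt_0_iff)
  have "f ` {..?m * (k - 1)} = (\<Union>i\<in>{1..?m}. f ` path_hyperedge k i)"
    unfolding Union_path_hyperedges[OF \<open>?m \<ge> 1\<close>, symmetric] by blast
  also have "\<dots> = {..<nverts H}" using f(2) assms(2) by simp
  finally have "bij_betw f {..<nverts (hyperpath k ?m)} {..<nverts H}"
    using f(1) by (simp add: hyperpath_def bij_betw_def lessThan_Suc_atMost)
  moreover have "edges H = (\<lambda>e. f ` e) ` edges (hyperpath k ?m)"
    using f(2) by (simp add: hyperpath_def image_image)
  ultimately show ?thesis unfolding hg_iso_def by blast
qed

section \<open>Recognising a hyperpath with one additional pendant hyperedge\<close>

lemma finite_nbrs: "finite E \<Longrightarrow> finite (nbrs E e)"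
  by (simp add: nbrs_def)

lemma nbrs_mono: "F \<subseteq> E \<Longrightarrow> nbrs F e \<subseteq> nbrs E e"
  by (auto simp: nbrs_def)

lemma nbrs_sym: "e \<in> E \<Longrightarrow> f \<in> nbrs E e \<Longrightarrow> e \<in> nbrs E f"
  by (auto simp: nbrs_def)

text \<open>The leaf touches only \<open>e0\<close>. A set that contains \<open>e0\<close> is
  enlarged by \<open>g\<close> before connectedness is applied; for a set without \<open>e0\<close>
  the hyperedge found cannot be \<open>g\<close>.\<close>

lemma edge_tree_remove_leaf:
  assumes tree: "edge_tree k E" and g: "g \<in> E" "nbrs E g = {e0}"
  shows "edge_tree k (E - {g})"
proof -
  have e0: "e0 \<in> E - {g}" using g(2) by (auto simp: nbrs_def)
  have con: "edge_connected E" using tree by (simp add: edge_tree_def)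
  have nb: "h = e0" if "h \<in> E" "h \<noteq> g" "h \<inter> g \<noteq> {}" for h
    using that g(2) by (auto simp: nbrs_def)
  have "edge_connected (E - {g})"
    unfolding edge_connected_def
  proof (intro allI impI)
    fix S assume S: "S \<subset> E - {g}" "S \<noteq> {}"
    show "\<exists>h\<in>E - {g} - S. h \<inter> \<Union>S \<noteq> {}"
    proof (cases "e0 \<in> S")
      case True
      have "insert g S \<subset> E" using S g(1) by blast
      then obtain h where h: "h \<in> E - insert g S" "h \<inter> \<Union>(insert g S) \<noteq> {}"
        using con[unfolded edge_connected_def, rule_format, of "insert g S"] by blast
      have "h \<inter> g = {}" using nb[of h] h(1) True by blast
      then have "h \<inter> \<Union>S \<noteq> {}" using h(2) by auto
      then show ?thesis using h(1) by blast
    next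
      case False
      have "S \<subset> E" using S by blast
      then obtain h where h: "h \<in> E - S" "h \<inter> \<Union>S \<noteq> {}"
        using con[unfolded edge_connected_def, rule_format, of S] S(2) by blast
      have "h \<noteq> g"
      proof
        assume "h = g"
        then obtain s where "s \<in> S" "s \<inter> g \<noteq> {}" using h(2) by blast
        then have "s = e0" using nb[of s] S by blast
        then show False using False \<open>s \<in> S\<close> by simp
      qed
      then show ?thesis using h by blast
    qed
  qed
  then show ?thesis
    using tree e0 acyclic_edges_subset[of E "E - {g}"] by (auto simp: edge_tree_def)
qed

text \<open>Removing the leaf \<open>g2\<close> leaves a hyperpath, which is numbered from the leaf
  \<open>g1\<close>. Being adjacent to \<open>g1\<close>, the hyperedge \<open>e0\<close> becomes
  the second one, and \<open>g2\<close> hangs at a vertex of it that no other path hyperedge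
  contains; this vertex can be exchanged with \<open>c\<close>.\<close>

lemma hg_iso_F_hgI:
  assumes tree: "edge_tree k (edges H)" and span: "\<Union>(edges H) = {..<nverts H}" and k: "k \<ge> 2"
    and m: "card (edges H) = m" "m \<ge> 3"
    and e0: "e0 \<in> edges H" "card (nbrs (edges H) e0) = 3"
    and others: "\<And>e. e \<in> edges H \<Longrightarrow> e \<noteq> e0 \<Longrightarrow> card (nbrs (edges H) e) \<le> 2"
    and g1: "g1 \<in> nbrs (edges H) e0" "card (nbrs (edges H) g1) = 1"
    and g2: "g2 \<in> nbrs (edges H) e0" "card (nbrs (edges H) g2) = 1" "g1 \<noteq> g2"
    and c: "c \<in> path_hyperedge k 2" "cored (hyperpath k (m - 1)) c"
  shows "hg_iso (F_hg m k c) H"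
proof -
  let ?P = "path_hyperedge k"
  define E where "E = edges H"
  define F where "F = E - {g2}"
  define l where "l = m - 1"
  have finE: "finite E" and uni: "\<And>e. e \<in> E \<Longrightarrow> finite e \<and> card e = k" and acyc: "acyclic_edges E"
    using tree by (auto simp: edge_tree_def E_def)
  have mem: "g1 \<in> E" "g2 \<in> E" "e0 \<in> E" "g1 \<noteq> e0" "g2 \<noteq> e0" "g1 \<inter> e0 \<noteq> {}" "g2 \<inter> e0 \<noteq> {}"
    using g1(1) g2(1) e0(1) by (auto simp: nbrs_def E_def)
  have nb2: "nbrs E g2 = {e0}"
    using g2(2) nbrs_sym[OF e0(1) g2(1)] by (auto simp: E_def card_1_singleton_iff)
  have treeF: "edge_tree k F"
    unfolding F_def using tree mem nb2 by (intro edge_tree_remove_leaf) (auto simp: E_def)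
  have cardF: "card F = l" using finE mem m by (simp add: F_def l_def E_def)
  have finF: "finite F" using finE by (simp add: F_def)
  have leaf: "card (nbrs F g1) \<le> 1"
    using card_mono[OF finite_nbrs[OF finE] nbrs_mono[of F E g1]] g1(2) by (auto simp: F_def E_def)
  have nbF: "card (nbrs F e) \<le> 2" if "e \<in> F" for e
  proof (cases "e = e0")
    case True
    have "nbrs F e0 = nbrs E e0 - {g2}" by (auto simp: nbrs_def F_def)
    then show ?thesis using True e0(2) g2(1) by (simp add: E_def)
  next
    case False
    have "card (nbrs F e) \<le> card (nbrs E e)"
      by (intro card_mono finite_nbrs[OF finE] nbrs_mono) (auto simp: F_def)
    then show ?thesis using others[of e] False that by (auto simp: E_def F_def)
  qed
  obtain f where f: "inj_on f {..l * (k - 1)}" "f ` ?P 1 = g1" "(\<lambda>i. f ` ?P i) ` {1..l} = F"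
    using path_embedding_onto[OF treeF k _ leaf nbF] mem g2(3) cardF by (auto simp: F_def)
  have l2: "l \<ge> 2" using m by (simp add: l_def)
  have PF: "f ` ?P i \<in> F" if "i \<in> {1..l}" for i using f(3) that by blast
  have Psub: "?P i \<subseteq> {..l * (k - 1)}" if "i \<in> {1..l}" for i
    using path_hyperedge_subset[of i l k] that by auto
  have "e0 \<in> F" using mem by (simp add: F_def)
  then obtain i where i: "i \<in> {1..l}" "e0 = f ` ?P i" using f(3) by blast
  have "i = 2"
  proof (rule ccontr)
    assume "i \<noteq> 2"
    moreover have "i \<noteq> 1" using i(2) f(2) mem(4) by auto
    ultimately have "?P 1 \<inter> ?P i = {}" using i(1) k by (intro path_hyperedge_Int_far) auto
    then have "f ` ?P 1 \<inter> f ` ?P i = {}"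
      using inj_on_image_Int[OF f(1) Psub Psub, of 1 i] i(1) l2 by auto
    then show False using f(2) i(2) mem(6) by simp
  qed
  then have e0f: "e0 = f ` ?P 2" using i by simp
  obtain x where x: "x \<in> g2" "x \<in> e0" using mem(7) by blast
  have g2x: "g2 \<inter> \<Union>F = {x}"
  proof -
    have "y = x" if "y \<in> g2" "y \<in> h" "h \<in> F" for y h
    proof -
      have "h \<in> nbrs E g2" using that by (auto simp: nbrs_def F_def)
      then have "h = e0" using nb2 by simp
      then show ?thesis
        using acyclic_edges_card_Int[OF acyc mem(2,3) mem(5)] x that by blast
    qed
    then show ?thesis using x \<open>e0 \<in> F\<close> by blast
  qed
  obtain y where y: "y \<in> ?P 2" "f y = x" using x(2) e0f by blast
  \<comment> \<open>A second path hyperedge through \<open>y\<close> would be another neighbour of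
    the leaf \<open>g2\<close>.\<close>
  have yonly: "i = 2" if "i \<in> {1..l}" "y \<in> ?P i" for i
  proof -
    have "f ` ?P i \<in> nbrs E g2"
      using PF[OF that(1)] that(2) y x by (auto simp: nbrs_def F_def)
    then have "f ` ?P i = f ` ?P 2" using nb2 e0f by simp
    then have "?P i = ?P 2"
      using inj_on_image_eq_iff[OF f(1) Psub Psub, of i 2] that(1) l2 by simp
    then show ?thesis
      using inj_onD[OF path_hyperedge_inj[OF k, of l], of i 2] that(1) l2 by simp
  qed
  have conly: "i = 2" if "i \<in> {1..l}" "c \<in> ?P i" for i
  proof (rule ccontr)
    assume "i \<noteq> 2"
    then have "?P i \<noteq> ?P 2"
      using inj_onD[OF path_hyperedge_inj[OF k, of l], of i 2] that(1) l2 by auto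
    then have "card {?P i, ?P 2} = 2" by simp
    moreover have "card {?P i, ?P 2} \<le> card {e \<in> ?P ` {1..l}. c \<in> e}"
      using that c(1) l2 by (intro card_mono) auto
    ultimately show False using c(2) by (simp add: cored_def degree_def hyperpath_def l_def)
  qed
  define f' where "f' = f \<circ> transpose y c"
  have le: "y \<le> l * (k - 1)" "c \<le> l * (k - 1)"
    using y(1) c(1) Psub[of 2] l2 by auto
  have f'P: "f' ` ?P i = f ` ?P i" if "i \<in> {1..l}" for i
  proof -
    have "y \<in> ?P i \<longleftrightarrow> c \<in> ?P i" using yonly[OF that] conly[OF that] y(1) c(1) by blast
    then show ?thesis unfolding f'_def image_comp[symmetric] using transpose_image_same by simp
  qed
  have f'A: "f' ` {..l * (k - 1)} = f ` {..l * (k - 1)}"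
    unfolding f'_def image_comp[symmetric] using transpose_image_same[of y "{..l * (k - 1)}" c] le by simp
  have f'inj: "inj_on f' {..l * (k - 1)}"
    unfolding f'_def using transpose_image_same[of y "{..l * (k - 1)}" c] f(1) le
    by (intro comp_inj_on) (auto simp: inj_on_def dest: transpose_eq_imp_eq)
  have f'c: "f' c = x" using y by (simp add: f'_def)
  have UF: "f ` {..l * (k - 1)} = \<Union>F"
    using f(3) Union_path_hyperedges[of l k] l2 by (metis One_nat_def Suc_leD image_UN numeral_2_eq_2)
  define N where "N = l * (k - 1) + 1"
  let ?B = "{N..<N + (k - 1)}"
  have g2u: "finite g2" "card g2 = k" using uni mem(2) by auto
  then have "card ?B = card (g2 - {x})" using x(1) by simp
  moreover have "(g2 - {x}) \<inter> f' ` {..l * (k - 1)} = {}" using g2x UF f'A by auto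
  moreover have "{..l * (k - 1)} \<inter> ?B = {}" by (auto simp: N_def)
  ultimately obtain h where h: "inj_on h ({..l * (k - 1)} \<union> ?B)"
      "\<And>a. a \<in> {..l * (k - 1)} \<Longrightarrow> h a = f' a" "h ` ?B = g2 - {x}"
    using inj_on_extend[OF f'inj, of "g2 - {x}" ?B] g2u(1) finite_Diff finite_atLeastLessThan by metis
  have dom: "{..l * (k - 1)} \<union> ?B = {..<N + (k - 1)}" by (auto simp: N_def)
  have hP: "h ` ?P i = f ` ?P i" if "i \<in> {1..l}" for i
    using f'P[OF that] Psub[OF that] h(2) by (metis image_cong subsetD)
  have hlast: "h ` insert c ?B = g2"
    using h(2)[of c] h(3) le f'c x(1) by auto
  have edges: "edges H = (\<lambda>e. h ` e) ` edges (F_hg m k c)"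
  proof -
    have "(\<lambda>e. h ` e) ` edges (F_hg m k c) = insert (h ` insert c ?B) ((\<lambda>i. h ` ?P i) ` {1..l})"
      by (simp add: F_hg_def attach_pendant_def hyperpath_def l_def N_def image_image)
    also have "(\<lambda>i. h ` ?P i) ` {1..l} = (\<lambda>i. f ` ?P i) ` {1..l}"
      by (rule image_cong[OF refl hP])
    finally show ?thesis
      using hlast f(3) mem(2) by (auto simp: F_def E_def)
  qed
  have "h ` {..<N + (k - 1)} = \<Union>(edges H)"
  proof -
    have "h ` {..l * (k - 1)} = \<Union>F"
      using h(2) f'A UF by (metis image_cong)
    then have "h ` {..<N + (k - 1)} = \<Union>F \<union> (g2 - {x})"
      unfolding dom[symmetric] image_Un using h(3) by simp
    also have "\<dots> = \<Union>(insert g2 F)" using g2x by auto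
    also have "insert g2 F = edges H" using mem(2) by (auto simp: F_def E_def)
    finally show ?thesis .
  qed
  then have "bij_betw h {..<nverts (F_hg m k c)} {..<nverts H}"
    using h(1) span unfolding dom
    by (simp add: bij_betw_def F_hg_def attach_pendant_def hyperpath_def l_def N_def)
  then show ?thesis unfolding hg_iso_def using edges by blast
qed

section \<open>Counting in trees of maximum degree two\<close>

lemma sum_vdeg:
  assumes "finite E" "\<And>e. e \<in> E \<Longrightarrow> e \<subseteq> {..<n}"
  shows "(\<Sum>v<n. vdeg E v * w v) = (\<Sum>e\<in>E. \<Sum>v\<in>e. w v)"
proof -
  have "(\<Sum>v<n. vdeg E v * w v) = (\<Sum>v<n. \<Sum>e\<in>E. if v \<in> e then w v else 0)"
    using assms(1) by (simp add: vdeg_def sum.If_cases Int_def)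
  also have "\<dots> = (\<Sum>e\<in>E. \<Sum>v<n. if v \<in> e then w v else 0)"
    by (rule sum.swap)
  also have "\<dots> = (\<Sum>e\<in>E. \<Sum>v\<in>e. w v)"
  proof (rule sum.cong[OF refl])
    fix e assume "e \<in> E"
    then have "{..<n} \<inter> e = e" using assms(2) by blast
    then show "(\<Sum>v<n. if v \<in> e then w v else 0) = (\<Sum>v\<in>e. w v)"
      by (simp add: sum.If_cases)
  qed
  finally show ?thesis .
qed

text \<open>Each neighbour of \<open>e\<close> is sent to the vertex that it shares with
  \<open>e\<close>. This vertex is unique because two common vertices form a cycle, and the map is
  injective because a vertex of degree at most two lies in only one further hyperedge.\<close>

lemma card_nbrs_eq:
  assumes "finite E" "acyclic_edges E" "e \<in> E" "finite e" "\<And>v. v \<in> e \<Longrightarrow> vdeg E v \<le> 2"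
  shows "card (nbrs E e) = card {v \<in> e. vdeg E v = 2}"
proof -
  define s where "s f = (THE v. v \<in> e \<inter> f)" for f
  have s: "s f = v" if "f \<in> nbrs E e" "v \<in> e" "v \<in> f" for f v
    unfolding s_def using that assms(3)
    by (intro the_equality) (auto simp: nbrs_def dest: acyclic_edges_card_Int[OF assms(2)])
  have smem: "s f \<in> e \<inter> f" if "f \<in> nbrs E e" for f
    using that s[OF that] by (auto simp: nbrs_def)
  have fin: "finite {f \<in> E. v \<in> f}" for v using assms(1) by simp
  have "bij_betw s (nbrs E e) {v \<in> e. vdeg E v = 2}"
  proof (rule bij_betw_imageI)
    show "inj_on s (nbrs E e)"
    proof (rule inj_onI)
      fix f g assume fg: "f \<in> nbrs E e" "g \<in> nbrs E e" "s f = s g"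
      show "f = g"
      proof (rule ccontr)
        assume "f \<noteq> g"
        moreover have "e \<noteq> f" "e \<noteq> g" using fg by (auto simp: nbrs_def)
        ultimately have "card {e, f, g} = 3" by simp
        moreover have "{e, f, g} \<subseteq> {h \<in> E. s f \<in> h}"
          using fg smem[OF fg(1)] smem[OF fg(2)] assms(3) by (auto simp: nbrs_def)
        then have "card {e, f, g} \<le> vdeg E (s f)"
          unfolding vdeg_def by (intro card_mono fin)
        ultimately show False using assms(5)[of "s f"] smem[OF fg(1)] by simp
      qed
    qed
    show "s ` nbrs E e = {v \<in> e. vdeg E v = 2}"
    proof (intro Set.set_eqI iffI)
      fix v assume "v \<in> s ` nbrs E e"
      then obtain f where f: "f \<in> nbrs E e" "v = s f" by blast
      have "{e, f} \<subseteq> {h \<in> E. v \<in> h}" using f smem[OF f(1)] assms(3) by (auto simp: nbrs_def)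
      then have "card {e, f} \<le> vdeg E v" unfolding vdeg_def by (intro card_mono fin)
      moreover have "e \<noteq> f" using f(1) by (auto simp: nbrs_def)
      then have "card {e, f} = 2" by simp
      ultimately show "v \<in> {v \<in> e. vdeg E v = 2}"
        using assms(5)[of v] smem[OF f(1)] f(2) by auto
    next
      fix v assume v: "v \<in> {v \<in> e. vdeg E v = 2}"
      then have "card ({h \<in> E. v \<in> h} - {e}) = 1" using assms(3) fin by (simp add: vdeg_def)
      then obtain f where f: "{h \<in> E. v \<in> h} - {e} = {f}" by (auto simp: card_1_singleton_iff)
      then have "f \<in> nbrs E e" "v \<in> f" using v by (auto simp: nbrs_def)
      then show "v \<in> s ` nbrs E e" using s v by force
    qed
  qed
  then show ?thesis by (rule bij_betw_same_card)
qed

lemma sum_nbrs_swap: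
  fixes h :: "nat set \<Rightarrow> nat set \<Rightarrow> 'b::comm_monoid_add"
  assumes "finite E"
  shows "(\<Sum>e\<in>E. \<Sum>f\<in>nbrs E e. h e f) = (\<Sum>e\<in>E. \<Sum>f\<in>nbrs E e. h f e)"
proof -
  have "(\<Sum>e\<in>E. \<Sum>f\<in>nbrs E e. g e f) = (\<Sum>(e, f)\<in>{(e, f). e \<in> E \<and> f \<in> nbrs E e}. g e f)"
    for g :: "nat set \<Rightarrow> nat set \<Rightarrow> 'b"
  proof -
    have "{(e, f). e \<in> E \<and> f \<in> nbrs E e} = (SIGMA e:E. nbrs E e)" by auto
    then show ?thesis using assms by (simp add: sum.Sigma finite_nbrs)
  qed
  moreover have "(\<Sum>(e, f)\<in>{(e, f). e \<in> E \<and> f \<in> nbrs E e}. h e f)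
      = (\<Sum>(e, f)\<in>{(e, f). e \<in> E \<and> f \<in> nbrs E e}. h f e)"
    by (rule sum.reindex_bij_witness[where i = prod.swap and j = prod.swap]) (auto simp: nbrs_def)
  ultimately show ?thesis by simp
qed

section \<open>Which choices of edges close up\<close>

text \<open>\<open>c e v\<close> is how often \<open>v\<close> chooses \<open>e\<close>, and the
  hypothesis equates outdegree and indegree. A vertex lying only in the newest \<open>e\<close>
  satisfies \<open>k\<close> times \<open>c e v\<close> equals the sum of \<open>c e\<close> over
  \<open>e\<close>, so these vertices agree, and then the attaching vertex agrees too. A constant
  hyperedge is balanced by itself and can be removed.\<close>

lemma balanced_constant:
  fixes c :: "nat set \<Rightarrow> nat \<Rightarrow> nat"
  assumes "grown k E" "k \<ge> 2"
    and "\<And>v. v \<in> \<Union>E \<Longrightarrow> (k - 1) * (\<Sum>e\<in>{e \<in> E. v \<in> e}. c e v) = (\<Sum>e\<in>{e \<in> E. v \<in> e}. \<Sum>i\<in>e - {v}. c e i)"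
  shows "\<forall>e\<in>E. \<forall>i\<in>e. \<forall>j\<in>e. c e i = c e j"
  using assms(1,3)
proof (induction rule: grown.induct)
  case (single e)
  have "c e v * k = (\<Sum>i\<in>e. c e i)" if v: "v \<in> e" for v
  proof -
    have "{e' \<in> {e}. v \<in> e'} = {e}" using v by auto
    then have "(k - 1) * c e v = (\<Sum>i\<in>e - {v}. c e i)" using single.prems[of v] v by simp
    then show ?thesis using assms(2) v single.hyps by (cases k) (auto simp: sum.remove[of e v] mult.commute)
  qed
  then show ?case using assms(2) by (metis mult_cancel2 not_numeral_le_zero singletonD)
next
  case (step E e w)
  have w: "w \<in> e" "w \<in> \<Union>E" using step.hyps(4) by auto
  have e: "e \<notin> E" by (rule grown_step_new[OF assms(2) step.hyps(3,4)])
  have finE: "finite E" using grown_finite[OF step.hyps(1)] by simp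
  have own: "c e v * k = (\<Sum>i\<in>e. c e i)" if v: "v \<in> e - {w}" for v
  proof -
    have "v \<notin> \<Union>E"
    proof
      assume "v \<in> \<Union>E"
      then have "v \<in> e \<inter> \<Union>E" using v by simp
      then show False using v unfolding step.hyps(4) by simp
    qed
    then have "{e' \<in> insert e E. v \<in> e'} = {e}" using v by auto
    then have "(k - 1) * c e v = (\<Sum>i\<in>e - {v}. c e i)" using step.prems[of v] v by simp
    then show ?thesis using assms(2) v step.hyps(2) by (cases k) (auto simp: sum.remove[of e v] mult.commute)
  qed
  have "card (e - {w}) = k - 1" using w step.hyps by simp
  then have "e - {w} \<noteq> {}" using assms(2) by (metis One_nat_def card.empty diff_is_0_eq not_less_eq_eq numeral_2_eq_2)
  then obtain u where u: "u \<in> e - {w}" by blast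
  define x where "x = c e u"
  have x: "c e v = x" if "v \<in> e - {w}" for v
    using own[OF that] own[OF u] assms(2) unfolding x_def by (metis mult_cancel2 not_numeral_le_zero)
  have Sw: "(\<Sum>i\<in>e - {w}. c e i) = (k - 1) * x"
    using x \<open>card (e - {w}) = k - 1\<close> by simp
  \<comment> \<open>The balance at \<open>u\<close> now determines the value at the attaching vertex
    \<open>w\<close>.\<close>
  have "x * k = c e w + (k - 1) * x"
    using own[OF u] Sw w step.hyps(2) by (simp add: sum.remove[of e w] x_def)
  then have xw: "c e w = x"
    using assms(2) by (cases k) auto
  have rest: "\<forall>e\<in>E. \<forall>i\<in>e. \<forall>j\<in>e. c e i = c e j"
  proof (rule step.IH)
    fix v assume v: "v \<in> \<Union>E"
    have full: "(k - 1) * (\<Sum>e'\<in>{e' \<in> insert e E. v \<in> e'}. c e' v) = (\<Sum>e'\<in>{e' \<in> insert e E. v \<in> e'}. \<Sum>i\<in>e' - {v}. c e' i)"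
      using step.prems v by blast
    show "(k - 1) * (\<Sum>e\<in>{e \<in> E. v \<in> e}. c e v) = (\<Sum>e\<in>{e \<in> E. v \<in> e}. \<Sum>i\<in>e - {v}. c e i)"
    proof (cases "v \<in> e")
      case True
      then have "v \<in> e \<inter> \<Union>E" using v by simp
      then have vw: "v = w" unfolding step.hyps(4) by simp
      have "{e' \<in> insert e E. v \<in> e'} = insert e {e' \<in> E. v \<in> e'}" using True by auto
      then show ?thesis using full Sw xw e finE vw by (simp add: distrib_left)
    next
      case False
      then have "{e' \<in> insert e E. v \<in> e'} = {e' \<in> E. v \<in> e'}" by auto
      then show ?thesis using full by simp
    qed
  qed
  have "c e i = x" if "i \<in> e" for i
    using x[of i] xw that by (cases "i = w") auto
  then have new: "c e i = c e j" if "i \<in> e" "j \<in> e" for i j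
    using that by simp
  show ?case
  proof (intro ballI)
    fix e' i j assume *: "e' \<in> insert e E" "i \<in> e'" "j \<in> e'"
    show "c e' i = c e' j"
    proof (cases "e' = e")
      case True
      show ?thesis using *(2,3) unfolding True by (rule new)
    next
      case False
      then have "e' \<in> E" using *(1) by simp
      then show ?thesis using rest *(2,3) by blast
    qed
  qed
qed

lemma indeg_edge_arcs: "finite e \<Longrightarrow> indeg v (edge_arcs i e) = (if v \<in> e \<and> v \<noteq> i then 1 else 0)"
  by (simp add: edge_arcs_def weight_sum)

text \<open>For the choices behind a closed word, constancy means that all vertices of
  \<open>e\<close> use it \<open>c e\<close> times; so the total number of uses is a multiple of
  \<open>k\<close>.\<close>

lemma balanced_edge_list:
  assumes uni: "uniform k H" and gr: "grown k (edges H)" and k: "k \<ge> 2"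
    and L: "\<And>i. i < nverts H \<Longrightarrow> set (L i) \<subseteq> edges_at H i"
    and cw: "closed_weight (list_arcs (nverts H) L) \<noteq> 0"
  obtains c where "\<And>i e. i < nverts H \<Longrightarrow> e \<in> edges H \<Longrightarrow> count_list (L i) e = (if i \<in> e then c e else 0)"
    "(\<Sum>i<nverts H. length (L i)) = k * (\<Sum>e\<in>edges H. c e)"
proof -
  let ?n = "nverts H" and ?E = "edges H"
  define c where "c e i = count_list (L i) e" for e i
  have finE: "finite ?E" using uniform_finite_edges[OF uni] .
  have edge: "finite e" "card e = k" "e \<subseteq> {..<?n}" if "e \<in> ?E" for e
    using uniform_edgeD[OF uni that] by auto
  have c0: "c e i = 0" if "i < ?n" "i \<notin> e" for e i
    using L[OF that(1)] that(2) by (auto simp: c_def count_list_0_iff edges_at_def)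
  have c1: "i \<in> e" if "0 < c e i" "i < ?n" for e i
    using c0[OF that(2), of e] that(1) by auto
  have sub: "set (L i) \<subseteq> ?E" if "i < ?n" for i
    using L[OF that] by (auto simp: edges_at_def)
  have len: "length (L i) = (\<Sum>e\<in>{e \<in> ?E. i \<in> e}. c e i)" if "i < ?n" for i
  proof -
    have "length (L i) = (\<Sum>e\<leftarrow>L i. 1)" by (simp add: sum_list_triv)
    also have "\<dots> = (\<Sum>e\<in>{e \<in> ?E. i \<in> e}. c e i)"
      using L[OF that] finE unfolding c_def
      by (subst sum_list_map_eq_sum_count2[where X = "{e \<in> ?E. i \<in> e}"]) (auto simp: edges_at_def)
    finally show ?thesis .
  qed
  have bal: "(k - 1) * (\<Sum>e\<in>{e \<in> ?E. v \<in> e}. c e v) = (\<Sum>e\<in>{e \<in> ?E. v \<in> e}. \<Sum>i\<in>e - {v}. c e i)" if "v \<in> \<Union>?E" for v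
  proof -
    have v: "v < ?n" using that edge(3) by auto
    have "indeg v (list_arcs ?n L) = (\<Sum>i<?n. \<Sum>e\<leftarrow>L i. indeg v (edge_arcs i e))"
      by (simp add: list_arcs_def weight_sum weight_sum_list)
    also have "\<dots> = (\<Sum>i<?n. \<Sum>e\<in>?E. c e i * (if v \<in> e \<and> v \<noteq> i then 1 else 0))"
    proof (rule sum.cong[OF refl])
      fix i assume "i \<in> {..<?n}"
      then have "(\<Sum>e\<leftarrow>L i. indeg v (edge_arcs i e)) = (\<Sum>e\<in>?E. c e i * indeg v (edge_arcs i e))"
        unfolding c_def by (intro sum_list_map_eq_sum_count2 sub finE) simp
      also have "\<dots> = (\<Sum>e\<in>?E. c e i * (if v \<in> e \<and> v \<noteq> i then 1 else 0))"
        using edge(1) by (intro sum.cong refl) (simp add: indeg_edge_arcs)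
      finally show "(\<Sum>e\<leftarrow>L i. indeg v (edge_arcs i e)) = (\<Sum>e\<in>?E. c e i * (if v \<in> e \<and> v \<noteq> i then 1 else 0))" .
    qed
    also have "\<dots> = (\<Sum>e\<in>?E. \<Sum>i<?n. c e i * (if v \<in> e \<and> v \<noteq> i then 1 else 0))"
      by (rule sum.swap)
    also have "\<dots> = (\<Sum>e\<in>?E. if v \<in> e then \<Sum>i\<in>e - {v}. c e i else 0)"
    proof (rule sum.cong[OF refl])
      fix e assume e: "e \<in> ?E"
      have "(\<Sum>i<?n. c e i * (if v \<noteq> i then 1 else 0)) = (\<Sum>i\<in>e - {v}. c e i)"
        using edge(3)[OF e] by (intro sum.mono_neutral_cong_right) (auto dest: c1)
      then show "(\<Sum>i<?n. c e i * (if v \<in> e \<and> v \<noteq> i then 1 else 0)) = (if v \<in> e then \<Sum>i\<in>e - {v}. c e i else 0)"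
        by simp
    qed
    also have "\<dots> = (\<Sum>e\<in>{e \<in> ?E. v \<in> e}. \<Sum>i\<in>e - {v}. c e i)"
      using finE by (simp add: sum.If_cases Int_def)
    finally have "indeg v (list_arcs ?n L) = (\<Sum>e\<in>{e \<in> ?E. v \<in> e}. \<Sum>i\<in>e - {v}. c e i)" .
    moreover have "outdeg v (list_arcs ?n L) = (k - 1) * (\<Sum>e\<in>{e \<in> ?E. v \<in> e}. c e v)"
      using outdeg_list_arcs[OF uni L v] len[OF v] by (simp add: mult.commute)
    ultimately show ?thesis
      using closed_weight_balanced[OF cw, of v] by simp
  qed
  have const: "\<forall>e\<in>?E. \<forall>i\<in>e. \<forall>j\<in>e. c e i = c e j"
    by (rule balanced_constant[OF gr k bal])
  define c' where "c' e = c e (SOME i. i \<in> e)" for e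
  have c': "c e i = c' e" if "e \<in> ?E" "i \<in> e" for e i
    unfolding c'_def using const that someI[of "\<lambda>i. i \<in> e" i] by blast
  show thesis
  proof (rule that)
    show "count_list (L i) e = (if i \<in> e then c' e else 0)" if "i < ?n" "e \<in> ?E" for i e
      using c0[OF that(1)] c'[OF that(2)] by (auto simp flip: c_def)
    have "(\<Sum>i<?n. length (L i)) = (\<Sum>i<?n. \<Sum>e\<in>?E. if i \<in> e then c' e else 0)"
      using len c' finE by (intro sum.cong) (auto simp: sum.If_cases Int_def)
    also have "\<dots> = (\<Sum>e\<in>?E. \<Sum>i<?n. if i \<in> e then c' e else 0)"
      by (rule sum.swap)
    also have "\<dots> = (\<Sum>e\<in>?E. k * c' e)"
    proof (rule sum.cong[OF refl])
      fix e assume e: "e \<in> ?E"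
      have "{..<?n} \<inter> e = e" using edge(3)[OF e] by blast
      then show "(\<Sum>i<?n. if i \<in> e then c' e else 0) = k * c' e"
        using edge(2)[OF e] by (simp add: sum.If_cases)
    qed
    finally show "(\<Sum>i<?n. length (L i)) = k * (\<Sum>e\<in>?E. c' e)"
      by (simp add: sum_distrib_left)
  qed
qed

section \<open>Lists that use one or two hyperedges\<close>

definition edge_list :: "nat \<Rightarrow> nat set \<Rightarrow> nat \<Rightarrow> nat set list" where
  "edge_list n e = restrict (\<lambda>i. if i \<in> e then [e] else []) {..<n}"

text \<open>At a common vertex \<open>e\<close> precedes \<open>f\<close>. For distinct intersecting
  hyperedges the pairs \<open>(e, f)\<close> and \<open>(f, e)\<close> therefore give different
  lists, and both are counted.\<close>

definition edge_pair_list :: "nat \<Rightarrow> nat set \<Rightarrow> nat set \<Rightarrow> nat \<Rightarrow> nat set list" where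
  "edge_pair_list n e f = restrict (\<lambda>i. (if i \<in> e then [e] else []) @ (if i \<in> f then [f] else [])) {..<n}"

text \<open>The complete digraph on \<open>e\<close>, which arises when every vertex of
  \<open>e\<close> uses \<open>e\<close> once.\<close>

definition full_arcs :: "nat set \<Rightarrow> arcs" where
  "full_arcs e = (\<Sum>i\<in>e. edge_arcs i e)"

lemma list_arcs_edge_list:
  assumes "e \<subseteq> {..<n}"
  shows "list_arcs n (edge_list n e) = full_arcs e"
proof -
  have "list_arcs n (edge_list n e) = (\<Sum>i<n. if i \<in> e then edge_arcs i e else 0)"
    by (auto simp: list_arcs_def edge_list_def intro!: sum.cong)
  then show ?thesis using assms by (simp add: sum.If_cases full_arcs_def Int_absorb1)
qed

lemma list_arcs_edge_pair_list:
  assumes "e \<subseteq> {..<n}" "f \<subseteq> {..<n}"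
  shows "list_arcs n (edge_pair_list n e f) = full_arcs e + full_arcs f"
proof -
  have "list_arcs n (edge_pair_list n e f)
      = (\<Sum>i<n. (if i \<in> e then edge_arcs i e else 0) + (if i \<in> f then edge_arcs i f else 0))"
    by (auto simp: list_arcs_def edge_pair_list_def intro!: sum.cong)
  then show ?thesis using assms by (simp add: sum.If_cases full_arcs_def Int_absorb1 sum.distrib)
qed

lemma keys_full_arcs: "Poly_Mapping.keys (full_arcs e) \<subseteq> e \<times> e"
  unfolding full_arcs_def using keys_edge_arcs by (intro order_trans[OF keys_sum]) blast

lemma outdeg_full_arcs:
  assumes "finite e" "v \<in> e"
  shows "outdeg v (full_arcs e) = card e - 1"
  using assms by (simp add: full_arcs_def weight_sum outdeg_edge_arcs)

lemma path_arcs_confined: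
  assumes "Poly_Mapping.keys (path_arcs xs) \<subseteq> A \<times> A \<union> B \<times> B" "A \<inter> B = {}" "xs \<noteq> []" "hd xs \<in> A"
  shows "set xs \<subseteq> A"
  using assms
proof (induction xs rule: path_arcs.induct)
  case (1 x y xs)
  have keys: "Poly_Mapping.keys (path_arcs (x # y # xs)) = insert (x, y) (Poly_Mapping.keys (path_arcs (y # xs)))"
    by (auto simp: in_keys_iff lookup_add lookup_single when_def split: if_splits)
  then have "(x, y) \<in> A \<times> A \<union> B \<times> B" using 1 by auto
  then have "y \<in> A" using 1 by auto
  then show ?case using 1 keys by auto
qed auto

text \<open>A closed word stays within one connected component of its arcs, but vertices of both
  \<open>e\<close> and \<open>f\<close> would have to occur in it.\<close>

lemma closed_weight_disjoint:
  assumes "finite e" "finite f" "card e \<ge> 2" "card f \<ge> 2" "e \<inter> f = {}"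
  shows "closed_weight (full_arcs e + full_arcs f) = 0"
proof (rule ccontr)
  assume "closed_weight (full_arcs e + full_arcs f) \<noteq> 0"
  then have "closed_words (full_arcs e + full_arcs f) \<noteq> {}"
    by (auto simp: closed_weight_def)
  then obtain xs where xs: "xs \<noteq> []" "closed_arcs xs = full_arcs e + full_arcs f"
    unfolding closed_words_def by blast
  have "e \<noteq> {}" "f \<noteq> {}" using assms(3,4) by auto
  then obtain u v where uv: "u \<in> e" "v \<in> f" by blast
  have "outdeg u (closed_arcs xs) > 0" "outdeg v (closed_arcs xs) > 0"
    using uv assms by (auto simp: xs weight_add outdeg_full_arcs)
  then have mem: "u \<in> set xs" "v \<in> set xs"
    unfolding outdeg_closed_arcs by (metis count_list_0_iff less_numeral_extra(3))+
  have keys: "Poly_Mapping.keys (path_arcs (xs @ [hd xs])) \<subseteq> e \<times> e \<union> f \<times> f"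
    using xs(2) keys_add[of "full_arcs e" "full_arcs f"] keys_full_arcs[of e] keys_full_arcs[of f]
    unfolding closed_arcs_def by auto
  have "set xs \<subseteq> fst ` Poly_Mapping.keys (path_arcs (xs @ [hd xs]))"
    using set_eq_keys_closed_arcs[of xs] by (simp add: closed_arcs_def)
  then have "hd xs \<in> e \<or> hd xs \<in> f" using keys xs(1) hd_in_set[of xs] by fastforce
  then have "set xs \<subseteq> e \<or> set xs \<subseteq> f"
  proof
    assume "hd xs \<in> e"
    then show ?thesis using path_arcs_confined[OF keys assms(5)] xs(1) by auto
  next
    assume "hd xs \<in> f"
    moreover have "Poly_Mapping.keys (path_arcs (xs @ [hd xs])) \<subseteq> f \<times> f \<union> e \<times> e" using keys by blast
    ultimately show ?thesis using path_arcs_confined[of "xs @ [hd xs]" f e] assms(5) xs(1) by auto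
  qed
  then show False using mem uv assms(5) by blast
qed

lemma sum_eq_oneE:
  fixes c :: "'a \<Rightarrow> nat"
  assumes "finite A" "sum c A = 1"
  obtains e where "e \<in> A" "\<And>f. f \<in> A \<Longrightarrow> c f = (if f = e then 1 else 0)"
proof -
  obtain e where e: "e \<in> A" "c e \<noteq> 0" using assms by (metis sum.neutral zero_neq_one)
  have "c e + sum c (A - {e}) = 1" using assms e by (simp add: sum.remove)
  then have "c e = 1" "sum c (A - {e}) = 0" using e by auto
  then have "c f = (if f = e then 1 else 0)" if "f \<in> A" for f using assms that by auto
  then show thesis using that e by blast
qed

lemma sum_eq_twoE:
  fixes c :: "'a \<Rightarrow> nat"
  assumes "finite A" "sum c A = 2"
  obtains e f where "e \<in> A" "f \<in> A" "\<And>h. h \<in> A \<Longrightarrow> c h = (if h = e then 1 else 0) + (if h = f then 1 else 0)"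
proof -
  obtain e where e: "e \<in> A" "c e \<noteq> 0" using assms by (metis sum.neutral zero_neq_numeral)
  define b where "b h = c h - (if h = e then 1 else 0)" for h
  have b: "c h = b h + (if h = e then 1 else 0)" for h using e by (auto simp: b_def)
  have "sum c A = sum b A + (\<Sum>h\<in>A. if h = e then 1 else 0)"
    by (simp add: b sum.distrib)
  also have "(\<Sum>h\<in>A. if h = e then 1 else 0) = (1::nat)" using assms e by simp
  finally have "sum b A = 1" using assms(2) by simp
  then obtain f where "f \<in> A" "\<And>h. h \<in> A \<Longrightarrow> b h = (if h = f then 1 else 0)"
    using sum_eq_oneE[OF assms(1)] by blast
  then show thesis using that[of e f] e b by simp
qed

lemma mset_eq_of_counts:
  assumes "\<And>x. count_list xs x = count_list ys x"
  shows "mset xs = mset ys"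
  using assms by (intro multiset_eqI) (simp add: count_mset)

text \<open>The number of uses is \<open>k\<close> times the sum of the multiplicities
  \<open>c e\<close>, hence below \<open>3 * k\<close> this sum is 1 or 2.\<close>

lemma edge_list_of_closed:
  assumes uni: "uniform k H" and gr: "grown k (edges H)" and k: "k \<ge> 2"
    and L: "L \<in> edge_lists H {1..d}" and d: "d < 3 * k"
    and cw: "closed_weight (list_arcs (nverts H) L) \<noteq> 0"
  shows "(\<exists>e\<in>edges H. L = edge_list (nverts H) e) \<or>
    (\<exists>e\<in>edges H. \<exists>f\<in>edges H. e \<inter> f \<noteq> {} \<and> L = edge_pair_list (nverts H) e f)"
proof -
  let ?n = "nverts H" and ?E = "edges H"
  have finE: "finite ?E" using uniform_finite_edges[OF uni] .
  have sub: "set (L i) \<subseteq> edges_at H i" if "i < ?n" for i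
    using L that by (auto simp: edge_lists_def PiE_iff)
  have ext: "L \<in> extensional {..<?n}" using L by (auto simp: edge_lists_def PiE_iff)
  obtain c where c: "\<And>i e. i < ?n \<Longrightarrow> e \<in> ?E \<Longrightarrow> count_list (L i) e = (if i \<in> e then c e else 0)"
    and sum: "(\<Sum>i<?n. length (L i)) = k * (\<Sum>e\<in>?E. c e)"
    using balanced_edge_list[OF uni gr k sub cw] by blast
  have "1 \<le> k * sum c ?E" "k * sum c ?E \<le> d" using L sum by (auto simp: edge_lists_def)
  moreover have "k * sum c ?E < k * 3" using calculation(2) d by (metis le_less_trans mult.commute)
  ultimately have "sum c ?E \<ge> 1" "sum c ?E < 3" by (auto simp: Suc_le_eq)
  then consider "sum c ?E = 1" | "sum c ?E = 2" by linarith
  then show ?thesis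
  proof cases
    case 1
    then obtain e where e: "e \<in> ?E" "\<And>f. f \<in> ?E \<Longrightarrow> c f = (if f = e then 1 else 0)"
      using sum_eq_oneE[OF finE] by blast
    have "L i = edge_list ?n e i" if i: "i < ?n" for i
    proof -
      have "count_list (L i) x = count_list (edge_list ?n e i) x" for x
      proof (cases "x \<in> ?E")
        case True
        then show ?thesis using c[OF i True] e(2)[OF True] i by (auto simp: edge_list_def)
      next
        case False
        then have "x \<notin> set (L i)" using sub[OF i] by (auto simp: edges_at_def)
        then show ?thesis using False e(1) i by (auto simp: edge_list_def count_list_0_iff)
      qed
      then have "mset (L i) = mset (edge_list ?n e i)" by (rule mset_eq_of_counts)
      then show ?thesis using i by (auto simp: edge_list_def split: if_splits)
    qed
    then have "L = edge_list ?n e"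
      using ext by (auto simp: fun_eq_iff edge_list_def extensional_def)
    then show ?thesis using e(1) by blast
  next
    case 2
    then obtain e f where ef: "e \<in> ?E" "f \<in> ?E"
        "\<And>h. h \<in> ?E \<Longrightarrow> c h = (if h = e then 1 else 0) + (if h = f then 1 else 0)"
      using sum_eq_twoE[OF finE] by blast
    have edge: "finite e" "finite f" "card e = k" "card f = k" "e \<subseteq> {..<?n}" "f \<subseteq> {..<?n}"
      using uniform_edgeD[OF uni] ef(1,2) by auto
    \<comment> \<open>The counts determine the lists only up to order. This suffices for the arcs,
      and thereby for \<open>e \<inter> f \<noteq> {}\<close>.\<close>
    have ms: "mset (L i) = mset (edge_pair_list ?n e f i)" if i: "i < ?n" for i
    proof (rule mset_eq_of_counts)
      fix x
      show "count_list (L i) x = count_list (edge_pair_list ?n e f i) x"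
      proof (cases "x \<in> ?E")
        case True
        then show ?thesis using c[OF i True] ef(3)[OF True] i by (auto simp: edge_pair_list_def)
      next
        case False
        then have "x \<notin> set (L i)" using sub[OF i] by (auto simp: edges_at_def)
        then show ?thesis using False ef(1,2) i by (auto simp: edge_pair_list_def count_list_0_iff)
      qed
    qed
    have "list_arcs ?n L = list_arcs ?n (edge_pair_list ?n e f)"
      unfolding list_arcs_def
    proof (rule sum.cong[OF refl])
      fix i assume "i \<in> {..<?n}"
      then show "(\<Sum>e\<leftarrow>L i. edge_arcs i e) = (\<Sum>e\<leftarrow>edge_pair_list ?n e f i. edge_arcs i e)"
        using ms[of i] by (metis lessThan_iff mset_map sum_mset_sum_list)
    qed
    then have "closed_weight (full_arcs e + full_arcs f) \<noteq> 0"
      using cw list_arcs_edge_pair_list[OF edge(5,6)] by simp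
    then have touch: "e \<inter> f \<noteq> {}"
      using closed_weight_disjoint[of e f] edge k by auto
    then obtain v where v: "v \<in> e" "v \<in> f" by blast
    \<comment> \<open>For \<open>e \<noteq> f\<close> only the common vertex \<open>v\<close> has a
      list of length two, and the order there decides between the two ordered pairs.\<close>
    have one: "i = v" if "e \<noteq> f" "i \<in> e" "i \<in> f" for i
      using acyclic_edges_card_Int[OF grown_acyclic[OF gr k] ef(1,2) that(1), of i v] that v by blast
    have two: "xs = [a, b] \<or> xs = [b, a]" if "mset xs = {#a, b#}" for xs :: "nat set list" and a b
    proof -
      have "length xs = 2" using that by (metis size_mset size_add_mset size_empty numeral_2_eq_2)
      then obtain p q where "xs = [p, q]" by (auto simp: length_Suc_conv numeral_2_eq_2)
      then show ?thesis using that by (auto simp: add_eq_conv_ex)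
    qed
    have off: "L i = edge_pair_list ?n e f i" "L i = edge_pair_list ?n f e i" if i: "i < ?n" "\<not> (i \<in> e \<and> i \<in> f)" for i
      using ms[OF i(1)] i by (auto simp: edge_pair_list_def)
    have ext2: "L = edge_pair_list ?n a b" if "\<And>i. i < ?n \<Longrightarrow> L i = edge_pair_list ?n a b i" for a b
      using ext that by (auto simp: fun_eq_iff edge_pair_list_def extensional_def)
    have vn: "v < ?n" using v edge(5) by auto
    have "mset (L v) = {#e, f#}" using ms[OF vn] v vn by (simp add: edge_pair_list_def)
    then have "L v = [e, f] \<or> L v = [f, e]" by (rule two)
    then have "L = edge_pair_list ?n e f \<or> L = edge_pair_list ?n f e"
    proof (cases "e = f")
      case True
      have "L i = edge_pair_list ?n e e i" if i: "i < ?n" for i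
        using ms[OF i] two[of "L i" e e] i True by (auto simp: edge_pair_list_def)
      then show ?thesis using ext2 True by blast
    next
      case False
      from \<open>L v = [e, f] \<or> L v = [f, e]\<close> show ?thesis
      proof
        assume Lv: "L v = [e, f]"
        have "L i = edge_pair_list ?n e f i" if i: "i < ?n" for i
        proof (cases "i = v")
          case True
          then show ?thesis using Lv v vn by (simp add: edge_pair_list_def)
        next
          case False
          then show ?thesis using off(1)[OF i] one[OF \<open>e \<noteq> f\<close>, of i] by blast
        qed
        then show ?thesis using ext2 by blast
      next
        assume Lv: "L v = [f, e]"
        have "L i = edge_pair_list ?n f e i" if i: "i < ?n" for i
        proof (cases "i = v")
          case True
          then show ?thesis using Lv v vn by (simp add: edge_pair_list_def)
        next
          case False
          then show ?thesis using off(2)[OF i] one[OF \<open>e \<noteq> f\<close>, of i] by blast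
        qed
        then show ?thesis using ext2 by blast
      qed
    qed
    then show ?thesis using ef(1,2) touch by (metis Int_commute)
  qed
qed

section \<open>Relabelling vertices\<close>

text \<open>Written as a sum over the arcs so that it is additive for every \<open>f\<close>; for
  injective \<open>f\<close> it merely renames them.\<close>

definition relabel :: "(nat \<Rightarrow> nat) \<Rightarrow> arcs \<Rightarrow> arcs" where
  "relabel f \<mu> = (\<Sum>x\<in>Poly_Mapping.keys \<mu>. Poly_Mapping.single (map_prod f f x) (Poly_Mapping.lookup \<mu> x))"

lemma relabel_superset:
  assumes "finite A" "Poly_Mapping.keys \<mu> \<subseteq> A"
  shows "relabel f \<mu> = (\<Sum>x\<in>A. Poly_Mapping.single (map_prod f f x) (Poly_Mapping.lookup \<mu> x))"
  unfolding relabel_def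
  by (rule sum.mono_neutral_left) (use assms in \<open>auto simp: in_keys_iff\<close>)

lemma relabel_zero [simp]: "relabel f 0 = 0"
  by (simp add: relabel_def)

lemma relabel_single [simp]: "relabel f (Poly_Mapping.single x c) = Poly_Mapping.single (map_prod f f x) c"
  by (simp add: relabel_def)

lemma relabel_add: "relabel f (\<mu> + \<nu>) = relabel f \<mu> + relabel f \<nu>"
proof -
  let ?A = "Poly_Mapping.keys \<mu> \<union> Poly_Mapping.keys \<nu>"
  have "relabel f (\<mu> + \<nu>) = (\<Sum>x\<in>?A. Poly_Mapping.single (map_prod f f x) (Poly_Mapping.lookup (\<mu> + \<nu>) x))"
    by (rule relabel_superset) (use keys_add[of \<mu> \<nu>] in auto)
  moreover have "relabel f \<mu> = (\<Sum>x\<in>?A. Poly_Mapping.single (map_prod f f x) (Poly_Mapping.lookup \<mu> x))"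
    "relabel f \<nu> = (\<Sum>x\<in>?A. Poly_Mapping.single (map_prod f f x) (Poly_Mapping.lookup \<nu> x))"
    by (rule relabel_superset; auto)+
  ultimately show ?thesis
    by (simp add: lookup_add single_add sum.distrib)
qed

lemma relabel_sum: "relabel f (\<Sum>x\<in>A. g x) = (\<Sum>x\<in>A. relabel f (g x))"
  by (induction A rule: infinite_finite_induct) (auto simp: relabel_add)

lemma relabel_relabel: "relabel g (relabel f \<mu>) = relabel (g \<circ> f) \<mu>"
  by (induction \<mu> rule: single_sum_induct) (auto simp: relabel_add map_prod_def split: prod.splits)

lemma relabel_ident:
  assumes "\<And>x. x \<in> U \<Longrightarrow> f x = x" "Poly_Mapping.keys \<mu> \<subseteq> U \<times> U"
  shows "relabel f \<mu> = \<mu>"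
proof -
  have "relabel f \<mu> = (\<Sum>x\<in>Poly_Mapping.keys \<mu>. Poly_Mapping.single x (Poly_Mapping.lookup \<mu> x))"
    unfolding relabel_def
  proof (rule sum.cong[OF refl])
    fix x assume "x \<in> Poly_Mapping.keys \<mu>"
    then have "map_prod f f x = x" using assms by (cases x) auto
    then show "Poly_Mapping.single (map_prod f f x) (Poly_Mapping.lookup \<mu> x) = Poly_Mapping.single x (Poly_Mapping.lookup \<mu> x)"
      by simp
  qed
  also have "\<dots> = \<mu>"
    by (rule poly_mapping_eqI) (simp add: lookup_sum lookup_single when_def in_keys_iff)
  finally show ?thesis .
qed

lemma relabel_path_arcs: "relabel f (path_arcs xs) = path_arcs (map f xs)"
  by (induction xs rule: path_arcs.induct) (auto simp: relabel_add)

lemma relabel_closed_arcs: "xs \<noteq> [] \<Longrightarrow> relabel f (closed_arcs xs) = closed_arcs (map f xs)"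
  by (simp add: closed_arcs_def relabel_path_arcs hd_map)

lemma
  assumes "inj_on f U" "Poly_Mapping.keys \<mu> \<subseteq> U \<times> U"
  shows lookup_relabel: "x \<in> U \<times> U \<Longrightarrow> Poly_Mapping.lookup (relabel f \<mu>) (map_prod f f x) = Poly_Mapping.lookup \<mu> x"
    and keys_relabel: "Poly_Mapping.keys (relabel f \<mu>) = map_prod f f ` Poly_Mapping.keys \<mu>"
proof -
  have inj: "map_prod f f x = map_prod f f y \<longleftrightarrow> x = y" if "x \<in> U \<times> U" "y \<in> U \<times> U" for x y
    using that assms(1) by (auto simp: inj_on_def)
  show *: "Poly_Mapping.lookup (relabel f \<mu>) (map_prod f f x) = Poly_Mapping.lookup \<mu> x" if x: "x \<in> U \<times> U" for x
  proof -
    have "Poly_Mapping.lookup (relabel f \<mu>) (map_prod f f x)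
        = (\<Sum>y\<in>Poly_Mapping.keys \<mu>. if y = x then Poly_Mapping.lookup \<mu> x else 0)"
      unfolding relabel_def lookup_sum
    proof (rule sum.cong[OF refl])
      fix y assume "y \<in> Poly_Mapping.keys \<mu>"
      then have "y \<in> U \<times> U" using assms(2) by blast
      then show "Poly_Mapping.lookup (Poly_Mapping.single (map_prod f f y) (Poly_Mapping.lookup \<mu> y)) (map_prod f f x)
          = (if y = x then Poly_Mapping.lookup \<mu> x else 0)"
        using inj[of y x] x by (auto simp: lookup_single when_def)
    qed
    then show ?thesis by (simp add: in_keys_iff)
  qed
  have sub: "Poly_Mapping.keys (relabel f \<mu>) \<subseteq> map_prod f f ` Poly_Mapping.keys \<mu>"
    unfolding relabel_def by (rule order_trans[OF keys_sum]) auto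
  have mem: "map_prod f f x \<in> Poly_Mapping.keys (relabel f \<mu>)" if "x \<in> Poly_Mapping.keys \<mu>" for x
  proof -
    have "x \<in> U \<times> U" using that assms(2) by blast
    then show ?thesis using *[of x] that by (simp add: in_keys_iff)
  qed
  show "Poly_Mapping.keys (relabel f \<mu>) = map_prod f f ` Poly_Mapping.keys \<mu>"
    by (rule equalityI[OF sub image_subsetI]) (rule mem)
qed

text \<open>Closed weights depend only on the isomorphism type of the arcs, so a single hyperedge, a
  doubled one and an adjacent pair each have one universal weight.\<close>

lemma closed_weight_relabel:
  assumes "inj_on f U" "Poly_Mapping.keys \<mu> \<subseteq> U \<times> U"
  shows "closed_weight (relabel f \<mu>) = closed_weight \<mu>"
proof -
  have sets: "set xs \<subseteq> U" if "xs \<in> closed_words \<mu>" for xs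
    using that assms(2) set_eq_keys_closed_arcs[of xs] by (auto simp: closed_words_def)
  define g where "g = inv_into U f"
  have gf: "(g \<circ> f) x = x" if "x \<in> U" for x
    using that assms(1) by (simp add: g_def)
  have fg: "f (g y) = y" if "y \<in> f ` U" for y
    using that by (simp add: g_def f_inv_into_f)
  have "bij_betw (map f) (closed_words \<mu>) (closed_words (relabel f \<mu>))"
  proof (rule bij_betw_imageI)
    show "inj_on (map f) (closed_words \<mu>)"
    proof (rule inj_onI)
      fix xs ys assume "xs \<in> closed_words \<mu>" "ys \<in> closed_words \<mu>" "map f xs = map f ys"
      then show "xs = ys"
        using sets[of xs] sets[of ys] assms(1) by (metis inj_on_subset map_inj_on le_sup_iff)
    qed
    show "map f ` closed_words \<mu> = closed_words (relabel f \<mu>)"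
    proof (intro Set.set_eqI iffI)
      fix ys assume "ys \<in> map f ` closed_words \<mu>"
      then show "ys \<in> closed_words (relabel f \<mu>)"
        by (auto simp: closed_words_def relabel_closed_arcs)
    next
      fix ys assume "ys \<in> closed_words (relabel f \<mu>)"
      then have ys: "ys \<noteq> []" "closed_arcs ys = relabel f \<mu>" by (auto simp: closed_words_def)
      have "set ys \<subseteq> f ` U"
        using set_eq_keys_closed_arcs[of ys] keys_relabel[OF assms] assms(2) unfolding ys(2) by auto
      then have "map f (map g ys) = ys"
        using fg by (simp add: map_idI subset_iff)
      moreover have "closed_arcs (map g ys) = \<mu>"
        using relabel_closed_arcs[OF ys(1), of g] relabel_ident[of U "g \<circ> f", OF gf assms(2)]
        by (simp add: ys(2) relabel_relabel)
      then have "map g ys \<in> closed_words \<mu>" using ys(1) by (simp add: closed_words_def)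
      ultimately show "ys \<in> map f ` closed_words \<mu>" by (metis imageI)
    qed
  qed
  then have "card (closed_words (relabel f \<mu>)) = card (closed_words \<mu>)"
    by (rule bij_betw_same_card[THEN sym])
  moreover have "size_arcs (relabel f \<mu>) = size_arcs \<mu>"
    by (simp add: relabel_def weight_sum) (simp add: weight_def)
  moreover have "mfact (relabel f \<mu>) = mfact \<mu>"
  proof -
    have "inj_on (map_prod f f) (Poly_Mapping.keys \<mu>)"
      using assms by (intro inj_on_subset[OF map_prod_inj_on[OF assms(1,1)]])
    then have "mfact (relabel f \<mu>) = (\<Prod>x\<in>Poly_Mapping.keys \<mu>. fact (Poly_Mapping.lookup (relabel f \<mu>) (map_prod f f x)))"
      unfolding mfact_def keys_relabel[OF assms] by (simp add: prod.reindex)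
    also have "\<dots> = mfact \<mu>"
      unfolding mfact_def using lookup_relabel[OF assms] assms(2) by (intro prod.cong) auto
    finally show ?thesis .
  qed
  ultimately show ?thesis by (simp add: closed_weight_def)
qed

lemma relabel_full_arcs:
  assumes "inj_on f e"
  shows "relabel f (full_arcs e) = full_arcs (f ` e)"
proof -
  have "full_arcs (f ` e) = (\<Sum>i\<in>e. \<Sum>j\<in>f ` e - {f i}. arc (f i) j)"
    unfolding full_arcs_def edge_arcs_def using assms by (subst sum.reindex) auto
  also have "\<dots> = (\<Sum>i\<in>e. \<Sum>j\<in>e - {i}. arc (f i) (f j))"
  proof (rule sum.cong[OF refl])
    fix i assume "i \<in> e"
    then have "f ` e - {f i} = f ` (e - {i})" using assms by (auto simp: inj_on_def)
    then show "(\<Sum>j\<in>f ` e - {f i}. arc (f i) j) = (\<Sum>j\<in>e - {i}. arc (f i) (f j))"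
      using inj_on_subset[OF assms, of "e - {i}"] by (simp add: sum.reindex)
  qed
  finally show ?thesis
    by (simp add: full_arcs_def edge_arcs_def relabel_sum)
qed

definition single_weight :: "nat \<Rightarrow> real" where
  "single_weight k = closed_weight (full_arcs {..<k})"

definition double_weight :: "nat \<Rightarrow> real" where
  "double_weight k = closed_weight (full_arcs {..<k} + full_arcs {..<k})"

text \<open>The model of an adjacent pair: two hyperedges that share exactly the vertex 0.\<close>

definition pair_weight :: "nat \<Rightarrow> real" where
  "pair_weight k = closed_weight (full_arcs {..<k} + full_arcs (insert 0 {k..<k + (k - 1)}))"

lemma closed_weight_full_arcs:
  assumes "finite e" "card e = k"
  shows "closed_weight (full_arcs e) = single_weight k"
    "closed_weight (full_arcs e + full_arcs e) = double_weight k"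
proof -
  obtain f where f: "bij_betw f {..<k} e"
    using finite_same_card_bij[of "{..<k}" e] assms by auto
  then have inj: "inj_on f {..<k}" and im: "f ` {..<k} = e" by (auto simp: bij_betw_def)
  show "closed_weight (full_arcs e) = single_weight k"
    using closed_weight_relabel[OF inj keys_full_arcs] relabel_full_arcs[OF inj] im
    by (simp add: single_weight_def)
  have "Poly_Mapping.keys (full_arcs {..<k} + full_arcs {..<k}) \<subseteq> {..<k} \<times> {..<k}"
    using keys_add[of "full_arcs {..<k}" "full_arcs {..<k}"] keys_full_arcs[of "{..<k}"] by blast
  then show "closed_weight (full_arcs e + full_arcs e) = double_weight k"
    using closed_weight_relabel[OF inj, of "full_arcs {..<k} + full_arcs {..<k}"] relabel_full_arcs[OF inj] im
    by (simp add: double_weight_def relabel_add)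
qed

lemma closed_weight_full_arcs_pair:
  assumes "finite e" "card e = k" "finite f" "card f = k" "e \<inter> f = {v}" "k \<ge> 1"
  shows "closed_weight (full_arcs e + full_arcs f) = pair_weight k"
proof -
  have v: "v \<in> e" "v \<in> f" using assms(5) by auto
  have "card {1..<k} = card (e - {v})" using v assms by simp
  then obtain g where g: "inj_on g ({0} \<union> {1..<k})" "g 0 = v" "g ` {1..<k} = e - {v}"
    using inj_on_extend[of "\<lambda>_. v" "{0}" "e - {v}" "{1..<k}"] assms(1) by auto
  have k: "{0} \<union> {1..<k} = {..<k}" using assms(6) by auto
  have im: "g ` {..<k} = e"
    unfolding k[symmetric] image_Un g(3) using g(2) v(1) by auto
  have cardf: "card {k..<k + (k - 1)} = card (f - {v})" using v assms by simp
  have new: "(f - {v}) \<inter> g ` {..<k} = {}" using im assms(5) by auto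
  have disj: "{..<k} \<inter> {k..<k + (k - 1)} = {}" by auto
  obtain h where h: "inj_on h ({..<k} \<union> {k..<k + (k - 1)})"
      "\<And>a. a \<in> {..<k} \<Longrightarrow> h a = g a" "h ` {k..<k + (k - 1)} = f - {v}"
    using inj_on_extend[OF g(1)[unfolded k] finite_Diff[OF assms(3)] cardf finite_atLeastLessThan disj new]
    by metis
  let ?U = "{..<k} \<union> {k..<k + (k - 1)}"
  let ?f = "insert 0 {k..<k + (k - 1)}"
  have sub: "{..<k} \<subseteq> ?U" "?f \<subseteq> ?U" using assms(6) by auto
  have he: "h ` {..<k} = e" using h(2) im by (metis image_cong)
  have hf: "h ` ?f = f" using h(2)[of 0] h(3) g(2) v(2) assms(6) by auto
  have "Poly_Mapping.keys (full_arcs {..<k} + full_arcs ?f) \<subseteq> ?U \<times> ?U"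
    using keys_add[of "full_arcs {..<k}" "full_arcs ?f"] keys_full_arcs[of "{..<k}"] keys_full_arcs[of ?f] sub
    by blast
  note closed_weight_relabel[OF h(1) this]
  moreover have "relabel h (full_arcs {..<k} + full_arcs ?f) = full_arcs e + full_arcs f"
    unfolding relabel_add relabel_full_arcs[OF inj_on_subset[OF h(1) sub(1)]]
      relabel_full_arcs[OF inj_on_subset[OF h(1) sub(2)]] he hf ..
  ultimately show ?thesis
    by (simp only: pair_weight_def)
qed

section \<open>Positivity of the universal weights\<close>

lemma full_arcs_insert:
  assumes "finite S" "z \<notin> S"
  shows "full_arcs (insert z S) = full_arcs S + (\<Sum>s\<in>S. arc z s + arc s z)"
proof -
  have "full_arcs (insert z S) = edge_arcs z (insert z S) + (\<Sum>i\<in>S. edge_arcs i (insert z S))"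
    using assms by (simp add: full_arcs_def)
  also have "edge_arcs z (insert z S) = (\<Sum>s\<in>S. arc z s)"
    using assms by (simp add: edge_arcs_def)
  also have "(\<Sum>i\<in>S. edge_arcs i (insert z S)) = (\<Sum>i\<in>S. arc i z + edge_arcs i S)"
  proof (rule sum.cong[OF refl])
    fix i assume i: "i \<in> S"
    then have "insert z S - {i} = insert z (S - {i})" using assms by auto
    then show "edge_arcs i (insert z S) = arc i z + edge_arcs i S"
      using assms i by (simp add: edge_arcs_def)
  qed
  finally show ?thesis
    by (simp add: sum.distrib full_arcs_def add_ac)
qed

lemma closed_words_two_cycle: "closed_words (arc x y + arc y x) \<noteq> {}"
proof -
  have "[x, y] \<in> closed_words (arc x y + arc y x)"
    by (simp add: closed_words_def closed_arcs_def)
  then show ?thesis by blast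
qed

text \<open>A complete digraph is a union of two-cycles, which are spliced in one after the other.
  Only the existence of a closed word matters, not the number of such words.\<close>

lemma closed_words_full_arcs:
  assumes "finite e" "card e \<ge> 2"
  shows "closed_words (full_arcs e) \<noteq> {}"
  using assms
proof (induction e rule: finite_induct)
  case (insert z S)
  show ?case
  proof (cases "card S = 1")
    case True
    then obtain a where "S = {a}" by (auto simp: card_1_singleton_iff)
    then have "full_arcs (insert z S) = arc z a + arc a z"
      using full_arcs_insert[OF insert.hyps(1,2)] by (simp add: full_arcs_def edge_arcs_def)
    then show ?thesis using closed_words_two_cycle by simp
  next
    case False
    then have S2: "card S \<ge> 2" using insert by simp
    have "closed_words (full_arcs S + (\<Sum>s\<in>T. arc z s + arc s z)) \<noteq> {}" if "T \<subseteq> S" for T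
      using finite_subset[OF that insert.hyps(1)] that
    proof (induction T rule: finite_induct)
      case empty
      then show ?case using insert.IH[OF S2] by simp
    next
      case (insert s T)
      let ?\<mu> = "full_arcs S + (\<Sum>s\<in>T. arc z s + arc s z)"
      have "outdeg s ?\<mu> > 0"
        using insert.prems S2 \<open>finite S\<close> by (simp add: weight_add outdeg_full_arcs)
      moreover have "outdeg s (arc z s + arc s z) > 0" by (simp add: weight_add)
      moreover have "closed_words ?\<mu> \<noteq> {}" using insert by simp
      ultimately have "closed_words (?\<mu> + (arc z s + arc s z)) \<noteq> {}"
        using closed_words_add[OF _ closed_words_two_cycle] by blast
      then show ?case using insert.hyps by (simp add: add_ac)
    qed
    then show ?thesis using full_arcs_insert[OF insert.hyps(1,2)] by simp
  qed
qed simp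

lemma single_weight_pos: "k \<ge> 2 \<Longrightarrow> single_weight k > 0"
  using closed_words_full_arcs[of "{..<k}"] by (simp add: single_weight_def closed_weight_pos_iff)

lemma pair_weight_pos:
  assumes "k \<ge> 2"
  shows "pair_weight k > 0"
proof -
  let ?f = "insert 0 {k..<k + (k - 1)}"
  have card: "card ?f = k" using assms by simp
  have "closed_words (full_arcs {..<k}) \<noteq> {}" "closed_words (full_arcs ?f) \<noteq> {}"
    using closed_words_full_arcs[of "{..<k}"] closed_words_full_arcs[of ?f] assms card by simp_all
  moreover have "outdeg 0 (full_arcs {..<k}) > 0" "outdeg 0 (full_arcs ?f) > 0"
    using outdeg_full_arcs[of "{..<k}" 0] outdeg_full_arcs[of ?f 0] assms card by simp_all
  ultimately show ?thesis
    unfolding pair_weight_def closed_weight_pos_iff by (rule closed_words_add)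
qed

section \<open>Low traces of hypertrees\<close>

text \<open>The series of the loops that can be inserted when every vertex of \<open>e\<close> is
  visited once.\<close>

definition edge_fps :: "real \<Rightarrow> hgraph \<Rightarrow> nat set \<Rightarrow> real fps" where
  "edge_fps \<alpha> H e = (\<Prod>i\<in>e. geo_fps (\<alpha> * real (degree H i)))"

definition single_const :: "real \<Rightarrow> nat \<Rightarrow> real" where
  "single_const \<alpha> k = ((1 - \<alpha>) / fact (k - 1)) ^ k * single_weight k"

definition double_const :: "real \<Rightarrow> nat \<Rightarrow> real" where
  "double_const \<alpha> k = ((1 - \<alpha>)\<^sup>2 / fact (2 * (k - 1))) ^ k * double_weight k"

text \<open>The \<open>2 * (k - 1)\<close> vertices that belong to one of the hyperedges have one
  list entry each; the common vertex has two, whence the larger factorial in its factor.\<close>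

definition pair_const :: "real \<Rightarrow> nat \<Rightarrow> real" where
  "pair_const \<alpha> k = ((1 - \<alpha>) / fact (k - 1)) ^ (2 * (k - 1)) * ((1 - \<alpha>)\<^sup>2 / fact (2 * (k - 1))) * pair_weight k"

lemma prod_if_subset:
  fixes x :: "'a::comm_monoid_mult"
  assumes "A \<subseteq> {..<n::nat}"
  shows "(\<Prod>i<n. if i \<in> A then f i else 1) = prod f A"
  using assms by (simp add: prod.If_cases Int_absorb1)

lemma length_edge_list: "i < n \<Longrightarrow> length (edge_list n e i) = (if i \<in> e then 1 else 0)"
  by (simp add: edge_list_def)

lemma length_edge_pair_list:
  "i < n \<Longrightarrow> length (edge_pair_list n e f i) = (if i \<in> e then 1 else 0) + (if i \<in> f then 1 else 0)"
  by (simp add: edge_pair_list_def)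

lemma edge_list_term:
  assumes "uniform k H" "e \<in> edges H"
  defines "n \<equiv> nverts H"
  defines "L \<equiv> edge_list n e"
  shows "list_coeff k \<alpha> n L * closed_weight (list_arcs n L) = single_const \<alpha> k"
    and "visit_fps \<alpha> H (length \<circ> L) = edge_fps \<alpha> H e"
    and "(\<Sum>i<n. length (L i)) = k"
    and "L \<in> PiE {..<n} (\<lambda>i. {L. set L \<subseteq> edges_at H i})"
proof -
  note e = uniform_edgeD[OF assms(1,2), folded n_def]
  have "list_coeff k \<alpha> n L = (\<Prod>i<n. if i \<in> e then (1 - \<alpha>) / fact (k - 1) else 1)"
    unfolding list_coeff_def L_def by (intro prod.cong) (auto simp: length_edge_list)
  then show "list_coeff k \<alpha> n L * closed_weight (list_arcs n L) = single_const \<alpha> k"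
    using e by (simp add: prod_if_subset L_def list_arcs_edge_list closed_weight_full_arcs single_const_def)
  have "visit_fps \<alpha> H (length \<circ> L) = (\<Prod>i<n. if i \<in> e then geo_fps (\<alpha> * real (degree H i)) else 1)"
    unfolding visit_fps_def L_def n_def[symmetric] by (intro prod.cong) (auto simp: length_edge_list)
  then show "visit_fps \<alpha> H (length \<circ> L) = edge_fps \<alpha> H e"
    using e by (simp add: prod_if_subset edge_fps_def)
  have "(\<Sum>i<n. length (L i)) = (\<Sum>i<n. if i \<in> e then 1 else 0)"
    unfolding L_def by (intro sum.cong) (auto simp: length_edge_list)
  then show "(\<Sum>i<n. length (L i)) = k"
    using e by (simp add: sum.If_cases Int_absorb1)
  show "L \<in> PiE {..<n} (\<lambda>i. {L. set L \<subseteq> edges_at H i})"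
    using assms(2) by (auto simp: L_def edge_list_def edges_at_def PiE_iff)
qed

lemma edge_pair_list_term:
  assumes "uniform k H" "acyclic_edges (edges H)" "e \<in> edges H" "f \<in> edges H" "e \<inter> f \<noteq> {}" "k \<ge> 2"
  defines "n \<equiv> nverts H"
  defines "L \<equiv> edge_pair_list n e f"
  shows "list_coeff k \<alpha> n L * closed_weight (list_arcs n L) = (if e = f then double_const \<alpha> k else pair_const \<alpha> k)"
    and "visit_fps \<alpha> H (length \<circ> L) = edge_fps \<alpha> H e * edge_fps \<alpha> H f"
    and "(\<Sum>i<n. length (L i)) = 2 * k"
    and "L \<in> PiE {..<n} (\<lambda>i. {L. set L \<subseteq> edges_at H i})"
proof -
  note e = uniform_edgeD[OF assms(1,3), folded n_def]
  note f = uniform_edgeD[OF assms(1,4), folded n_def]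
  show "list_coeff k \<alpha> n L * closed_weight (list_arcs n L) = (if e = f then double_const \<alpha> k else pair_const \<alpha> k)"
  proof (cases "e = f")
    case True
    have "list_coeff k \<alpha> n L = (\<Prod>i<n. if i \<in> e then (1 - \<alpha>)\<^sup>2 / fact (2 * (k - 1)) else 1)"
      unfolding list_coeff_def L_def True by (intro prod.cong) (auto simp: length_edge_pair_list numeral_2_eq_2)
    then show ?thesis
      using e True by (simp add: prod_if_subset L_def list_arcs_edge_pair_list closed_weight_full_arcs double_const_def)
  next
    case False
    obtain v where v: "v \<in> e" "v \<in> f" using assms(5) by blast
    have ef: "e \<inter> f = {v}"
      using acyclic_edges_card_Int[OF assms(2-4) False, of _ v] v by blast
    let ?a = "(1 - \<alpha>) / fact (k - 1) :: real" and ?b = "(1 - \<alpha>)\<^sup>2 / fact (2 * (k - 1)) :: real"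
    have "list_coeff k \<alpha> n L = (\<Prod>i<n. (if i \<in> e - {v} then ?a else 1) * (if i \<in> f - {v} then ?a else 1) * (if i \<in> {v} then ?b else 1))"
      unfolding list_coeff_def L_def
    proof (rule prod.cong[OF refl])
      fix i assume i: "i \<in> {..<n}"
      have iv: "i \<in> e \<and> i \<in> f \<longleftrightarrow> i = v" using ef by blast
      show "(1 - \<alpha>) ^ length (edge_pair_list n e f i) / fact (length (edge_pair_list n e f i) * (k - 1))
          = (if i \<in> e - {v} then ?a else 1) * (if i \<in> f - {v} then ?a else 1) * (if i \<in> {v} then ?b else 1)"
      proof (cases "i = v")
        case True
        then show ?thesis using i v by (simp add: length_edge_pair_list numeral_2_eq_2)
      next
        case False
        then have "\<not> (i \<in> e \<and> i \<in> f)" using iv by simp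
        then show ?thesis
          using i False by (cases "i \<in> e"; cases "i \<in> f") (simp_all add: length_edge_pair_list)
      qed
    qed
    also have "\<dots> = (\<Prod>i<n. if i \<in> e - {v} then ?a else 1) * (\<Prod>i<n. if i \<in> f - {v} then ?a else 1) * (\<Prod>i<n. if i \<in> {v} then ?b else 1)"
      by (simp only: prod.distrib)
    also have "\<dots> = ?a ^ card (e - {v}) * ?a ^ card (f - {v}) * ?b"
    proof -
      have "e - {v} \<subseteq> {..<n}" "f - {v} \<subseteq> {..<n}" "{v} \<subseteq> {..<n}" using e(2) f(2) v by auto
      then show ?thesis by (simp only: prod_if_subset prod_constant card.empty) simp
    qed
    also have "?a ^ card (e - {v}) * ?a ^ card (f - {v}) = ?a ^ (2 * (k - 1))"
      using e f v by (simp add: mult_2 power_add)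
    finally have "list_coeff k \<alpha> n L = ?a ^ (2 * (k - 1)) * ?b" .
    then show ?thesis
      using closed_weight_full_arcs_pair[OF e(3,1) f(3,1) ef] e f assms(6) False
      by (simp add: L_def list_arcs_edge_pair_list pair_const_def)
  qed
  have "visit_fps \<alpha> H (length \<circ> L) = (\<Prod>i<n. (if i \<in> e then geo_fps (\<alpha> * real (degree H i)) else 1) *
      (if i \<in> f then geo_fps (\<alpha> * real (degree H i)) else 1))"
    unfolding visit_fps_def L_def n_def[symmetric] by (intro prod.cong) (auto simp: length_edge_pair_list)
  then show "visit_fps \<alpha> H (length \<circ> L) = edge_fps \<alpha> H e * edge_fps \<alpha> H f"
    using e f by (simp add: prod_if_subset edge_fps_def prod.distrib)
  have "(\<Sum>i<n. length (L i)) = (\<Sum>i<n. (if i \<in> e then 1 else 0) + (if i \<in> f then 1 else 0))"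
    unfolding L_def by (intro sum.cong) (auto simp: length_edge_pair_list)
  then show "(\<Sum>i<n. length (L i)) = 2 * k"
    using e f by (simp add: sum.If_cases Int_absorb1 sum.distrib)
  show "L \<in> PiE {..<n} (\<lambda>i. {L. set L \<subseteq> edges_at H i})"
    using assms(3,4) by (auto simp: L_def edge_pair_list_def edges_at_def PiE_iff)
qed

lemma edge_list_inj:
  assumes "edge_list n e = edge_list n f" "e \<subseteq> {..<n}" "e \<noteq> {}"
  shows "e = f"
proof -
  obtain i where "i \<in> e" "i < n" using assms by blast
  then show ?thesis using fun_cong[OF assms(1), of i] by (auto simp: edge_list_def split: if_splits)
qed

lemma edge_pair_list_inj:
  assumes "edge_pair_list n e f = edge_pair_list n e' f'" "e \<subseteq> {..<n}" "e \<inter> f \<noteq> {}"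
  shows "e = e' \<and> f = f'"
proof -
  obtain i where "i \<in> e" "i \<in> f" "i < n" using assms by blast
  then show ?thesis using fun_cong[OF assms(1), of i] by (auto simp: edge_pair_list_def split: if_splits)
qed

text \<open>Below order \<open>3 * k\<close> the surviving lists are indexed by hyperedges and by
  ordered pairs of intersecting hyperedges, the equal pairs being doubled hyperedges. Whatever is
  left of the order is filled with loops.\<close>

theorem Tr_hypertree:
  assumes uni: "uniform k H" and gr: "grown k (edges H)" and k: "k \<ge> 2" and d: "1 \<le> d" "d < 3 * k"
  defines "n \<equiv> nverts H"
  shows "Tr n k (A_tensor \<alpha> k H) d = real ((k - 1) ^ (n - 1)) *
    ((\<Sum>v<n. (\<alpha> * real (degree H v)) ^ d) + real (d * (k - 1)) *
     ((if k \<le> d then single_const \<alpha> k * (\<Sum>e\<in>edges H. fps_nth (edge_fps \<alpha> H e) (d - k)) else 0) +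
      (if 2 * k \<le> d then
         double_const \<alpha> k * (\<Sum>e\<in>edges H. fps_nth (edge_fps \<alpha> H e * edge_fps \<alpha> H e) (d - 2 * k)) +
         pair_const \<alpha> k * (\<Sum>e\<in>edges H. \<Sum>f\<in>nbrs (edges H) e. fps_nth (edge_fps \<alpha> H e * edge_fps \<alpha> H f) (d - 2 * k))
       else 0)))"
proof -
  let ?E = "edges H"
  let ?t = "\<lambda>L. list_coeff k \<alpha> n L * closed_weight (list_arcs n L) *
        fps_nth (visit_fps \<alpha> H (length \<circ> L)) (d - (\<Sum>i<n. length (L i)))"
  have finE: "finite ?E" using uniform_finite_edges[OF uni] .
  have acyc: "acyclic_edges ?E" using grown_acyclic[OF gr k] .
  have edge: "e \<subseteq> {..<n}" "e \<noteq> {}" if "e \<in> ?E" for e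
    using uniform_edgeD[OF uni that] k by (auto simp: n_def)
  \<comment> \<open>The conditions on \<open>d\<close> in \<open>S\<close> and \<open>D\<close>
    record which lists fit into the total order.\<close>
  define S where "S = (if k \<le> d then edge_list n ` ?E else {})"
  define T where "T = {(e, f). e \<in> ?E \<and> f \<in> ?E \<and> e \<inter> f \<noteq> {}}"
  define D where "D = (if 2 * k \<le> d then (\<lambda>(e, f). edge_pair_list n e f) ` T else {})"
  have finT: "finite T" by (rule finite_subset[of _ "?E \<times> ?E"]) (use finE in \<open>auto simp: T_def\<close>)
  have fin: "finite S" "finite D" using finE finT by (auto simp: S_def D_def)
  have Ssum: "(\<Sum>i<n. length (L i)) = k" if "L \<in> S" for L
    using that edge_list_term(3)[OF uni] by (auto simp: S_def n_def split: if_splits)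
  have Dsum: "(\<Sum>i<n. length (L i)) = 2 * k" if "L \<in> D" for L
    using that edge_pair_list_term(3)[OF uni acyc _ _ _ k] by (auto simp: D_def T_def n_def split: if_splits)
  have disj: "S \<inter> D = {}"
  proof (rule equals0I)
    fix L assume "L \<in> S \<inter> D"
    then have "k = 2 * k" using Ssum[of L] Dsum[of L] by simp
    then show False using k by simp
  qed
  have sub: "S \<union> D \<subseteq> edge_lists H {1..d}"
  proof
    fix L assume L: "L \<in> S \<union> D"
    have "L \<in> PiE {..<n} (\<lambda>i. {L. set L \<subseteq> edges_at H i})"
    proof -
      consider e where "e \<in> ?E" "L = edge_list n e" | e f where "(e, f) \<in> T" "L = edge_pair_list n e f"
        using L by (auto simp: S_def D_def split: if_splits)
      then show ?thesis
      proof cases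
        case 1
        then show ?thesis using edge_list_term(4)[OF uni 1(1)] by (simp only: n_def)
      next
        case 2
        then have "e \<in> ?E" "f \<in> ?E" "e \<inter> f \<noteq> {}" by (auto simp: T_def)
        from edge_pair_list_term(4)[OF uni acyc this k] show ?thesis by (simp only: n_def 2(2))
      qed
    qed
    moreover have "(\<Sum>i<n. length (L i)) \<in> {1..d}"
    proof (cases "L \<in> S")
      case True
      then show ?thesis using Ssum[OF True] k by (auto simp: S_def split: if_splits)
    next
      case False
      then have "L \<in> D" using L by blast
      then show ?thesis using Dsum[of L] k by (auto simp: D_def split: if_splits)
    qed
    ultimately show "L \<in> edge_lists H {1..d}" by (simp add: edge_lists_def n_def)
  qed
  have zero: "?t L = 0" if L: "L \<in> edge_lists H {1..d} - (S \<union> D)" for L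
  proof (rule ccontr)
    assume "?t L \<noteq> 0"
    then have "closed_weight (list_arcs (nverts H) L) \<noteq> 0" by (auto simp: n_def)
    then consider e where "e \<in> ?E" "L = edge_list n e" | e f where "(e, f) \<in> T" "L = edge_pair_list n e f"
      using edge_list_of_closed[OF uni gr k _ d(2), of L] L unfolding n_def T_def by blast
    then show False
    proof cases
      case 1
      then have "k \<le> d" using L edge_list_term(3)[OF uni 1(1)] by (auto simp: edge_lists_def n_def)
      then show False using L 1 by (auto simp: S_def)
    next
      case 2
      then have "2 * k \<le> d" using L edge_pair_list_term(3)[OF uni acyc _ _ _ k, of e f]
        by (auto simp: edge_lists_def n_def T_def)
      then show False using L 2 by (auto simp: D_def)
    qed
  qed
  have "(\<Sum>L\<in>edge_lists H {1..d}. ?t L) = (\<Sum>L\<in>S \<union> D. ?t L)"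
    using sub zero finite_edge_lists[OF uni] by (intro sum.mono_neutral_right) auto
  also have "\<dots> = (\<Sum>L\<in>S. ?t L) + (\<Sum>L\<in>D. ?t L)"
    using fin disj by (rule sum.union_disjoint)
  also have "(\<Sum>L\<in>S. ?t L) = (if k \<le> d then single_const \<alpha> k * (\<Sum>e\<in>?E. fps_nth (edge_fps \<alpha> H e) (d - k)) else 0)"
  proof (cases "k \<le> d")
    case True
    have "inj_on (edge_list n) ?E" using edge_list_inj edge by (auto simp: inj_on_def)
    then have "(\<Sum>L\<in>S. ?t L) = (\<Sum>e\<in>?E. ?t (edge_list n e))"
      using True by (simp add: S_def sum.reindex)
    also have "\<dots> = (\<Sum>e\<in>?E. single_const \<alpha> k * fps_nth (edge_fps \<alpha> H e) (d - k))"
      using edge_list_term[OF uni] by (intro sum.cong) (auto simp: n_def)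
    finally show ?thesis using True by (simp add: sum_distrib_left)
  qed (simp add: S_def)
  also have "(\<Sum>L\<in>D. ?t L) = (if 2 * k \<le> d then
         double_const \<alpha> k * (\<Sum>e\<in>?E. fps_nth (edge_fps \<alpha> H e * edge_fps \<alpha> H e) (d - 2 * k)) +
         pair_const \<alpha> k * (\<Sum>e\<in>?E. \<Sum>f\<in>nbrs ?E e. fps_nth (edge_fps \<alpha> H e * edge_fps \<alpha> H f) (d - 2 * k))
       else 0)"
  proof (cases "2 * k \<le> d")
    case True
    let ?F = "\<lambda>e f. fps_nth (edge_fps \<alpha> H e * edge_fps \<alpha> H f) (d - 2 * k)"
    have "inj_on (\<lambda>(e, f). edge_pair_list n e f) T"
      using edge_pair_list_inj edge(1) by (force simp: inj_on_def T_def)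
    then have "(\<Sum>L\<in>D. ?t L) = (\<Sum>(e, f)\<in>T. ?t (edge_pair_list n e f))"
      using True by (simp add: D_def sum.reindex case_prod_unfold)
    also have "\<dots> = (\<Sum>(e, f)\<in>T. (if e = f then double_const \<alpha> k else pair_const \<alpha> k) * ?F e f)"
    proof (rule sum.cong[OF refl])
      fix x assume "x \<in> T"
      then obtain e f where x: "x = (e, f)" and ef: "e \<in> ?E" "f \<in> ?E" "e \<inter> f \<noteq> {}"
        by (auto simp: T_def)
      show "(case x of (e, f) \<Rightarrow> ?t (edge_pair_list n e f))
          = (case x of (e, f) \<Rightarrow> (if e = f then double_const \<alpha> k else pair_const \<alpha> k) * ?F e f)"
        unfolding x prod.case n_def edge_pair_list_term[OF uni acyc ef k] ..
    qed
    \<comment> \<open>Nonempty hyperedges meet themselves, so the diagonal supplies the doubled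
      hyperedges.\<close>
    also have "T = (SIGMA e:?E. insert e (nbrs ?E e))"
      using edge(2) by (auto simp: T_def nbrs_def)
    also have "(\<Sum>(e, f)\<in>(SIGMA e:?E. insert e (nbrs ?E e)). (if e = f then double_const \<alpha> k else pair_const \<alpha> k) * ?F e f)
        = (\<Sum>e\<in>?E. \<Sum>f\<in>insert e (nbrs ?E e). (if e = f then double_const \<alpha> k else pair_const \<alpha> k) * ?F e f)"
      using finE by (subst sum.Sigma) (auto simp: finite_nbrs)
    also have "\<dots> = (\<Sum>e\<in>?E. double_const \<alpha> k * ?F e e + (\<Sum>f\<in>nbrs ?E e. pair_const \<alpha> k * ?F e f))"
    proof (rule sum.cong[OF refl])
      fix e assume "e \<in> ?E"
      have "e \<notin> nbrs ?E e" by (simp add: nbrs_def)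
      then have "(\<Sum>f\<in>nbrs ?E e. (if e = f then double_const \<alpha> k else pair_const \<alpha> k) * ?F e f)
          = (\<Sum>f\<in>nbrs ?E e. pair_const \<alpha> k * ?F e f)"
        by (intro sum.cong) auto
      then show "(\<Sum>f\<in>insert e (nbrs ?E e). (if e = f then double_const \<alpha> k else pair_const \<alpha> k) * ?F e f)
          = double_const \<alpha> k * ?F e e + (\<Sum>f\<in>nbrs ?E e. pair_const \<alpha> k * ?F e f)"
        using \<open>e \<notin> nbrs ?E e\<close> finite_nbrs[OF finE] by simp
    qed
    finally show ?thesis unfolding if_P[OF True] sum.distrib sum_distrib_left .
  qed (simp add: D_def)
  finally show ?thesis
    unfolding n_def Tr_eq_sum_edge_lists[OF uni k d(1)] by (simp only:)
qed

section \<open>Traces of hypertrees of maximum degree two\<close>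

lemma uniform_hypertreesD:
  assumes "H \<in> uniform_hypertrees k m" "k \<ge> 2" "m \<ge> 1"
  shows "uniform k H" "card (edges H) = m" "finite (edges H)" "edge_tree k (edges H)"
    "\<Union>(edges H) = {..<nverts H}" "grown k (edges H)" "nverts H = m * (k - 1) + 1"
proof -
  show uni: "uniform k H" and card: "card (edges H) = m"
    using assms(1) by (auto simp: uniform_hypertrees_def)
  have ne: "edges H \<noteq> {}" using card assms(3) by auto
  have "hypertree H" using assms(1) by (simp add: uniform_hypertrees_def)
  then show tree: "edge_tree k (edges H)" and span: "\<Union>(edges H) = {..<nverts H}"
    using hypertree_edge_tree[OF _ uni ne assms(2)] by auto
  show "grown k (edges H)" using edge_tree_grown[OF tree assms(2)] .
  then show "nverts H = m * (k - 1) + 1"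
    using grown_card_Union[of k "edges H"] assms(2) card span by simp
  show "finite (edges H)" using uniform_finite_edges[OF uni] .
qed

lemma degree_pos:
  assumes "H \<in> uniform_hypertrees k m" "k \<ge> 2" "m \<ge> 1" "v < nverts H"
  shows "degree H v \<ge> 1"
proof -
  note H = uniform_hypertreesD[OF assms(1-3)]
  have "v \<in> \<Union>(edges H)" using H(5) assms(4) by simp
  then have "{e \<in> edges H. v \<in> e} \<noteq> {}" by blast
  then show ?thesis using H(3) by (simp add: degree_def Suc_le_eq card_gt_0_iff)
qed

lemma sum_degree:
  assumes "H \<in> uniform_hypertrees k m" "k \<ge> 2" "m \<ge> 1"
  shows "(\<Sum>v<nverts H. degree H v) = k * m"
proof -
  note H = uniform_hypertreesD[OF assms]
  have "(\<Sum>v<nverts H. degree H v) = (\<Sum>e\<in>edges H. \<Sum>v\<in>e. 1)"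
    using sum_vdeg[OF H(3) uniform_edgeD(2)[OF H(1)], where w = "\<lambda>_. 1"] by (simp add: degree_eq_vdeg)
  also have "\<dots> = (\<Sum>e\<in>edges H. k)"
    using uniform_edgeD(1)[OF H(1)] by (intro sum.cong) auto
  finally show ?thesis using H(2) by (simp add: mult.commute)
qed

definition max_degree_two :: "hgraph \<Rightarrow> bool" where
  "max_degree_two H \<longleftrightarrow> (\<forall>v<nverts H. degree H v \<le> 2)"

abbreviation nbr_count :: "hgraph \<Rightarrow> nat set \<Rightarrow> nat" where
  "nbr_count H e \<equiv> card (nbrs (edges H) e)"

text \<open>On the degrees 1 and 2 every function is affine, and the sum of the degrees is
  \<open>k * m\<close>; so the diagonal terms cannot separate hypertrees of maximum degree
  two.\<close>

lemma sum_over_degrees: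
  fixes g :: "nat \<Rightarrow> real"
  assumes "H \<in> uniform_hypertrees k m" "k \<ge> 2" "m \<ge> 1" "max_degree_two H"
  shows "(\<Sum>v<nverts H. g (degree H v)) = real (nverts H) * g 1 + (real (k * m) - real (nverts H)) * (g 2 - g 1)"
proof -
  have "(\<Sum>v<nverts H. g (degree H v)) = (\<Sum>v<nverts H. g 1 + (real (degree H v) - 1) * (g 2 - g 1))"
  proof (rule sum.cong[OF refl])
    fix v assume "v \<in> {..<nverts H}"
    then have "degree H v = 1 \<or> degree H v = 2"
      using degree_pos[OF assms(1-3), of v] assms(4) by (force simp: max_degree_two_def)
    then show "g (degree H v) = g 1 + (real (degree H v) - 1) * (g 2 - g 1)" by auto
  qed
  also have "\<dots> = real (nverts H) * g 1 + (real (\<Sum>v<nverts H. degree H v) - real (nverts H)) * (g 2 - g 1)"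
    by (simp add: sum.distrib sum_subtractf flip: sum_distrib_right)
  finally show ?thesis using sum_degree[OF assms(1-3)] by simp
qed

lemma nbr_count_eq:
  assumes "H \<in> uniform_hypertrees k m" "k \<ge> 2" "m \<ge> 1" "max_degree_two H" "e \<in> edges H"
  shows "nbr_count H e = card {v \<in> e. degree H v = 2}"
proof -
  note H = uniform_hypertreesD[OF assms(1-3)]
  have "vdeg (edges H) v \<le> 2" if "v \<in> e" for v
    using assms(4) that uniform_edgeD(2)[OF H(1) assms(5)] by (auto simp: max_degree_two_def degree_eq_vdeg)
  then show ?thesis
    using card_nbrs_eq[OF H(3) grown_acyclic[OF H(6) assms(2)] assms(5)] uniform_edgeD(3)[OF H(1) assms(5)]
    by (simp add: degree_eq_vdeg)
qed

text \<open>The excess of the degree sum over the number of vertices,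
  \<open>k m - n = m - 1\<close>, counts the vertices of degree two, and each of them is seen from
  two hyperedges.\<close>

lemma sum_nbr_count:
  assumes "H \<in> uniform_hypertrees k m" "k \<ge> 2" "m \<ge> 1" "max_degree_two H"
  shows "(\<Sum>e\<in>edges H. nbr_count H e) = 2 * (m - 1)"
proof -
  note H = uniform_hypertreesD[OF assms(1-3)]
  let ?w = "\<lambda>v. if degree H v = 2 then 1 else 0 :: nat"
  have "(\<Sum>e\<in>edges H. nbr_count H e) = (\<Sum>e\<in>edges H. \<Sum>v\<in>e. ?w v)"
    using nbr_count_eq[OF assms] uniform_edgeD(3)[OF H(1)]
    by (intro sum.cong) (auto simp: sum.If_cases Int_def)
  also have "\<dots> = (\<Sum>v<nverts H. degree H v * ?w v)"
    using sum_vdeg[OF H(3) uniform_edgeD(2)[OF H(1)], where w = ?w] by (simp add: degree_eq_vdeg)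
  finally have "real (\<Sum>e\<in>edges H. nbr_count H e) = (\<Sum>v<nverts H. real (degree H v * ?w v))"
    by simp
  also have "\<dots> = real (nverts H) * 0 + (real (k * m) - real (nverts H)) * (2 - 0)"
    using sum_over_degrees[OF assms, of "\<lambda>x. real (x * (if x = 2 then 1 else 0))"] by simp
  also have "\<dots> = real (2 * (m - 1))"
  proof -
    have "k * m = m * (k - 1) + m" using assms(2) by (cases k) auto
    then have "real (k * m) = real (m * (k - 1)) + real m" by (metis of_nat_add)
    then have "real (k * m) - real (nverts H) = real (m - 1)"
      unfolding H(7) of_nat_add of_nat_diff[OF assms(3)] by linarith
    then show ?thesis by simp
  qed
  finally show ?thesis by (simp only: of_nat_eq_iff)
qed

lemma nbr_count_pos:
  assumes "H \<in> uniform_hypertrees k m" "k \<ge> 2" "m \<ge> 2" "e \<in> edges H"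
  shows "nbr_count H e \<ge> 1"
proof -
  have m1: "m \<ge> 1" using assms(3) by simp
  note H = uniform_hypertreesD[OF assms(1,2) m1]
  have "edges H \<noteq> {e}"
  proof
    assume "edges H = {e}"
    then have "card (edges H) = 1" by simp
    then show False using H(2) assms(3) by simp
  qed
  then have "{e} \<subset> edges H" using assms(4) by blast
  moreover have "edge_connected (edges H)" using H(4) by (simp add: edge_tree_def)
  ultimately obtain h where "h \<in> edges H - {e}" "h \<inter> \<Union>{e} \<noteq> {}"
    unfolding edge_connected_def by (metis empty_not_insert)
  then have "nbrs (edges H) e \<noteq> {}" by (auto simp: nbrs_def)
  then show ?thesis using finite_nbrs[OF H(3)] by (simp add: Suc_le_eq card_gt_0_iff)
qed

text \<open>The factor by which a vertex of degree two changes the series of an edge.\<close>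

definition branch_fps :: "real \<Rightarrow> real fps" where
  "branch_fps \<alpha> = geo_fps (2 * \<alpha>) * (1 - fps_const \<alpha> * fps_X)"

lemma geo_fps_times: "geo_fps c * (1 - fps_const c * fps_X) = 1"
proof (rule fps_ext)
  fix n
  have "geo_fps c * (1 - fps_const c * fps_X) = geo_fps c - fps_const c * (geo_fps c * fps_X)"
    by (simp add: algebra_simps)
  then show "fps_nth (geo_fps c * (1 - fps_const c * fps_X)) n = fps_nth 1 n"
    by (cases n) (simp_all add: geo_fps_def)
qed

lemma geo_fps_branch: "geo_fps \<alpha> * branch_fps \<alpha> = geo_fps (2 * \<alpha>)"
  using geo_fps_times[of \<alpha>] by (simp add: branch_fps_def mult.left_commute)

lemma branch_fps_nth:
  "fps_nth (branch_fps \<alpha>) 0 = 1" "fps_nth (branch_fps \<alpha>) 1 = \<alpha>" "fps_nth (branch_fps \<alpha>) 2 = 2 * \<alpha>\<^sup>2"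
proof -
  have *: "branch_fps \<alpha> = geo_fps (2 * \<alpha>) - fps_const \<alpha> * (geo_fps (2 * \<alpha>) * fps_X)"
    by (simp add: branch_fps_def algebra_simps)
  show "fps_nth (branch_fps \<alpha>) 0 = 1" "fps_nth (branch_fps \<alpha>) 1 = \<alpha>" "fps_nth (branch_fps \<alpha>) 2 = 2 * \<alpha>\<^sup>2"
    unfolding * by (simp_all add: geo_fps_def power2_eq_square numeral_2_eq_2)
qed

lemma fps_mult_nth_2:
  fixes f g :: "real fps"
  shows "fps_nth (f * g) 2 = fps_nth f 0 * fps_nth g 2 + fps_nth f 1 * fps_nth g 1 + fps_nth f 2 * fps_nth g 0"
  by (simp add: fps_mult_nth numeral_2_eq_2)

text \<open>The second coefficient collects \<open>2 \<alpha>^2\<close> from each of the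
  \<open>q\<close> factors and \<open>\<alpha>^2\<close> from each of the
  \<open>q (q - 1) / 2\<close> pairs of factors; the resulting term in \<open>q^2\<close> is what
  separates hypertrees.\<close>

lemma branch_fps_power_nth:
  "fps_nth (branch_fps \<alpha> ^ q) 0 = 1" "fps_nth (branch_fps \<alpha> ^ q) 1 = real q * \<alpha>"
  "fps_nth (branch_fps \<alpha> ^ q) 2 = \<alpha>\<^sup>2 * ((real q)\<^sup>2 + 3 * real q) / 2"
proof -
  show 0: "fps_nth (branch_fps \<alpha> ^ q) 0 = 1" for q
    by (induction q) (simp_all add: branch_fps_nth)
  show 1: "fps_nth (branch_fps \<alpha> ^ q) 1 = real q * \<alpha>" for q
    by (induction q) (simp_all add: fps_mult_nth 0 branch_fps_nth[simplified] algebra_simps)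
  show "fps_nth (branch_fps \<alpha> ^ q) 2 = \<alpha>\<^sup>2 * ((real q)\<^sup>2 + 3 * real q) / 2"
  proof (induction q)
    case (Suc q)
    then show ?case
      by (simp only: power_Suc fps_mult_nth_2 0 1 branch_fps_nth)
         (simp add: power2_eq_square field_simps)
  qed simp
qed

lemma edge_fps_eq:
  assumes "H \<in> uniform_hypertrees k m" "k \<ge> 2" "m \<ge> 1" "max_degree_two H" "e \<in> edges H"
  shows "edge_fps \<alpha> H e = geo_fps \<alpha> ^ k * branch_fps \<alpha> ^ nbr_count H e"
proof -
  note H = uniform_hypertreesD[OF assms(1-3)]
  note e = uniform_edgeD[OF H(1) assms(5)]
  have "edge_fps \<alpha> H e = (\<Prod>i\<in>e. geo_fps \<alpha> * (if degree H i = 2 then branch_fps \<alpha> else 1))"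
    unfolding edge_fps_def
  proof (rule prod.cong[OF refl])
    fix i assume "i \<in> e"
    then have "i < nverts H" using e(2) by auto
    then have "degree H i = 1 \<or> degree H i = 2"
      using degree_pos[OF assms(1-3), of i] assms(4) by (force simp: max_degree_two_def)
    then show "geo_fps (\<alpha> * real (degree H i)) = geo_fps \<alpha> * (if degree H i = 2 then branch_fps \<alpha> else 1)"
      using geo_fps_branch[of \<alpha>] by (auto simp: mult.commute)
  qed
  also have "\<dots> = geo_fps \<alpha> ^ k * branch_fps \<alpha> ^ card {i \<in> e. degree H i = 2}"
    using e by (simp add: prod.distrib prod.If_cases Int_def)
  finally show ?thesis using nbr_count_eq[OF assms] by simp
qed

text \<open>\<open>p\<close> counts all visits, \<open>k\<close> for one hyperedge and
  \<open>2 * k\<close> for two, and \<open>q\<close> counts the visits to vertices of degree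
  two.\<close>

definition series_nth :: "real \<Rightarrow> nat \<Rightarrow> nat \<Rightarrow> nat \<Rightarrow> real" where
  "series_nth \<alpha> p j q = fps_nth (geo_fps \<alpha> ^ p * branch_fps \<alpha> ^ q) j"

lemma series_nth_low:
  "series_nth \<alpha> p 0 q = 1"
  "series_nth \<alpha> p (Suc 0) q = series_nth \<alpha> p (Suc 0) 0 + \<alpha> * real q"
  "series_nth \<alpha> p 2 q = series_nth \<alpha> p 2 0 + series_nth \<alpha> p (Suc 0) 0 * \<alpha> * real q + \<alpha>\<^sup>2 * ((real q)\<^sup>2 + 3 * real q) / 2"
proof -
  have g0: "fps_nth (geo_fps \<alpha> ^ p) 0 = 1" by (simp add: geo_fps_def fps_power_zeroth)
  show "series_nth \<alpha> p 0 q = 1" using g0 branch_fps_power_nth(1)[of \<alpha> q] by (simp add: series_nth_def)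
  show "series_nth \<alpha> p (Suc 0) q = series_nth \<alpha> p (Suc 0) 0 + \<alpha> * real q"
    using g0 branch_fps_power_nth(1,2)[of \<alpha> q] by (simp add: series_nth_def fps_mult_nth)
  show "series_nth \<alpha> p 2 q = series_nth \<alpha> p 2 0 + series_nth \<alpha> p (Suc 0) 0 * \<alpha> * real q + \<alpha>\<^sup>2 * ((real q)\<^sup>2 + 3 * real q) / 2"
    using g0 branch_fps_power_nth[of \<alpha> q] by (simp add: series_nth_def fps_mult_nth_2)
qed

text \<open>Up to this order the trace depends on \<open>H\<close> only through the neighbour counts
  of its hyperedges and of its adjacent pairs.\<close>

lemma Tr_max_degree_two:
  assumes "H \<in> uniform_hypertrees k m" "k \<ge> 2" "m \<ge> 1" "max_degree_two H" "1 \<le> d" "d < 3 * k"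
  defines "n \<equiv> m * (k - 1) + 1"
  shows "Tr n k (A_tensor \<alpha> k H) d = real ((k - 1) ^ (n - 1)) *
    (real n * \<alpha> ^ d + (real (k * m) - real n) * ((2 * \<alpha>) ^ d - \<alpha> ^ d) + real (d * (k - 1)) *
     ((if k \<le> d then single_const \<alpha> k * (\<Sum>e\<in>edges H. series_nth \<alpha> k (d - k) (nbr_count H e)) else 0) +
      (if 2 * k \<le> d then
         double_const \<alpha> k * (\<Sum>e\<in>edges H. series_nth \<alpha> (2 * k) (d - 2 * k) (2 * nbr_count H e)) +
         pair_const \<alpha> k * (\<Sum>e\<in>edges H. \<Sum>f\<in>nbrs (edges H) e.
           series_nth \<alpha> (2 * k) (d - 2 * k) (nbr_count H e + nbr_count H f))
       else 0)))"
proof -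
  note H = uniform_hypertreesD[OF assms(1-3)]
  have n: "nverts H = n" using H(7) by (simp add: n_def)
  have diag: "(\<Sum>v<n. (\<alpha> * real (degree H v)) ^ d) = real n * \<alpha> ^ d + (real (k * m) - real n) * ((2 * \<alpha>) ^ d - \<alpha> ^ d)"
    using sum_over_degrees[OF assms(1-4), of "\<lambda>x. (\<alpha> * real x) ^ d"] by (simp add: n mult.commute)
  have one: "fps_nth (edge_fps \<alpha> H e) j = series_nth \<alpha> k j (nbr_count H e)" if "e \<in> edges H" for e j
    using edge_fps_eq[OF assms(1-4) that] by (simp add: series_nth_def)
  have two: "fps_nth (edge_fps \<alpha> H e * edge_fps \<alpha> H f) j = series_nth \<alpha> (2 * k) j (nbr_count H e + nbr_count H f)"
    if "e \<in> edges H" "f \<in> edges H" for e f j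
    using edge_fps_eq[OF assms(1-4)] that by (simp add: series_nth_def power_add mult_2_right mult_ac)
  have s1: "(\<Sum>e\<in>edges H. fps_nth (edge_fps \<alpha> H e) j) = (\<Sum>e\<in>edges H. series_nth \<alpha> k j (nbr_count H e))" for j
    by (rule sum.cong[OF refl one])
  have s2: "(\<Sum>e\<in>edges H. fps_nth (edge_fps \<alpha> H e * edge_fps \<alpha> H e) j)
      = (\<Sum>e\<in>edges H. series_nth \<alpha> (2 * k) j (2 * nbr_count H e))" for j
    by (rule sum.cong[OF refl]) (simp add: two mult_2)
  have s3: "(\<Sum>e\<in>edges H. \<Sum>f\<in>nbrs (edges H) e. fps_nth (edge_fps \<alpha> H e * edge_fps \<alpha> H f) j)
      = (\<Sum>e\<in>edges H. \<Sum>f\<in>nbrs (edges H) e. series_nth \<alpha> (2 * k) j (nbr_count H e + nbr_count H f))" for j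
    by (intro sum.cong refl two) (auto simp: nbrs_def)
  show ?thesis
    using Tr_hypertree[OF H(1,6) assms(2,5,6), of \<alpha>]
    unfolding n diag s1 s2 s3 .
qed

section \<open>Comparing traces\<close>

lemma precI:
  assumes G: "G \<in> uniform_hypertrees k m" and H: "H \<in> uniform_hypertrees k m"
    and km: "k \<ge> 3" "m \<ge> 4" and d: "1 \<le> d" "d \<le> 2 * k + 2"
  defines "n \<equiv> m * (k - 1) + 1"
  assumes eq: "\<And>t. 1 \<le> t \<Longrightarrow> t < d \<Longrightarrow> Tr n k (A_tensor \<alpha> k G) t = Tr n k (A_tensor \<alpha> k H) t"
    and less: "Tr n k (A_tensor \<alpha> k G) d < Tr n k (A_tensor \<alpha> k H) d"
  shows "prec \<alpha> k G H"
proof -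
  have nG: "nverts G = n" "nverts H = n"
    using uniform_hypertreesD(7)[OF G] uniform_hypertreesD(7)[OF H] km by (simp_all add: n_def)
  \<comment> \<open>The admissible orders end just before the number of eigenvalues; the bound is at
    least \<open>2 n - 1\<close>, hence at least \<open>2 k + 2\<close>.\<close>
  have "4 * (k - 1) \<le> m * (k - 1)" using km by (intro mult_le_mono1) simp
  then have n: "n \<ge> 4 * (k - 1) + 1" by (simp add: n_def)
  have "(k - 1) ^ 1 \<le> (k - 1) ^ (n - 1)" using km n by (intro power_increasing) auto
  then have "n * 2 \<le> n * (k - 1) ^ (n - 1)" using km by (intro mult_le_mono2) simp
  then have "d \<le> n * (k - 1) ^ (n - 1) - 1" using d n km by linarith
  moreover have "Tr n k (A_tensor \<alpha> k G) t = Tr n k (A_tensor \<alpha> k H) t" if "t < d" for t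
    using eq[of t] that by (cases "t = 0") (auto simp: Tr_def)
  ultimately show ?thesis
    unfolding prec_def nG using d(1) less by (intro conjI refl bexI[of _ d]) auto
qed

text \<open>Order 2 lies below \<open>k\<close>, so only the diagonal counts, that is, the sum of
  the squared degrees. Writing \<open>d^2\<close> as \<open>3 d - 2 + (d - 1)(d - 2)\<close> with a
  fixed degree sum shows that it is least exactly when all degrees are at most two.\<close>

lemma prec_of_large_degree:
  assumes G: "G \<in> uniform_hypertrees k m" and H: "H \<in> uniform_hypertrees k m"
    and km: "k \<ge> 3" "m \<ge> 4" and \<alpha>: "\<alpha> > 0"
    and two: "max_degree_two G" "\<not> max_degree_two H"
  shows "prec \<alpha> k G H"
proof -
  define n where "n = m * (k - 1) + 1"
  have km': "k \<ge> 2" "m \<ge> 1" using km by auto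
  note G' = uniform_hypertreesD[OF G km'] and H' = uniform_hypertreesD[OF H km']
  have nG: "nverts G = n" "nverts H = n" using G'(7) H'(7) by (simp_all add: n_def)
  have small: "Tr n k (A_tensor \<alpha> k K) d = real ((k - 1) ^ (n - 1)) * (\<Sum>v<n. (\<alpha> * real (degree K v)) ^ d)"
    if "K = G \<or> K = H" "1 \<le> d" "d < k" for K d
    using that Tr_hypertree[OF G'(1,6) km'(1), of d \<alpha>] Tr_hypertree[OF H'(1,6) km'(1), of d \<alpha>] km nG by auto
  have sq: "(\<Sum>v<n. (real (degree K v))\<^sup>2) = 3 * real (k * m) - 2 * real n + (\<Sum>v<n. real ((degree K v - 1) * (degree K v - 2)))"
    if K: "K \<in> uniform_hypertrees k m" "nverts K = n" for K
  proof -
    have "(\<Sum>v<n. (real (degree K v))\<^sup>2) = (\<Sum>v<n. 3 * real (degree K v) - 2 + real ((degree K v - 1) * (degree K v - 2)))"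
    proof (rule sum.cong[OF refl])
      fix v assume "v \<in> {..<n}"
      then have "degree K v \<ge> 1" using degree_pos[OF K(1) km', of v] K(2) by simp
      then consider "degree K v = 1" | a where "degree K v = a + 2"
        by (metis One_nat_def Suc_1 le_add_diff_inverse2 le_antisym not_less_eq_eq)
      then show "(real (degree K v))\<^sup>2 = 3 * real (degree K v) - 2 + real ((degree K v - 1) * (degree K v - 2))"
        by cases (simp_all add: power2_eq_square algebra_simps)
    qed
    also have "\<dots> = 3 * real (\<Sum>v<n. degree K v) - 2 * real n + (\<Sum>v<n. real ((degree K v - 1) * (degree K v - 2)))"
      by (simp add: sum.distrib sum_subtractf sum_distrib_left)
    finally show ?thesis unfolding sum_degree[OF K(1) km', unfolded K(2)] .
  qed
  have "(\<Sum>v<n. real ((degree G v - 1) * (degree G v - 2))) = 0"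
    using two(1) nG by (intro sum.neutral) (auto simp: max_degree_two_def)
  moreover have "(\<Sum>v<n. real ((degree H v - 1) * (degree H v - 2))) > 0"
  proof -
    obtain v where v: "v < n" "degree H v > 2" using two(2) nG by (auto simp: max_degree_two_def)
    then show ?thesis by (intro sum_pos2[of _ v]) auto
  qed
  ultimately have less: "(\<Sum>v<n. (real (degree G v))\<^sup>2) < (\<Sum>v<n. (real (degree H v))\<^sup>2)"
    using sq[OF G nG(1)] sq[OF H nG(2)] by simp
  have C: "real ((k - 1) ^ (n - 1)) > 0" using km by simp
  show ?thesis
  proof (rule precI[OF G H km, of 2], unfold n_def[symmetric])
    fix t :: nat assume "1 \<le> t" "t < 2"
    then have "t = 1" by simp
    moreover have "(\<Sum>v<n. real (degree G v)) = (\<Sum>v<n. real (degree H v))"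
      using sum_degree[OF G km'] sum_degree[OF H km'] nG by (simp flip: of_nat_sum)
    ultimately show "Tr n k (A_tensor \<alpha> k G) t = Tr n k (A_tensor \<alpha> k H) t"
      using small[of G 1] small[of H 1] km by (simp flip: sum_distrib_left)
  next
    have "\<alpha>\<^sup>2 * (\<Sum>v<n. (real (degree G v))\<^sup>2) < \<alpha>\<^sup>2 * (\<Sum>v<n. (real (degree H v))\<^sup>2)"
      using less \<alpha> by simp
    then show "Tr n k (A_tensor \<alpha> k G) 2 < Tr n k (A_tensor \<alpha> k H) 2"
      using small[of G 2] small[of H 2] km C by (simp add: power_mult_distrib flip: sum_distrib_left)
  qed (use km in auto)
qed

definition nbr_power_sum :: "hgraph \<Rightarrow> nat \<Rightarrow> real" where
  "nbr_power_sum H j = (\<Sum>e\<in>edges H. real (nbr_count H e) ^ j)"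

definition nbr_product_sum :: "hgraph \<Rightarrow> real" where
  "nbr_product_sum H = (\<Sum>e\<in>edges H. \<Sum>f\<in>nbrs (edges H) e. real (nbr_count H e) * real (nbr_count H f))"

lemma single_const_pos: "\<alpha> < 1 \<Longrightarrow> k \<ge> 2 \<Longrightarrow> single_const \<alpha> k > 0"
  by (simp add: single_const_def single_weight_pos)

lemma pair_const_pos: "\<alpha> < 1 \<Longrightarrow> k \<ge> 2 \<Longrightarrow> pair_const \<alpha> k > 0"
  by (simp add: pair_const_def pair_weight_pos)

lemma nbr_power_sum_low:
  assumes "H \<in> uniform_hypertrees k m" "k \<ge> 2" "m \<ge> 1" "max_degree_two H"
  shows "nbr_power_sum H 0 = real m" "nbr_power_sum H 1 = real (2 * (m - 1))"
  using uniform_hypertreesD(2)[OF assms(1-3)] sum_nbr_count[OF assms]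
  by (simp_all add: nbr_power_sum_def flip: of_nat_sum)

lemma sum_series_nth_low:
  shows "(\<Sum>e\<in>edges H. series_nth \<alpha> p 0 (nbr_count H e)) = nbr_power_sum H 0"
    "(\<Sum>e\<in>edges H. series_nth \<alpha> p (Suc 0) (nbr_count H e))
      = series_nth \<alpha> p (Suc 0) 0 * nbr_power_sum H 0 + \<alpha> * nbr_power_sum H 1"
    "(\<Sum>e\<in>edges H. series_nth \<alpha> p 2 (nbr_count H e))
      = series_nth \<alpha> p 2 0 * nbr_power_sum H 0 + series_nth \<alpha> p (Suc 0) 0 * \<alpha> * nbr_power_sum H 1
        + \<alpha>\<^sup>2 / 2 * (nbr_power_sum H 2 + 3 * nbr_power_sum H 1)"
proof -
  show "(\<Sum>e\<in>edges H. series_nth \<alpha> p 0 (nbr_count H e)) = nbr_power_sum H 0"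
    by (simp add: series_nth_low(1) nbr_power_sum_def)
  show "(\<Sum>e\<in>edges H. series_nth \<alpha> p (Suc 0) (nbr_count H e))
      = series_nth \<alpha> p (Suc 0) 0 * nbr_power_sum H 0 + \<alpha> * nbr_power_sum H 1"
    by (subst series_nth_low(2)) (simp add: nbr_power_sum_def sum.distrib sum_distrib_left mult.commute)
  have "(\<Sum>e\<in>edges H. series_nth \<alpha> p 2 (nbr_count H e))
      = (\<Sum>e\<in>edges H. series_nth \<alpha> p 2 0 * 1 + series_nth \<alpha> p (Suc 0) 0 * \<alpha> * real (nbr_count H e)
          + \<alpha>\<^sup>2 / 2 * ((real (nbr_count H e))\<^sup>2 + 3 * real (nbr_count H e)))"
    by (rule sum.cong[OF refl], subst series_nth_low(3)) simp
  also have "\<dots> = series_nth \<alpha> p 2 0 * nbr_power_sum H 0 + series_nth \<alpha> p (Suc 0) 0 * \<alpha> * nbr_power_sum H 1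
        + \<alpha>\<^sup>2 / 2 * (nbr_power_sum H 2 + 3 * nbr_power_sum H 1)"
    unfolding sum.distrib sum_distrib_left[symmetric] by (simp add: nbr_power_sum_def)
  finally show "(\<Sum>e\<in>edges H. series_nth \<alpha> p 2 (nbr_count H e))
      = series_nth \<alpha> p 2 0 * nbr_power_sum H 0 + series_nth \<alpha> p (Suc 0) 0 * \<alpha> * nbr_power_sum H 1
        + \<alpha>\<^sup>2 / 2 * (nbr_power_sum H 2 + 3 * nbr_power_sum H 1)" .
qed

text \<open>Orders \<open>k\<close> and \<open>k + 1\<close> read only the number of hyperedges and
  the sum of the neighbour counts, both determined by \<open>m\<close>. Order \<open>k + 2\<close>
  is still below \<open>2 * k\<close>, so the squares enter through single hyperedges alone.\<close>

lemma prec_of_nbr_squares: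
  assumes G: "G \<in> uniform_hypertrees k m" and H: "H \<in> uniform_hypertrees k m"
    and km: "k \<ge> 3" "m \<ge> 4" and \<alpha>: "\<alpha> > 0" "\<alpha> < 1"
    and two: "max_degree_two G" "max_degree_two H"
    and less: "nbr_power_sum G 2 < nbr_power_sum H 2"
  shows "prec \<alpha> k G H"
proof -
  have km': "k \<ge> 2" "m \<ge> 1" using km by auto
  define n where "n = m * (k - 1) + 1"
  note TG = Tr_max_degree_two[OF G km' two(1), folded n_def]
  note TH = Tr_max_degree_two[OF H km' two(2), folded n_def]
  have low: "nbr_power_sum G 0 = nbr_power_sum H 0" "nbr_power_sum G 1 = nbr_power_sum H 1"
    using nbr_power_sum_low[OF G km' two(1)] nbr_power_sum_low[OF H km' two(2)] by auto
  have C: "real ((k - 1) ^ (n - 1)) > 0" using km by simp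
  show ?thesis
  proof (rule precI[OF G H km, of "k + 2"], unfold n_def[symmetric])
    fix t assume t: "1 \<le> t" "t < k + 2"
    then have t2: "t < 3 * k" "\<not> 2 * k \<le> t" using km by auto
    consider "t < k" | "t = k" | "t = Suc k" using t by linarith
    then have "(if k \<le> t then single_const \<alpha> k * (\<Sum>e\<in>edges G. series_nth \<alpha> k (t - k) (nbr_count G e)) else 0)
        = (if k \<le> t then single_const \<alpha> k * (\<Sum>e\<in>edges H. series_nth \<alpha> k (t - k) (nbr_count H e)) else 0)"
      (is ?goal)
    proof cases
      case 2
      then have "t - k = 0" by simp
      then show ?goal using low by (simp only: sum_series_nth_low)
    next
      case 3
      then have "t - k = Suc 0" by simp
      then show ?goal using low by (simp only: sum_series_nth_low)
    qed simp
    then show "Tr n k (A_tensor \<alpha> k G) t = Tr n k (A_tensor \<alpha> k H) t"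
      unfolding TG[OF t(1) t2(1)] TH[OF t(1) t2(1)] if_not_P[OF t2(2)] by (simp only:)
  next
    define d where "d = k + 2"
    have d: "1 \<le> d" "d < 3 * k" "\<not> 2 * k \<le> d" "k \<le> d" "d - k = 2" using km by (auto simp: d_def)
    have "\<alpha>\<^sup>2 / 2 * nbr_power_sum G 2 < \<alpha>\<^sup>2 / 2 * nbr_power_sum H 2"
      using less \<alpha> by simp
    then have "(\<Sum>e\<in>edges G. series_nth \<alpha> k 2 (nbr_count G e)) < (\<Sum>e\<in>edges H. series_nth \<alpha> k 2 (nbr_count H e))"
      unfolding sum_series_nth_low(3) low distrib_left by linarith
    moreover note single_const_pos[OF \<alpha>(2) km'(1)]
    moreover have "real (d * (k - 1)) > 0" unfolding of_nat_0_less_iff using km by (simp add: d_def)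
    ultimately show "Tr n k (A_tensor \<alpha> k G) (k + 2) < Tr n k (A_tensor \<alpha> k H) (k + 2)"
      unfolding d_def[symmetric] TG[OF d(1,2)] TH[OF d(1,2)] if_not_P[OF d(3)] if_P[OF d(4)] d(5) add_0_right
      using C by (intro mult_strict_left_mono add_strict_left_mono)
  qed (use km in auto)
qed

lemma sum_pairs_series_nth_low:
  fixes H :: hgraph
  assumes "finite (edges H)"
  defines "P \<equiv> nbr_power_sum H"
  shows "(\<Sum>e\<in>edges H. \<Sum>f\<in>nbrs (edges H) e. series_nth \<alpha> p 0 (nbr_count H e + nbr_count H f)) = P 1"
    "(\<Sum>e\<in>edges H. \<Sum>f\<in>nbrs (edges H) e. series_nth \<alpha> p (Suc 0) (nbr_count H e + nbr_count H f))
      = series_nth \<alpha> p (Suc 0) 0 * P 1 + 2 * \<alpha> * P 2"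
    "(\<Sum>e\<in>edges H. \<Sum>f\<in>nbrs (edges H) e. series_nth \<alpha> p 2 (nbr_count H e + nbr_count H f))
      = series_nth \<alpha> p 2 0 * P 1 + series_nth \<alpha> p (Suc 0) 0 * \<alpha> * (2 * P 2)
        + \<alpha>\<^sup>2 / 2 * (2 * P 3 + 6 * P 2 + 2 * nbr_product_sum H)"
proof -
  let ?E = "edges H"
  let ?q = "\<lambda>e. real (nbr_count H e)"
  \<comment> \<open>The inner sum is constant with \<open>nbr_count H e\<close> terms, which raises
    the power by one; by symmetry of adjacency the same holds for powers of the count of
    \<open>f\<close>.\<close>
  have own: "(\<Sum>e\<in>?E. \<Sum>f\<in>nbrs ?E e. ?q e ^ j) = P (Suc j)" for j
    by (simp add: P_def nbr_power_sum_def)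
  have other: "(\<Sum>e\<in>?E. \<Sum>f\<in>nbrs ?E e. ?q f ^ j) = P (Suc j)" for j
    using sum_nbrs_swap[OF assms(1), of "\<lambda>e f. ?q f ^ j"] own by simp
  have products: "nbr_product_sum H = (\<Sum>e\<in>?E. ?q e * (\<Sum>f\<in>nbrs ?E e. ?q f))"
    by (simp add: nbr_product_sum_def sum_distrib_left)
  note s = own[of 0] own[of 1] own[of 2] other[of 1] other[of 2]
  show "(\<Sum>e\<in>?E. \<Sum>f\<in>nbrs ?E e. series_nth \<alpha> p 0 (nbr_count H e + nbr_count H f)) = P 1"
    using s(1) by (simp add: series_nth_low(1))
  have "(\<Sum>e\<in>?E. \<Sum>f\<in>nbrs ?E e. series_nth \<alpha> p (Suc 0) (nbr_count H e + nbr_count H f))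
      = (\<Sum>e\<in>?E. \<Sum>f\<in>nbrs ?E e. series_nth \<alpha> p (Suc 0) 0 * ?q e ^ 0 + \<alpha> * ?q e ^ 1 + \<alpha> * ?q f ^ 1)"
    by (intro sum.cong refl, subst series_nth_low(2)) (simp add: distrib_left)
  also have "\<dots> = series_nth \<alpha> p (Suc 0) 0 * P 1 + 2 * \<alpha> * P 2"
    unfolding sum.distrib sum_distrib_left[symmetric] s by (simp add: numeral_2_eq_2)
  finally show "(\<Sum>e\<in>?E. \<Sum>f\<in>nbrs ?E e. series_nth \<alpha> p (Suc 0) (nbr_count H e + nbr_count H f))
      = series_nth \<alpha> p (Suc 0) 0 * P 1 + 2 * \<alpha> * P 2" .
  have "(\<Sum>e\<in>?E. \<Sum>f\<in>nbrs ?E e. series_nth \<alpha> p 2 (nbr_count H e + nbr_count H f))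
      = (\<Sum>e\<in>?E. \<Sum>f\<in>nbrs ?E e. series_nth \<alpha> p 2 0 * ?q e ^ 0
          + (series_nth \<alpha> p (Suc 0) 0 * \<alpha> * ?q e ^ 1 + series_nth \<alpha> p (Suc 0) 0 * \<alpha> * ?q f ^ 1)
          + (\<alpha>\<^sup>2 / 2 * ?q e ^ 2 + \<alpha>\<^sup>2 / 2 * ?q f ^ 2 + \<alpha>\<^sup>2 * (?q e * ?q f) + \<alpha>\<^sup>2 * 3 / 2 * ?q e ^ 1 + \<alpha>\<^sup>2 * 3 / 2 * ?q f ^ 1))"
    by (intro sum.cong refl, subst series_nth_low(3)) (simp add: power2_eq_square field_simps)
  also have "\<dots> = series_nth \<alpha> p 2 0 * P 1 + series_nth \<alpha> p (Suc 0) 0 * \<alpha> * (2 * P 2)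
        + \<alpha>\<^sup>2 / 2 * (2 * P 3 + 6 * P 2 + 2 * nbr_product_sum H)"
    unfolding sum.distrib sum_distrib_left[symmetric] s products[symmetric]
    by (simp add: numeral_2_eq_2 numeral_3_eq_3 field_simps)
  finally show "(\<Sum>e\<in>?E. \<Sum>f\<in>nbrs ?E e. series_nth \<alpha> p 2 (nbr_count H e + nbr_count H f))
      = series_nth \<alpha> p 2 0 * P 1 + series_nth \<alpha> p (Suc 0) 0 * \<alpha> * (2 * P 2)
        + \<alpha>\<^sup>2 / 2 * (2 * P 3 + 6 * P 2 + 2 * nbr_product_sum H)" .
qed

text \<open>By \<open>dist\<close> the neighbour counts have the same distribution, so single and
  doubled hyperedges contribute equally at every order considered. For adjacent pairs the first two
  coefficients are power sums as well, and in the third only the product of the two counts is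
  new.\<close>

lemma prec_of_nbr_products:
  assumes G: "G \<in> uniform_hypertrees k m" and H: "H \<in> uniform_hypertrees k m"
    and km: "k \<ge> 3" "m \<ge> 4" and \<alpha>: "\<alpha> > 0" "\<alpha> < 1"
    and two: "max_degree_two G" "max_degree_two H"
    and dist: "\<And>g :: nat \<Rightarrow> real. (\<Sum>e\<in>edges G. g (nbr_count G e)) = (\<Sum>e\<in>edges H. g (nbr_count H e))"
    and less: "nbr_product_sum G < nbr_product_sum H"
  shows "prec \<alpha> k G H"
proof -
  have km': "k \<ge> 2" "m \<ge> 1" using km by auto
  define n where "n = m * (k - 1) + 1"
  have fin: "finite (edges G)" "finite (edges H)"
    using uniform_hypertreesD(3)[OF G km'] uniform_hypertreesD(3)[OF H km'] by auto
  have P: "nbr_power_sum G = nbr_power_sum H"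
  proof
    fix j
    show "nbr_power_sum G j = nbr_power_sum H j"
      unfolding nbr_power_sum_def by (rule dist[of "\<lambda>q. real q ^ j"])
  qed
  define S where "S K t = (\<Sum>e\<in>edges K. \<Sum>f\<in>nbrs (edges K) e. series_nth \<alpha> (2 * k) (t - 2 * k) (nbr_count K e + nbr_count K f))" for K t
  define R where "R t = real n * \<alpha> ^ t + (real (k * m) - real n) * ((2 * \<alpha>) ^ t - \<alpha> ^ t)" for t
  define Q where "Q t = (if k \<le> t then single_const \<alpha> k * (\<Sum>e\<in>edges H. series_nth \<alpha> k (t - k) (nbr_count H e)) else 0)" for t
  define D where "D t = double_const \<alpha> k * (\<Sum>e\<in>edges H. series_nth \<alpha> (2 * k) (t - 2 * k) (2 * nbr_count H e))" for t
  have d1: "(\<Sum>e\<in>edges G. series_nth \<alpha> k j (nbr_count G e)) = (\<Sum>e\<in>edges H. series_nth \<alpha> k j (nbr_count H e))" for j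
    by (rule dist)
  have d2: "(\<Sum>e\<in>edges G. series_nth \<alpha> (2 * k) j (2 * nbr_count G e)) = (\<Sum>e\<in>edges H. series_nth \<alpha> (2 * k) j (2 * nbr_count H e))" for j
    using dist[of "\<lambda>q. series_nth \<alpha> (2 * k) j (2 * q)"] .
  have TG: "Tr n k (A_tensor \<alpha> k G) t = real ((k - 1) ^ (n - 1)) *
      (R t + real (t * (k - 1)) * (Q t + (if 2 * k \<le> t then D t + pair_const \<alpha> k * S G t else 0)))"
    if "1 \<le> t" "t < 3 * k" for t
    unfolding Tr_max_degree_two[OF G km' two(1) that, folded n_def] d1 d2 R_def Q_def D_def S_def ..
  have TH: "Tr n k (A_tensor \<alpha> k H) t = real ((k - 1) ^ (n - 1)) *
      (R t + real (t * (k - 1)) * (Q t + (if 2 * k \<le> t then D t + pair_const \<alpha> k * S H t else 0)))"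
    if "1 \<le> t" "t < 3 * k" for t
    unfolding Tr_max_degree_two[OF H km' two(2) that, folded n_def] R_def Q_def D_def S_def ..
  have C: "real ((k - 1) ^ (n - 1)) > 0" using km by simp
  show ?thesis
  proof (rule precI[OF G H km, of "2 * k + 2"], unfold n_def[symmetric])
    fix t assume t: "1 \<le> t" "t < 2 * k + 2"
    then have t3: "t < 3 * k" using km by auto
    have "S G t = S H t" if "2 * k \<le> t"
    proof -
      consider "t - 2 * k = 0" | "t - 2 * k = Suc 0" using that t by linarith
      then show ?thesis
      proof cases
        case 1
        show ?thesis
          unfolding S_def 1 sum_pairs_series_nth_low(1)[OF fin(1)] sum_pairs_series_nth_low(1)[OF fin(2)] P ..
      next
        case 2
        show ?thesis
          unfolding S_def 2 sum_pairs_series_nth_low(2)[OF fin(1)] sum_pairs_series_nth_low(2)[OF fin(2)] P ..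
      qed
    qed
    then show "Tr n k (A_tensor \<alpha> k G) t = Tr n k (A_tensor \<alpha> k H) t"
      unfolding TG[OF t(1) t3] TH[OF t(1) t3] by simp
  next
    define d where "d = 2 * k + 2"
    have d: "1 \<le> d" "d < 3 * k" "2 * k \<le> d" "d - 2 * k = 2" using km by (auto simp: d_def)
    have "\<alpha>\<^sup>2 / 2 * (2 * nbr_product_sum G) < \<alpha>\<^sup>2 / 2 * (2 * nbr_product_sum H)"
      using less \<alpha> by simp
    then have "S G d < S H d"
      unfolding S_def d(4) sum_pairs_series_nth_low(3)[OF fin(1)] sum_pairs_series_nth_low(3)[OF fin(2)] P
        distrib_left by linarith
    moreover note pair_const_pos[OF \<alpha>(2) km'(1)]
    moreover have "real (d * (k - 1)) > 0" unfolding of_nat_0_less_iff using km by (simp add: d_def)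
    ultimately show "Tr n k (A_tensor \<alpha> k G) (2 * k + 2) < Tr n k (A_tensor \<alpha> k H) (2 * k + 2)"
      unfolding d_def[symmetric] TG[OF d(1,2)] TH[OF d(1,2)] if_P[OF d(3)]
      using C by (intro mult_strict_left_mono add_strict_left_mono)
  qed (use km in auto)
qed

section \<open>Trees with a single branching edge\<close>

definition spider :: "hgraph \<Rightarrow> nat set \<Rightarrow> bool" where
  "spider H e0 \<longleftrightarrow> e0 \<in> edges H \<and> nbr_count H e0 = 3 \<and> (\<forall>e\<in>edges H. e \<noteq> e0 \<longrightarrow> nbr_count H e \<le> 2)"

text \<open>The legs at the branching hyperedge that consist of a single hyperedge.\<close>

definition short_legs :: "hgraph \<Rightarrow> nat set \<Rightarrow> nat" where
  "short_legs H e0 = card {f \<in> nbrs (edges H) e0. nbr_count H f = 1}"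

text \<open>Outside \<open>e0\<close> the counts are 1 or 2, where \<open>g\<close> is affine, and
  their sum is fixed. So all spiders with \<open>m\<close> hyperedges have the same distribution of
  counts, with exactly three leaves.\<close>

lemma spider_distribution:
  fixes g :: "nat \<Rightarrow> real"
  assumes H: "H \<in> uniform_hypertrees k m" and km: "k \<ge> 2" "m \<ge> 2" and two: "max_degree_two H"
    and sp: "spider H e0"
  shows "(\<Sum>e\<in>edges H. g (nbr_count H e)) = g 3 + (real m - 1) * g 2 + 3 * (g 1 - g 2)"
proof -
  have m1: "m \<ge> 1" using km by simp
  note H' = uniform_hypertreesD[OF H km(1) m1]
  let ?E = "edges H - {e0}"
  have e0: "e0 \<in> edges H" "nbr_count H e0 = 3" using sp by (auto simp: spider_def)
  have split: "(\<Sum>e\<in>edges H. h e) = h e0 + (\<Sum>e\<in>?E. h e)" for h :: "nat set \<Rightarrow> real"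
    using H'(3) e0(1) by (rule sum.remove)
  have card: "real (card ?E) = real m - 1"
    using H'(2,3) e0(1) m1 by (simp add: of_nat_diff)
  have "(\<Sum>e\<in>?E. g (nbr_count H e)) = (\<Sum>e\<in>?E. g 2 + (2 - real (nbr_count H e)) * (g 1 - g 2))"
  proof (rule sum.cong[OF refl])
    fix e assume "e \<in> ?E"
    then have "nbr_count H e = 1 \<or> nbr_count H e = 2"
      using sp nbr_count_pos[OF H km, of e] by (force simp: spider_def)
    then show "g (nbr_count H e) = g 2 + (2 - real (nbr_count H e)) * (g 1 - g 2)" by auto
  qed
  also have "\<dots> = (real m - 1) * g 2 + (2 * (real m - 1) - (\<Sum>e\<in>?E. real (nbr_count H e))) * (g 1 - g 2)"
    unfolding sum.distrib sum_distrib_right[symmetric] sum_subtractf sum_constant card by simp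
  also have "(\<Sum>e\<in>?E. real (nbr_count H e)) = 2 * (real m - 1) - 3"
  proof -
    have "(\<Sum>e\<in>edges H. real (nbr_count H e)) = 2 * (real m - 1)"
      using arg_cong[OF sum_nbr_count[OF H km(1) m1 two], of real] m1 by (simp add: of_nat_diff)
    then show ?thesis using split[of "\<lambda>e. real (nbr_count H e)"] e0(2) by simp
  qed
  finally show ?thesis using split[of "\<lambda>e. g (nbr_count H e)"] e0(2) by simp
qed

text \<open>Two adjacent leaves touch nothing else, so by connectedness there would be only two
  hyperedges.\<close>

lemma leaves_not_adjacent:
  assumes H: "H \<in> uniform_hypertrees k m" and km: "k \<ge> 2" "m \<ge> 3"
    and e: "e \<in> edges H" "nbr_count H e = 1" and f: "f \<in> nbrs (edges H) e" "nbr_count H f = 1"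
  shows False
proof -
  have m1: "m \<ge> 1" using km by simp
  note H' = uniform_hypertreesD[OF H km(1) m1]
  have fE: "f \<in> edges H" "f \<noteq> e" using f(1) by (auto simp: nbrs_def)
  have ne: "nbrs (edges H) e = {f}"
    using e(2) f(1) by (auto simp: card_1_singleton_iff)
  have nf: "nbrs (edges H) f = {e}"
    using f(2) nbrs_sym[OF e(1) f(1)] by (auto simp: card_1_singleton_iff)
  have "edges H \<noteq> {e, f}"
  proof
    assume "edges H = {e, f}"
    then have "card (edges H) = 2" using fE(2) by simp
    then show False using H'(2) km(2) by simp
  qed
  then have "{e, f} \<subset> edges H" using e(1) fE(1) by blast
  moreover have "edge_connected (edges H)" using H'(4) by (simp add: edge_tree_def)
  ultimately obtain h where h: "h \<in> edges H - {e, f}" "h \<inter> \<Union>{e, f} \<noteq> {}"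
    unfolding edge_connected_def by (metis insert_not_empty)
  then have "h \<in> nbrs (edges H) e \<or> h \<in> nbrs (edges H) f" by (auto simp: nbrs_def)
  then show False using ne nf h(1) by auto
qed

text \<open>With \<open>w = q - 2\<close> only pairs of the branching edge and a leaf contribute to the sum of
  \<open>w e * w f\<close> over adjacent pairs.\<close>

lemma spider_product_sum:
  assumes H: "H \<in> uniform_hypertrees k m" and km: "k \<ge> 2" "m \<ge> 3" and two: "max_degree_two H"
    and sp: "spider H e0"
  shows "nbr_product_sum H = 4 * nbr_power_sum H 2 - 4 * nbr_power_sum H 1 - 2 * real (short_legs H e0)"
proof -
  have m1: "m \<ge> 1" and m2: "m \<ge> 2" using km by auto
  note H' = uniform_hypertreesD[OF H km(1) m1]
  let ?E = "edges H"
  let ?q = "\<lambda>e. real (nbr_count H e)"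
  define w where "w e = ?q e - 2" for e
  have e0: "e0 \<in> ?E" "w e0 = 1" using sp by (auto simp: spider_def w_def)
  have cases: "nbr_count H e = 1 \<or> nbr_count H e = 2" if "e \<in> ?E" "e \<noteq> e0" for e
    using sp nbr_count_pos[OF H km(1) m2 that(1)] that by (force simp: spider_def)
  have nbE: "f \<in> ?E" "f \<noteq> e" if "f \<in> nbrs ?E e" for e f using that by (auto simp: nbrs_def)
  have own: "(\<Sum>e\<in>?E. \<Sum>f\<in>nbrs ?E e. ?q e) = nbr_power_sum H 2"
    by (simp add: nbr_power_sum_def power2_eq_square)
  have other: "(\<Sum>e\<in>?E. \<Sum>f\<in>nbrs ?E e. ?q f) = nbr_power_sum H 2"
    using sum_nbrs_swap[OF H'(3), of "\<lambda>e f. ?q f"] own by simp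
  have ones: "(\<Sum>e\<in>?E. \<Sum>f\<in>nbrs ?E e. (1::real)) = nbr_power_sum H 1"
    by (simp add: nbr_power_sum_def)
  have "(\<Sum>e\<in>?E. \<Sum>f\<in>nbrs ?E e. w e * w f)
      = (\<Sum>e\<in>?E. \<Sum>f\<in>nbrs ?E e. ?q e * ?q f - 2 * ?q e - 2 * ?q f + 4 * 1)"
    by (simp add: w_def algebra_simps)
  also have "\<dots> = nbr_product_sum H - 2 * nbr_power_sum H 2 - 2 * nbr_power_sum H 2 + 4 * nbr_power_sum H 1"
  proof -
    have products: "(\<Sum>e\<in>?E. ?q e * (\<Sum>f\<in>nbrs ?E e. ?q f)) = nbr_product_sum H"
      by (simp add: nbr_product_sum_def sum_distrib_left)
    show ?thesis
      unfolding sum.distrib sum_subtractf sum_distrib_left[symmetric] own other ones products ..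
  qed
  finally have 1: "(\<Sum>e\<in>?E. \<Sum>f\<in>nbrs ?E e. w e * w f)
      = nbr_product_sum H - 4 * nbr_power_sum H 2 + 4 * nbr_power_sum H 1" by simp
  have "(\<Sum>e\<in>?E. \<Sum>f\<in>nbrs ?E e. w e * w f)
      = (\<Sum>e\<in>?E. \<Sum>f\<in>nbrs ?E e. (if e = e0 then w f else 0) + (if f = e0 then w e else 0))"
  proof (intro sum.cong refl)
    fix e f assume e: "e \<in> ?E" and f: "f \<in> nbrs ?E e"
    show "w e * w f = (if e = e0 then w f else 0) + (if f = e0 then w e else 0)"
    proof (cases "e = e0 \<or> f = e0")
      case True
      then show ?thesis using nbE(2)[OF f] e0(2) by auto
    next
      case False
      then have "\<not> (nbr_count H e = 1 \<and> nbr_count H f = 1)"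
        using leaves_not_adjacent[OF H km e _ f] by blast
      then have "w e = 0 \<or> w f = 0"
        using cases[OF e] cases[OF nbE(1)[OF f]] False by (auto simp: w_def)
      then show ?thesis using False by auto
    qed
  qed
  also have "\<dots> = (\<Sum>e\<in>?E. \<Sum>f\<in>nbrs ?E e. if e = e0 then w f else 0) + (\<Sum>e\<in>?E. \<Sum>f\<in>nbrs ?E e. if f = e0 then w e else 0)"
    by (simp add: sum.distrib)
  \<comment> \<open>Every adjacent pair is summed in both orders; this is the factor 2 in front of
    \<open>short_legs\<close>, and its sign comes from \<open>w = -1\<close> on leaves.\<close>
  also have "(\<Sum>e\<in>?E. \<Sum>f\<in>nbrs ?E e. if f = e0 then w e else 0) = (\<Sum>e\<in>?E. \<Sum>f\<in>nbrs ?E e. if e = e0 then w f else 0)"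
    by (rule sum_nbrs_swap[OF H'(3)])
  also have "(\<Sum>e\<in>?E. \<Sum>f\<in>nbrs ?E e. if e = e0 then w f else 0) = (\<Sum>f\<in>nbrs ?E e0. w f)"
  proof -
    have "(\<Sum>e\<in>?E. \<Sum>f\<in>nbrs ?E e. if e = e0 then w f else 0) = (\<Sum>e\<in>?E. if e = e0 then (\<Sum>f\<in>nbrs ?E e0. w f) else 0)"
      by (intro sum.cong) auto
    then show ?thesis using e0(1) H'(3) by simp
  qed
  also have "(\<Sum>f\<in>nbrs ?E e0. w f) = (\<Sum>f\<in>nbrs ?E e0. if nbr_count H f = 1 then - 1 else 0)"
  proof (rule sum.cong[OF refl])
    fix f assume "f \<in> nbrs ?E e0"
    then show "w f = (if nbr_count H f = 1 then - 1 else 0)"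
      using cases[OF nbE] by (auto simp: w_def)
  qed
  also have "\<dots> = - real (short_legs H e0)"
    using finite_nbrs[OF H'(3)] by (simp add: sum.If_cases Int_def short_legs_def)
  finally show ?thesis using 1 by simp
qed

section \<open>The hyperpath and the hypertree with one branching edge\<close>

text \<open>Intersecting with \<open>{1..l}\<close> discards the index 0 before the first hyperedge
  and \<open>l + 1\<close> beyond the last.\<close>

lemma nbrs_path_hyperedge:
  assumes "k \<ge> 2" "i \<in> {1..l}"
  shows "nbrs (path_hyperedge k ` {1..l}) (path_hyperedge k i) = path_hyperedge k ` ({i - 1, i + 1} \<inter> {1..l})"
proof (intro Set.set_eqI iffI)
  fix e assume "e \<in> nbrs (path_hyperedge k ` {1..l}) (path_hyperedge k i)"
  then have e: "e \<in> path_hyperedge k ` {1..l}" "e \<noteq> path_hyperedge k i" "e \<inter> path_hyperedge k i \<noteq> {}"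
    by (simp_all add: nbrs_def)
  then obtain j where j: "j \<in> {1..l}" "e = path_hyperedge k j" "j \<noteq> i" "path_hyperedge k j \<inter> path_hyperedge k i \<noteq> {}"
    by blast
  have "\<not> i + 2 \<le> j" using path_hyperedge_Int_far[of i j k] assms j(4) by auto
  moreover have "\<not> j + 2 \<le> i" using path_hyperedge_Int_far[of j i k] assms j(1,4) by auto
  ultimately have "j = i - 1 \<or> j = i + 1" using j(3) by linarith
  then show "e \<in> path_hyperedge k ` ({i - 1, i + 1} \<inter> {1..l})" using j(1,2) by blast
next
  fix e assume "e \<in> path_hyperedge k ` ({i - 1, i + 1} \<inter> {1..l})"
  then obtain j where j: "j = i - 1 \<or> j = i + 1" "j \<in> {1..l}" "e = path_hyperedge k j" by blast
  have ji: "j \<noteq> i" using j(1) assms(2) by auto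
  then have "path_hyperedge k j \<noteq> path_hyperedge k i"
    using inj_onD[OF path_hyperedge_inj[OF assms(1)] _ j(2) assms(2)] by blast
  moreover have "path_hyperedge k j \<inter> path_hyperedge k i \<noteq> {}"
  proof (cases "j = i + 1")
    case True
    then show ?thesis using path_hyperedge_Int_next[of i k] assms(2) by auto
  next
    case False
    then have "Suc j = i" using j(1,2) assms(2) by auto
    then show ?thesis using path_hyperedge_Int_next[of j k] j(2) by auto
  qed
  ultimately show "e \<in> nbrs (path_hyperedge k ` {1..l}) (path_hyperedge k i)"
    using j by (auto simp: nbrs_def)
qed

lemma card_image_path_hyperedge:
  assumes "k \<ge> 2" "A \<subseteq> {1..l}"
  shows "card (path_hyperedge k ` A) = card A"
  by (rule card_image[OF inj_on_subset[OF path_hyperedge_inj[OF assms(1)] assms(2)]])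

lemma vdeg_path_hyperedges:
  assumes "k \<ge> 2"
  shows "vdeg (path_hyperedge k ` {1..l}) v \<le> 2"
proof (cases "\<exists>i\<in>{1..l}. v \<in> path_hyperedge k i")
  case True
  \<comment> \<open>Only \<open>a\<close> and \<open>a + 1\<close> are possible from the least index
    \<open>a\<close> on, since hyperedges two steps apart are disjoint.\<close>
  define a where "a = (LEAST i. i \<in> {1..l} \<and> v \<in> path_hyperedge k i)"
  have a: "a \<in> {1..l}" "v \<in> path_hyperedge k a"
    using LeastI_ex[of "\<lambda>i. i \<in> {1..l} \<and> v \<in> path_hyperedge k i"] True unfolding a_def by blast+
  have "i = a \<or> i = Suc a" if i: "i \<in> {1..l}" "v \<in> path_hyperedge k i" for i
  proof -
    have "a \<le> i" unfolding a_def using i by (intro Least_le) blast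
    moreover have "\<not> a + 2 \<le> i" using path_hyperedge_Int_far[of a i k] a i assms by auto
    ultimately show ?thesis by linarith
  qed
  then have "{e \<in> path_hyperedge k ` {1..l}. v \<in> e} \<subseteq> {path_hyperedge k a, path_hyperedge k (Suc a)}" by blast
  then have "vdeg (path_hyperedge k ` {1..l}) v \<le> card {path_hyperedge k a, path_hyperedge k (Suc a)}"
    unfolding vdeg_def by (intro card_mono) auto
  also have "\<dots> \<le> 2" by (simp add: card_insert_if)
  finally show ?thesis .
next
  case False
  then have "{e \<in> path_hyperedge k ` {1..l}. v \<in> e} = {}" by blast
  then show ?thesis unfolding vdeg_def by (simp only: card.empty)
qed

lemma hyperpath_facts:
  assumes "k \<ge> 2" "m \<ge> 1"
  shows "hyperpath k m \<in> uniform_hypertrees k m" "max_degree_two (hyperpath k m)"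
    "\<And>e. e \<in> edges (hyperpath k m) \<Longrightarrow> nbr_count (hyperpath k m) e \<le> 2"
proof -
  let ?E = "path_hyperedge k ` {1..m}"
  have P: "hyperpath k m = HG (m * (k - 1) + 1) ?E" by (simp add: hyperpath_def)
  have "\<Union>?E = {..<m * (k - 1) + 1}"
    using Union_path_hyperedges[OF assms(2), of k] by auto
  then show "hyperpath k m \<in> uniform_hypertrees k m"
    using grown_hypertree[OF grown_path_hyperedges[OF assms] assms(1)] card_image_path_hyperedge[OF assms(1), of "{1..m}" m]
    by (simp add: uniform_hypertrees_def P)
  show "max_degree_two (hyperpath k m)"
    using vdeg_path_hyperedges[OF assms(1)] by (simp add: max_degree_two_def degree_eq_vdeg P)
  show "nbr_count (hyperpath k m) e \<le> 2" if e: "e \<in> edges (hyperpath k m)" for e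
  proof -
    obtain i where i: "i \<in> {1..m}" "e = path_hyperedge k i" using e by (auto simp: P)
    have "card (path_hyperedge k ` ({i - 1, i + 1} \<inter> {1..m})) \<le> card ({i - 1, i + 1} \<inter> {1..m})"
      by (intro card_image_le) simp
    also have "\<dots> \<le> card {i - 1, i + 1}" by (intro card_mono) auto
    also have "\<dots> \<le> 2" by (simp add: card_insert_if)
    finally show ?thesis using nbrs_path_hyperedge[OF assms(1) i(1)] i(2) by (simp add: P)
  qed
qed

text \<open>The underlying hyperpath has at least three hyperedges, so the second one has a
  predecessor and a successor besides the pendant hyperedge. Two short legs are the first path
  hyperedge and the pendant one.\<close>

lemma F_hg_facts:
  assumes k: "k \<ge> 3" and m: "m \<ge> 4"
    and c: "c \<in> path_hyperedge k 2" "cored (hyperpath k (m - 1)) c"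
  shows "F_hg m k c \<in> uniform_hypertrees k m" "max_degree_two (F_hg m k c)"
    "spider (F_hg m k c) (path_hyperedge k 2)" "short_legs (F_hg m k c) (path_hyperedge k 2) \<ge> 2"
proof -
  let ?P = "path_hyperedge k"
  have k2: "k \<ge> 2" using k by simp
  define l where "l = m - 1"
  have l: "l \<ge> 3" "m = Suc l" using m by (auto simp: l_def)
  define N where "N = l * (k - 1) + 1"
  let ?E = "?P ` {1..l}"
  define p where "p = insert c {N..<N + (k - 1)}"
  define F where "F = F_hg m k c"
  have F: "F = HG (N + (k - 1)) (insert p ?E)"
    by (simp add: F_def F_hg_def attach_pendant_def hyperpath_def l_def N_def p_def)
  have UE: "\<Union>?E = {..<N}"
    using Union_path_hyperedges[of l k] l by (auto simp: N_def)
  have PN: "?P i \<subseteq> {..<N}" if "i \<in> {1..l}" for i using UE that by blast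
  have two: "2 \<in> {1..l}" using l by simp
  have cN: "c < N" using PN[OF two] c(1) by auto
  have finE: "finite ?E" by simp
  have only: "{e \<in> ?E. c \<in> e} = {?P 2}"
  proof -
    have "card {e \<in> ?E. c \<in> e} = 1"
      using c(2) by (simp add: cored_def degree_def hyperpath_def l_def)
    moreover have "?P 2 \<in> {e \<in> ?E. c \<in> e}" using c(1) two by blast
    ultimately show ?thesis by (metis card_1_singletonE singletonD)
  qed
  have cardp: "card p = k" "finite p" using cN k by (auto simp: p_def)
  have pE: "p \<inter> \<Union>?E = {c}" unfolding UE p_def using cN by auto
  have p_new: "p \<notin> ?E" by (rule grown_step_new[OF k2 cardp(1) pE])
  have gr: "grown k (insert p ?E)"
    using grown_path_hyperedges[OF k2, of l] l cardp pE by (intro grown.step) auto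
  have "\<Union>(insert p ?E) = {..<N + (k - 1)}"
    using UE cN by (auto simp: p_def)
  then have "hypertree F" "uniform k F"
    unfolding F using grown_hypertree[OF gr k2] by auto
  moreover have "card (edges F) = m"
    using card_image_path_hyperedge[OF k2, of "{1..l}" l] p_new l by (simp add: F)
  ultimately show FC: "F_hg m k c \<in> uniform_hypertrees k m"
    by (simp add: uniform_hypertrees_def F_def)
  have "degree F v \<le> 2" for v
  proof (cases "v \<in> p")
    case False
    then have "{e \<in> insert p ?E. v \<in> e} = {e \<in> ?E. v \<in> e}" by auto
    then show ?thesis using vdeg_path_hyperedges[OF k2, of l v] by (simp add: F degree_eq_vdeg vdeg_def)
  next
    case True
    have "{e \<in> ?E. v \<in> e} \<subseteq> {?P 2}"
    proof (cases "v = c")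
      case False
      then have "v \<notin> \<Union>?E" using True unfolding UE p_def by auto
      then show ?thesis by blast
    qed (use only in simp)
    then have "{e \<in> insert p ?E. v \<in> e} \<subseteq> {p, ?P 2}" by blast
    then have "card {e \<in> insert p ?E. v \<in> e} \<le> card {p, ?P 2}" by (intro card_mono) auto
    also have "\<dots> \<le> 2" by (simp add: card_insert_if)
    finally show ?thesis by (simp add: F degree_eq_vdeg vdeg_def)
  qed
  then show "max_degree_two (F_hg m k c)" by (simp add: max_degree_two_def F_def)
  have touch: "?P i \<inter> p \<noteq> {} \<longleftrightarrow> i = 2" if i: "i \<in> {1..l}" for i
  proof
    assume "?P i \<inter> p \<noteq> {}"
    then obtain x where "x \<in> ?P i" "x \<in> p" by blast
    then have "x \<in> p \<inter> \<Union>?E" using i by blast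
    then have "x = c" unfolding pE by simp
    then have "?P i \<in> {e \<in> ?E. c \<in> e}" using \<open>x \<in> ?P i\<close> i by blast
    then have "?P i = ?P 2" unfolding only by simp
    then show "i = 2" using inj_onD[OF path_hyperedge_inj[OF k2] _ i two] by blast
  next
    assume "i = 2"
    then show "?P i \<inter> p \<noteq> {}" using c(1) by (auto simp: p_def)
  qed
  have nbp: "nbrs (edges F) p = {?P 2}"
  proof (intro equalityI subsetI)
    fix e assume "e \<in> nbrs (edges F) p"
    then have "e \<in> insert p ?E \<and> e \<noteq> p \<and> e \<inter> p \<noteq> {}"
      unfolding nbrs_def F hgraph.sel by blast
    then obtain i where "i \<in> {1..l}" "e = ?P i" "?P i \<inter> p \<noteq> {}" by blast
    then show "e \<in> {?P 2}" using touch by simp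
  next
    fix e assume "e \<in> {?P 2}"
    then have "e \<in> ?E" "e \<inter> p \<noteq> {}" using touch[OF two] two by simp_all
    moreover have "e \<noteq> p" using p_new calculation(1) by blast
    ultimately show "e \<in> nbrs (edges F) p" unfolding nbrs_def F by simp
  qed
  have nbP: "nbrs (edges F) (?P i) = ?P ` ({i - 1, i + 1} \<inter> {1..l}) \<union> (if i = 2 then {p} else {})"
    if i: "i \<in> {1..l}" for i
  proof -
    have "?P i \<noteq> p" using p_new i by blast
    then have "nbrs (edges F) (?P i) = nbrs ?E (?P i) \<union> (if ?P i \<inter> p \<noteq> {} then {p} else {})"
      by (auto simp: nbrs_def F)
    then show ?thesis using nbrs_path_hyperedge[OF k2 i] touch[OF i] by simp
  qed
  have cardP: "card (?P ` ({i - 1, i + 1} \<inter> {1..l})) = card ({i - 1, i + 1} \<inter> {1..l})" for i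
    by (rule card_image_path_hyperedge[OF k2, of _ l]) simp
  have small: "card ({i - 1, i + 1} \<inter> {1..l}) \<le> 2" for i
  proof -
    have "card ({i - 1, i + 1} \<inter> {1..l}) \<le> card {i - 1, i + 1}" by (intro card_mono) auto
    also have "\<dots> \<le> 2" by (simp add: card_insert_if)
    finally show ?thesis .
  qed
  have c2: "nbr_count F (?P 2) = 3"
  proof -
    have "{2 - 1, 2 + 1} \<inter> {1..l} = {1, 3}" using l by auto
    then have nb: "nbrs (edges F) (?P 2) = insert p (?P ` {1, 3})" using nbP[OF two] by simp
    have "card (?P ` {1, 3}) = 2" using card_image_path_hyperedge[OF k2, of "{1, 3}" l] l by simp
    moreover have "p \<notin> ?P ` {1, 3}" using p_new l by auto
    ultimately show ?thesis unfolding nb by simp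
  qed
  show "spider (F_hg m k c) (?P 2)"
    unfolding spider_def F_def[symmetric]
  proof (intro conjI ballI impI)
    show "?P 2 \<in> edges F" using two by (auto simp: F)
    show "nbr_count F (?P 2) = 3" by (rule c2)
    fix e assume e: "e \<in> edges F" "e \<noteq> ?P 2"
    then consider "e = p" | i where "i \<in> {1..l}" "i \<noteq> 2" "e = ?P i"
      unfolding F hgraph.sel by blast
    then show "nbr_count F e \<le> 2"
    proof cases
      case 1
      then show ?thesis using nbp by simp
    next
      case 2
      then show ?thesis using nbP[OF 2(1)] cardP[of i] small[of i] by simp
    qed
  qed
  have "{1 - 1, 1 + 1} \<inter> {1..l} = {2}" using l by auto
  then have c1: "nbr_count F (?P 1) = 1" using nbP[of 1] l by simp
  have "?P 1 \<in> nbrs (edges F) (?P 2)" using nbP[OF two] l by auto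
  moreover have "p \<in> nbrs (edges F) (?P 2)" using nbP[OF two] by simp
  ultimately have "{?P 1, p} \<subseteq> {f \<in> nbrs (edges F) (?P 2). nbr_count F f = 1}"
    using c1 nbp by simp
  then have "card {?P 1, p} \<le> short_legs F (?P 2)"
    unfolding short_legs_def by (intro card_mono) (auto simp: finite_nbrs F)
  moreover have "?P 1 \<noteq> p" using p_new l by auto
  ultimately show "short_legs (F_hg m k c) (?P 2) \<ge> 2" by (simp add: F_def)
qed

section \<open>Minimality of the hyperpath, then of the spider with two short legs\<close>

lemma nbr_squares_eq:
  assumes H: "H \<in> uniform_hypertrees k m" and km: "k \<ge> 2" "m \<ge> 2" and two: "max_degree_two H"
  shows "nbr_power_sum H 2 = 4 * real m - 6 + real (\<Sum>e\<in>edges H. (nbr_count H e - 1) * (nbr_count H e - 2))"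
proof -
  have m1: "m \<ge> 1" using km by simp
  \<comment> \<open>For a positive count, \<open>q^2 = 3 q - 2 + (q - 1)(q - 2)\<close>. The sum of
    the counts is fixed, so only the last term varies, and it is nonnegative.\<close>
  have "nbr_power_sum H 2 = (\<Sum>e\<in>edges H. 3 * real (nbr_count H e) - 2 + real ((nbr_count H e - 1) * (nbr_count H e - 2)))"
    unfolding nbr_power_sum_def
  proof (rule sum.cong[OF refl])
    fix e assume "e \<in> edges H"
    then have "nbr_count H e \<ge> 1" by (rule nbr_count_pos[OF H km])
    then consider "nbr_count H e = 1" | a where "nbr_count H e = a + 2"
      by (metis One_nat_def Suc_1 le_add_diff_inverse2 le_antisym not_less_eq_eq)
    then show "(real (nbr_count H e))\<^sup>2 = 3 * real (nbr_count H e) - 2 + real ((nbr_count H e - 1) * (nbr_count H e - 2))"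
      by cases (simp_all add: power2_eq_square algebra_simps)
  qed
  also have "\<dots> = 3 * real (\<Sum>e\<in>edges H. nbr_count H e) - 2 * real (card (edges H))
      + real (\<Sum>e\<in>edges H. (nbr_count H e - 1) * (nbr_count H e - 2))"
    by (simp add: sum.distrib sum_subtractf sum_distrib_left)
  also have "\<dots> = 4 * real m - 6 + real (\<Sum>e\<in>edges H. (nbr_count H e - 1) * (nbr_count H e - 2))"
    unfolding sum_nbr_count[OF H km(1) m1 two] uniform_hypertreesD(2)[OF H km(1) m1] using m1
    by (simp add: of_nat_diff)
  finally show ?thesis .
qed

text \<open>The largest neighbour count does not grow along an isomorphism; this tells
  \<open>F\<close> from the hyperpath.\<close>

lemma hg_iso_nbr_count_le:
  assumes iso: "hg_iso G H" and sub: "\<And>e. e \<in> edges G \<Longrightarrow> e \<subseteq> {..<nverts G}" and fin: "finite (edges G)"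
    and e: "e \<in> edges H"
  shows "\<exists>e'\<in>edges G. nbr_count H e \<le> nbr_count G e'"
proof -
  obtain f where f: "inj_on f {..<nverts G}" "edges H = (\<lambda>e. f ` e) ` edges G"
    using iso by (auto simp: hg_iso_def bij_betw_def)
  obtain e' where e': "e' \<in> edges G" "e = f ` e'" using e f(2) by blast
  have "nbrs (edges H) e \<subseteq> (\<lambda>e. f ` e) ` nbrs (edges G) e'"
  proof
    fix g assume "g \<in> nbrs (edges H) e"
    then obtain g' where g': "g' \<in> edges G" "g = f ` g'" "g \<noteq> e" "g \<inter> e \<noteq> {}"
      using f(2) by (auto simp: nbrs_def)
    then have "f ` (g' \<inter> e') \<noteq> {}"
      using inj_on_image_Int[OF f(1) sub sub, of g' e'] e' by simp
    then show "g \<in> (\<lambda>e. f ` e) ` nbrs (edges G) e'"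
      using g' e' by (auto simp: nbrs_def)
  qed
  then have "nbr_count H e \<le> nbr_count G e'"
    using surj_card_le[OF finite_nbrs[OF fin]] by blast
  then show ?thesis using e'(1) by blast
qed

text \<open>If all counts were at most two, their sum \<open>2 (m - 1) < 2 m\<close> would force a
  leaf, and from a leaf the hypertree unrolls as a hyperpath.\<close>

lemma branching_edge_exists:
  assumes H: "H \<in> uniform_hypertrees k m" and km: "k \<ge> 2" "m \<ge> 2" and two: "max_degree_two H"
    and no: "\<not> hg_iso (hyperpath k m) H"
  shows "\<exists>e\<in>edges H. nbr_count H e \<ge> 3"
proof (rule ccontr)
  assume "\<not> (\<exists>e\<in>edges H. nbr_count H e \<ge> 3)"
  then have le: "nbr_count H e \<le> 2" if "e \<in> edges H" for e
    using that by (force simp: not_le)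
  have m1: "m \<ge> 1" using km by simp
  note H' = uniform_hypertreesD[OF H km(1) m1]
  have "\<exists>g\<in>edges H. nbr_count H g \<le> 1"
  proof (rule ccontr)
    assume "\<not> (\<exists>g\<in>edges H. nbr_count H g \<le> 1)"
    then have "(\<Sum>e\<in>edges H. nbr_count H e) \<ge> (\<Sum>e\<in>edges H. 2)"
      by (intro sum_mono) (force simp: not_le)
    then show False using sum_nbr_count[OF H km(1) m1 two] H'(2) m1 by simp
  qed
  then obtain g where "g \<in> edges H" "nbr_count H g \<le> 1" by blast
  then show False
    using hg_iso_hyperpathI[OF H'(4,5) km(1), of g] le H'(2) no by simp
qed

text \<open>\<open>m \<ge> 4\<close> is the range in which \<open>F\<close> is not a hyperpath: for
  \<open>m = 3\<close> the second hyperedge of the shorter hyperpath is its last one, and the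
  pendant hyperedge would just prolong it.\<close>

theorem theorem6p3:
  fixes k m c :: nat and \<alpha> :: real
  assumes "k \<ge> 3" and "m \<ge> 4" and "0 < \<alpha>" and "\<alpha> < 1"
    and "c \<in> path_hyperedge k 2" and "cored (hyperpath k (m - 1)) c"
  shows "is_second \<alpha> k (uniform_hypertrees k m) (F_hg m k c)"
proof -
  let ?C = "uniform_hypertrees k m" and ?P = "hyperpath k m" and ?F = "F_hg m k c"
  \<comment> \<open>Up to a constant, the sum of the squared neighbour counts. It is 0 on the
    hyperpath; its next value is 2, taken on the spiders.\<close>
  let ?Z = "\<lambda>H. \<Sum>e\<in>edges H. (nbr_count H e - 1) * (nbr_count H e - 2)"
  have km: "k \<ge> 2" "m \<ge> 2" "m \<ge> 1" "m \<ge> 3" using assms by auto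
  note P = hyperpath_facts[OF km(1,3)]
  note F = F_hg_facts[OF assms(1,2,5,6)]
  have ZP: "?Z ?P = 0"
    using P(3) by (intro sum.neutral) (auto simp: le_Suc_eq numeral_2_eq_2)
  have spider_Z: "?Z H = 2" if "spider H e0" "finite (edges H)" for H e0
  proof -
    have "?Z H = (nbr_count H e0 - 1) * (nbr_count H e0 - 2) + (\<Sum>e\<in>edges H - {e0}. (nbr_count H e - 1) * (nbr_count H e - 2))"
      using that by (intro sum.remove) (auto simp: spider_def)
    moreover have "(\<Sum>e\<in>edges H - {e0}. (nbr_count H e - 1) * (nbr_count H e - 2)) = 0"
      using that by (intro sum.neutral) (auto simp: spider_def)
    ultimately show ?thesis using that by (simp add: spider_def)
  qed
  have branch_Z: "?Z H \<ge> 2 \<and> (?Z H = 2 \<longrightarrow> spider H e0)"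
    if e0: "e0 \<in> edges H" "nbr_count H e0 \<ge> 3" and fin: "finite (edges H)" for H e0
  proof -
    have split: "?Z H = (nbr_count H e0 - 1) * (nbr_count H e0 - 2) + (\<Sum>e\<in>edges H - {e0}. (nbr_count H e - 1) * (nbr_count H e - 2))"
      using e0 fin by (intro sum.remove) auto
    \<comment> \<open>With \<open>a + 3\<close> neighbours the branching term is
      \<open>(a + 2)(a + 1) = 2 + a (a + 3)\<close>, so the total 2 forces \<open>a = 0\<close> and
      every other term to vanish.\<close>
    obtain a where a: "nbr_count H e0 = a + 3" using e0(2) by (metis le_add_diff_inverse2)
    have sq: "(nbr_count H e0 - 1) * (nbr_count H e0 - 2) = 2 + a * (a + 3)"
      by (simp add: a algebra_simps)
    have "spider H e0" if "?Z H = 2"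
    proof -
      have "a = 0" using split that unfolding sq by auto
      moreover have "(\<Sum>e\<in>edges H - {e0}. (nbr_count H e - 1) * (nbr_count H e - 2)) = 0"
        using split that unfolding sq by linarith
      then have "\<forall>e\<in>edges H - {e0}. (nbr_count H e - 1) * (nbr_count H e - 2) = 0"
        using fin by simp
      ultimately show ?thesis using e0(1) a by (force simp: spider_def)
    qed
    then show ?thesis using split unfolding sq by linarith
  qed
  have squares: "prec \<alpha> k G H"
    if "G \<in> ?C" "H \<in> ?C" "max_degree_two G" "max_degree_two H" "?Z G < ?Z H" for G H
    using that nbr_squares_eq[OF that(1) km(1,2) that(3)] nbr_squares_eq[OF that(2) km(1,2) that(4)]
    by (intro prec_of_nbr_squares[OF that(1,2) assms(1-4) that(3,4)]) (simp only: add_strict_left_mono of_nat_less_iff)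
  have first: "is_first \<alpha> k ?C ?P"
    unfolding is_first_def
  proof (intro conjI ballI impI)
    fix H assume H: "H \<in> ?C" "\<not> hg_iso ?P H"
    show "prec \<alpha> k ?P H"
    proof (cases "max_degree_two H")
      case False
      then show ?thesis using prec_of_large_degree[OF P(1) H(1) assms(1-3) P(2)] by simp
    next
      case True
      then obtain e0 where "e0 \<in> edges H" "nbr_count H e0 \<ge> 3"
        using branching_edge_exists[OF H(1) km(1,2) _ H(2)] by blast
      then have "?Z H \<ge> 2" using branch_Z uniform_hypertreesD(3)[OF H(1) km(1,3)] by blast
      then show ?thesis using squares[OF P(1) H(1) P(2) True] ZP by simp
    qed
  qed (rule P(1))
  have "is_first \<alpha> k {H \<in> ?C. \<not> hg_iso ?P H} ?F"
    unfolding is_first_def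
  proof (intro conjI ballI impI)
    have "\<not> hg_iso ?P ?F"
    proof
      assume iso: "hg_iso ?P ?F"
      have "path_hyperedge k 2 \<in> edges ?F" "nbr_count ?F (path_hyperedge k 2) = 3"
        using F(3) by (auto simp: spider_def)
      then obtain e where "e \<in> edges ?P" "3 \<le> nbr_count ?P e"
        using hg_iso_nbr_count_le[OF iso _ uniform_hypertreesD(3)[OF P(1) km(1,3)]]
          uniform_edgeD(2)[OF uniform_hypertreesD(1)[OF P(1) km(1,3)]] by metis
      then show False using P(3)[of e] by simp
    qed
    then show "?F \<in> {H \<in> ?C. \<not> hg_iso ?P H}" using F(1) by simp
  next
    fix H assume H: "H \<in> {H \<in> ?C. \<not> hg_iso ?P H}" "\<not> hg_iso ?F H"
    then have HC: "H \<in> ?C" by simp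
    note H' = uniform_hypertreesD[OF HC km(1,3)]
    show "prec \<alpha> k ?F H"
    proof (cases "max_degree_two H")
      case False
      then show ?thesis using prec_of_large_degree[OF F(1) HC assms(1-3) F(2)] by simp
    next
      case True
      then obtain e0 where e0: "e0 \<in> edges H" "nbr_count H e0 \<ge> 3"
        using branching_edge_exists[OF HC km(1,2)] H(1) by blast
      have ZF: "?Z ?F = 2" using spider_Z[OF F(3)] uniform_hypertreesD(3)[OF F(1) km(1,3)] by simp
      show ?thesis
      proof (cases "?Z H = 2")
        case False
        then have "?Z ?F < ?Z H" using branch_Z[OF e0 H'(3)] ZF by linarith
        then show ?thesis using squares[OF F(1) HC F(2) True] by simp
      next
        case Z2: True
        then have sp: "spider H e0" using branch_Z[OF e0 H'(3)] by blast
        \<comment> \<open>Two short legs would supply \<open>g1\<close> and \<open>g2\<close> for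
          \<open>hg_iso_F_hgI\<close>, but copies of \<open>F\<close> are excluded here.\<close>
        have legs: "short_legs H e0 \<le> 1"
        proof (rule ccontr)
          let ?S = "{f \<in> nbrs (edges H) e0. nbr_count H f = 1}"
          assume "\<not> short_legs H e0 \<le> 1"
          then have S2: "card ?S \<ge> 2" by (simp add: short_legs_def)
          then obtain g1 where g1: "g1 \<in> ?S" by (metis card.empty equals0I not_numeral_le_zero)
          have "card (?S - {g1}) \<ge> 1" using S2 g1 by (simp add: card_Diff_singleton)
          then obtain g2 where g2: "g2 \<in> ?S - {g1}" by (metis card.empty equals0I not_one_le_zero)
          have "hg_iso ?F H"
            using sp g1 g2
            by (intro hg_iso_F_hgI[OF H'(4,5) km(1) H'(2) km(4), of e0 g1 g2 c] assms(5,6)) (auto simp: spider_def)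
          then show False using H(2) by simp
        qed
        have dist: "(\<Sum>e\<in>edges ?F. g (nbr_count ?F e)) = (\<Sum>e\<in>edges H. g (nbr_count H e))" for g :: "nat \<Rightarrow> real"
          using spider_distribution[OF F(1) km(1,2) F(2,3)] spider_distribution[OF HC km(1,2) True sp] by simp
        \<comment> \<open>With equal power sums, the product sum of a spider depends only on its
          number of short legs, and more short legs make it smaller.\<close>
        have "nbr_power_sum ?F j = nbr_power_sum H j" for j
          unfolding nbr_power_sum_def by (rule dist[of "\<lambda>q. real q ^ j"])
        then have "nbr_product_sum ?F < nbr_product_sum H"
          using spider_product_sum[OF F(1) km(1,4) F(2,3)] spider_product_sum[OF HC km(1,4) True sp] legs F(4)
          by simp
        then show ?thesis
          using prec_of_nbr_products[OF F(1) HC assms(1-4) F(2) True dist] by simp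
      qed
    qed
  qed
  then show ?thesis using first unfolding is_second_def by blast
qed

end
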